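(* Let $d<-3$ be a square-free integer such that the quadratic number field $\mathbb{Q}(\sqrt{d})$ has class number $1$, and let $\mathbb{Z}[\omega]$ be its ring of integers. If $p$ is a rational prime such that $\left(\frac{d}{p}\right) = -1$ (equivalently, $p$ is inert in $\mathbb{Z}[\omega]$), then $\rho(\mathbb{Z}[p\omega]) = 1 + \frac{p}{2}$.
   Context: Here $\omega = \sqrt{d}$ if $d\equiv 2,3 \pmod 4$ and $\omega = \frac{1+\sqrt{d}}{2}$ if $d\equiv 1\pmod 4$, so $\mathbb{Z}[\omega]$ is the ring of integers of $\mathbb{Q}(\sqrt d)$, and $\mathbb{Z}[p\omega]$ is the order $\mathbb{Z}+p\omega\mathbb{Z}$. The condition $\left(\frac{d}{p}\right)=-1$ is to be read as: $p$ is inert in $\mathbb{Z}[\omega]$, i.e. $p\mathbb{Z}[\omega]$ is a prime ideal. The elasticity of an atomic domain $R$ is $\rho(R) = \sup\{ n/m \mid \alpha_1\cdots\alpha_n = \beta_1\cdots\beta_m,\ \alpha_i,\beta_j\in\mathrm{Irr}(R)\}$, where $\mathrm{Irr}(R)$ is the set of irreducible elements of $R$. *)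

theory Defs
  imports
    "HOL-Algebra.Algebra"
    "HOL-Algebra.Algebraic_Closure_Type"
    "HOL-Computational_Algebra.Computational_Algebra"
    "HOL-Library.Extended_Real"
begin

definition complex_ring :: "complex set \<Rightarrow> complex ring" where
  "complex_ring S = (ring_of_type_algebra :: complex ring)\<lparr>carrier := S\<rparr>"

subsection \<open>Class number\<close>

definition nonzero_ideals :: "('a, 'b) ring_scheme \<Rightarrow> 'a set set" where
  "nonzero_ideals R = {I. ideal I R \<and> I \<noteq> {\<zero>\<^bsub>R\<^esub>}}"

(* Two nonzero ideals are in the same class iff a I = b J for some nonzero a, b, i.e. iff
   they differ by a principal fractional ideal.  For a Dedekind domain every class of
   fractional ideals contains an integral ideal, so the quotient is the ideal class group. *)
definition ideal_class_rel :: "('a, 'b) ring_scheme \<Rightarrow> ('a set \<times> 'a set) set" where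
  "ideal_class_rel R =
     {(I, J). I \<in> nonzero_ideals R \<and> J \<in> nonzero_ideals R \<and>
        (\<exists>a\<in>carrier R - {\<zero>\<^bsub>R\<^esub>}. \<exists>b\<in>carrier R - {\<zero>\<^bsub>R\<^esub>}. a <#\<^bsub>R\<^esub> I = b <#\<^bsub>R\<^esub> J)}"

definition ideal_classes :: "('a, 'b) ring_scheme \<Rightarrow> 'a set set set" where
  "ideal_classes R = nonzero_ideals R // ideal_class_rel R"

definition ring_of_integers :: "complex set \<Rightarrow> complex ring" where
  "ring_of_integers K = complex_ring {x \<in> K. algebraic_int x}"

definition class_number :: "complex set \<Rightarrow> nat" where
  "class_number K = card (ideal_classes (ring_of_integers K))"

subsection \<open>Quadratic fields and their orders\<close>

definition quadratic_field :: "int \<Rightarrow> complex set" where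
  "quadratic_field d = {of_rat a + of_rat b * csqrt (of_int d) | a b. True}"

(* For negative d as well, d mod 4 lies in {0, 1, 2, 3}. *)
definition quad_omega :: "int \<Rightarrow> complex" where
  "quad_omega d =
     (if d mod 4 = 1 then (1 + csqrt (of_int d)) / 2 else csqrt (of_int d))"

(* Z + Z x.  It is closed under multiplication, and hence equal to the ring Z[x], whenever x is
   a root of a monic quadratic integer polynomial, in particular for integer multiples of
   quad_omega d with d squarefree. *)
definition quad_order :: "complex \<Rightarrow> complex ring" where
  "quad_order x = complex_ring {of_int a + of_int b * x | a b. True}"

definition inert :: "nat \<Rightarrow> complex ring \<Rightarrow> bool" where
  "inert p R \<longleftrightarrow> primeideal (PIdl\<^bsub>R\<^esub> (of_nat p)) R"

subsection \<open>Elasticity\<close>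

definition Irr :: "('a, 'b) ring_scheme \<Rightarrow> 'a set" where
  "Irr R = {a \<in> carrier R. ring_irreducible\<^bsub>R\<^esub> a}"

definition list_product :: "('a, 'b) ring_scheme \<Rightarrow> 'a list \<Rightarrow> 'a" where
  "list_product R xs = foldr (\<otimes>\<^bsub>R\<^esub>) xs \<one>\<^bsub>R\<^esub>"

(* Extended real, as the supremum may be infinite.  For a field the set is empty and the
   value is -\<infinity>, so the definition is meant for domains that are not fields. *)
definition elasticity :: "('a, 'b) ring_scheme \<Rightarrow> ereal" where
  "elasticity R =
     Sup {ereal (real (length as) / real (length bs)) | as bs.
            as \<noteq> [] \<and> bs \<noteq> [] \<and> set as \<subseteq> Irr R \<and> set bs \<subseteq> Irr R \<and>
            list_product R as = list_product R bs}"

end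

theory Submission
  imports Defs "HOL-Analysis.Analysis" "HOL-Number_Theory.Cong"
begin

text \<open>
  Let \<open>\<O>\<close> be the maximal order; it is a principal ideal domain with units \<open>\<plusminus>1\<close>, in which \<open>p\<close> is prime.
  The group \<open>G = (\<O>/p)\<^sup>* / (\<int>/p)\<^sup>*\<close> is cyclic of order \<open>p + 1\<close>, and an element of \<open>\<O>\<close> prime to \<open>p\<close>
  lies in \<open>\<int>[p\<omega>]\<close> iff its class in \<open>G\<close> is trivial. An irreducible of \<open>\<int>[p\<omega>]\<close> therefore is either a
  prime of trivial class, or a product of primes forming a minimal zero-sum sequence in \<open>G\<close>, or \<open>p\<close>
  times a product of primes forming a zero-sum free sequence. Give weight \<open>2\<close> to \<open>p\<close> and to the primes
  of trivial class and weight \<open>1\<close> to all other primes of \<open>\<O>\<close>. As \<open>G\<close> has Davenport constant \<open>p + 1\<close>,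
  every irreducible has weight between \<open>2\<close> and \<open>p + 2\<close>, which bounds the elasticity by \<open>1 + p/2\<close>.

  For equality one prime \<open>q\<close> whose class generates \<open>G\<close> is enough, because then
  \<open>(p q\<^sup>p) (p q'\<^sup>p) = p \<cdot> p \<cdot> (q q')\<^sup>p\<close>, where \<open>q'\<close> is the conjugate of \<open>q\<close>, is an equation between products of \<open>2\<close> and of
  \<open>p + 2\<close> irreducibles. Such a \<open>q\<close> is found in the manner of Dirichlet. Let \<open>\<chi>\<close> run through the characters
  of \<open>G\<close> and let \<open>L(\<chi>, t)\<close> be the sum of \<open>\<chi>(x) \<bar>x\<bar>\<^sup>-\<^sup>t\<close>. If no prime had class \<open>\<plusminus>g\<close> for a fixed
  generator \<open>g\<close>, then the sum over all \<open>\<chi>\<close> of \<open>Re \<chi>(g) ln \<bar>L(\<chi>, t)\<bar>\<close> would be bounded as \<open>t \<rightarrow> 2\<close>. But the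
  trivial character contributes a term tending to infinity, and the other terms are bounded below:
  for nonreal \<open>\<chi>\<close> because two conjugate zeros would cancel more than the simple pole, and for the
  quadratic character because \<open>\<chi>(g) = -1\<close>, so that a zero would only help.
\<close>

section \<open>Lattices spanned by 1 and x, and rings of quadratic integers\<close>

definition zspan :: "complex \<Rightarrow> complex set" where
  "zspan x = {of_int a + of_int b * x | a b. True}"

lemma zspanI [intro]: "of_int a + of_int b * x \<in> zspan x"
  by (auto simp: zspan_def)

lemma zspanE:
  assumes "z \<in> zspan x" obtains a b where "z = of_int a + of_int b * x"
  using assms by (auto simp: zspan_def)

lemma of_int_in_zspan [simp]: "of_int a \<in> zspan x"
  using zspanI[of a 0 x] by simp

lemma of_nat_in_zspan [simp]: "of_nat a \<in> zspan x"
  using of_int_in_zspan[of "int a" x] by simp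

lemma zero_in_zspan [simp]: "0 \<in> zspan x" and one_in_zspan [simp]: "1 \<in> zspan x"
  using of_int_in_zspan[of 0 x] of_int_in_zspan[of 1 x] by simp_all

lemma zspan_add [simp]: "y \<in> zspan x \<Longrightarrow> z \<in> zspan x \<Longrightarrow> y + z \<in> zspan x"
proof (elim zspanE)
  fix a b c d assume "y = of_int a + of_int b * x" "z = of_int c + of_int d * x"
  then have "y + z = of_int (a + c) + of_int (b + d) * x" by (simp add: algebra_simps)
  then show ?thesis by (metis zspanI)
qed

lemma zspan_uminus: "y \<in> zspan x \<Longrightarrow> - y \<in> zspan x"
proof (elim zspanE)
  fix a b assume "y = of_int a + of_int b * x"
  then have "- y = of_int (- a) + of_int (- b) * x" by (simp add: algebra_simps)
  then show ?thesis by (metis zspanI)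
qed

lemma zspan_diff [simp]: "y \<in> zspan x \<Longrightarrow> z \<in> zspan x \<Longrightarrow> y - z \<in> zspan x"
  using zspan_add[OF _ zspan_uminus] by fastforce

lemma zspan_uminus_iff [simp]: "- y \<in> zspan x \<longleftrightarrow> y \<in> zspan x"
  using zspan_uminus[of y x] zspan_uminus[of "- y" x] by auto

text \<open>\<open>square_in\<close> closes the lattice under products and \<open>trace_int\<close>
  under conjugation; \<open>Im_pos\<close> makes 1 and \<open>w\<close> independent over the reals,
  so that coordinates are unique.\<close>

locale quadratic_ints =
  fixes w :: complex
  assumes Im_pos: "Im w > 0"
    and square_in: "w * w \<in> zspan w"
    and trace_int: "w + cnj w \<in> \<int>"
begin

abbreviation OO :: "complex set" ("\<O>") where "\<O> \<equiv> zspan w"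

lemma w_in [simp]: "w \<in> \<O>"
  using zspanI[of 0 1 w] by simp

lemma of_int_mult_in: "y \<in> \<O> \<Longrightarrow> of_int k * y \<in> \<O>"
proof (elim zspanE)
  fix a b assume "y = of_int a + of_int b * w"
  then have "of_int k * y = of_int (k * a) + of_int (k * b) * w" by (simp add: algebra_simps)
  then show ?thesis by (metis zspanI)
qed

lemma mult_in [simp]: "y \<in> \<O> \<Longrightarrow> z \<in> \<O> \<Longrightarrow> y * z \<in> \<O>"
proof (elim zspanE)
  fix a b c d assume y: "y = of_int a + of_int b * w" and z: "z = of_int c + of_int d * w"
  have "y * z = of_int a * z + of_int (b * c) * w + of_int (b * d) * (w * w)"
    unfolding y z by (simp add: algebra_simps)
  also have "\<dots> \<in> \<O>"
    unfolding z by (intro zspan_add of_int_mult_in square_in zspanI w_in)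
  finally show ?thesis .
qed

lemma power_in [simp]: "y \<in> \<O> \<Longrightarrow> y ^ n \<in> \<O>"
  by (induction n) auto

lemma prod_mset_in [simp]: "(\<And>y. y \<in># A \<Longrightarrow> y \<in> \<O>) \<Longrightarrow> prod_mset A \<in> \<O>"
  by (induction A) auto

lemma cnj_in [simp]: "y \<in> \<O> \<Longrightarrow> cnj y \<in> \<O>"
proof (elim zspanE)
  fix a b assume y: "y = of_int a + of_int b * w"
  obtain k where "w + cnj w = of_int k" using trace_int by (elim Ints_cases)
  then have "cnj w = of_int k - w" by (simp add: algebra_simps)
  then have "cnj y = of_int (a + b * k) + of_int (- b) * w"
    unfolding y by (simp add: \<open>cnj w = of_int k - w\<close> algebra_simps)
  then show ?thesis by (metis zspanI)
qed

lemma coeffs_unique: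
  assumes "of_int a + of_int b * w = of_int c + of_int d * w"
  shows "a = c" "b = d"
proof -
  have "of_int b * Im w = of_int d * Im w" using arg_cong[OF assms, of Im] by simp
  then show "b = d" using Im_pos by simp
  then show "a = c" using arg_cong[OF assms, of Re] by simp
qed

lemma real_in_imp_int: "y \<in> \<O> \<Longrightarrow> Im y = 0 \<Longrightarrow> \<exists>k. y = of_int k"
  using Im_pos by (elim zspanE) auto

text \<open>The product with the conjugate is real and stays in the lattice, whose real elements are
  integers.\<close>

lemma norm_int:
  assumes "y \<in> \<O>" obtains k :: nat where "(cmod y)^2 = real k" "y * cnj y = of_nat k"
proof -
  obtain k where k: "y * cnj y = of_int k"
    using real_in_imp_int[of "y * cnj y"] assms by auto
  have eq: "of_real ((cmod y)^2) = (of_real (of_int k) :: complex)"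
    using k by (simp add: complex_norm_square del: of_real_power)
  then have eq': "(cmod y)^2 = of_int k" by (simp only: of_real_eq_iff)
  have "0 \<le> (cmod y)^2" by simp
  then have "k \<ge> 0" unfolding eq' by simp
  with eq' k show ?thesis by (intro that[of "nat k"]) auto
qed

lemma one_le_cmod: "y \<in> \<O> \<Longrightarrow> y \<noteq> 0 \<Longrightarrow> 1 \<le> cmod y"
proof -
  assume y: "y \<in> \<O>" "y \<noteq> 0"
  obtain k :: nat where k: "(cmod y)^2 = real k" using norm_int[OF y(1)] by metis
  moreover have "(cmod y)^2 > 0" using y by simp
  ultimately have "(cmod y)^2 \<ge> 1\<^sup>2" by simp
  then show ?thesis by (rule power2_le_imp_le) simp
qed

lemma two_le_cmod_square: "y \<in> \<O> \<Longrightarrow> y \<noteq> 0 \<Longrightarrow> cmod y \<noteq> 1 \<Longrightarrow> 2 \<le> (cmod y)^2"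
proof -
  assume y: "y \<in> \<O>" "y \<noteq> 0" "cmod y \<noteq> 1"
  obtain k :: nat where k: "(cmod y)^2 = real k" using norm_int[OF y(1)] by metis
  moreover have "(cmod y)^2 > 0" using y by simp
  moreover have "(cmod y)^2 \<noteq> 1" using y(3) norm_ge_zero[of y] by (auto simp: power2_eq_1_iff simp del: norm_ge_zero)
  ultimately show ?thesis by simp
qed

text \<open>Divisibility has to be taken relative to the ring, since \<open>dvd\<close> on the field
  of complex numbers carries no arithmetic.\<close>

definition dv :: "complex \<Rightarrow> complex \<Rightarrow> bool" (infix "dvO" 50) where
  "x dvO y \<longleftrightarrow> (\<exists>z\<in>\<O>. y = x * z)"

lemma dvI: "z \<in> \<O> \<Longrightarrow> x dvO (x * z)"
  by (auto simp: dv_def)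

lemma dvE: assumes "x dvO y" obtains z where "z \<in> \<O>" "y = x * z"
  using assms by (auto simp: dv_def)

lemma dv_refl [simp]: "x dvO x"
  using dvI[of 1 x] by simp

lemma dv_0 [simp]: "x dvO 0"
  using dvI[of 0 x] by simp

lemma dv_mult: "x dvO y \<Longrightarrow> z \<in> \<O> \<Longrightarrow> x dvO (y * z)" "x dvO y \<Longrightarrow> z \<in> \<O> \<Longrightarrow> x dvO (z * y)"
  by (auto simp: dv_def mult_ac)

lemma dv_zero_left [simp]: "0 dvO x \<longleftrightarrow> x = 0"
  by (auto simp: dv_def intro: bexI[of _ 0])

lemma dv_trans: "x dvO y \<Longrightarrow> y dvO z \<Longrightarrow> x dvO z"
  by (auto simp: dv_def mult_ac)

lemma dv_add: "x dvO y \<Longrightarrow> x dvO z \<Longrightarrow> x dvO (y + z)"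
  unfolding dv_def by (elim bexE) (metis distrib_left zspan_add)

lemma dv_uminus [simp]: "x dvO (- y) \<longleftrightarrow> x dvO y"
proof -
  have "x dvO (- y)" if *: "x dvO y" for y
  proof -
    obtain z where "z \<in> \<O>" "y = x * z" using * unfolding dv_def by metis
    then have "- z \<in> \<O>" "- y = x * (- z)" by auto
    then show ?thesis unfolding dv_def by metis
  qed
  from this[of y] this[of "- y"] show ?thesis by auto
qed

lemma dv_uminus_left [simp]: "(- x) dvO y \<longleftrightarrow> x dvO y"
proof -
  have "(- x) dvO y" if *: "x dvO y" for x
  proof -
    obtain z where "z \<in> \<O>" "y = x * z" using * unfolding dv_def by metis
    then have "- z \<in> \<O>" "y = (- x) * (- z)" by auto
    then show ?thesis unfolding dv_def by metis
  qed
  from this[of x] this[of "- x"] show ?thesis by auto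
qed

lemma dv_diff: "x dvO y \<Longrightarrow> x dvO z \<Longrightarrow> x dvO (y - z)"
  using dv_add[of x y "- z"] by simp

lemma of_int_dv_iff: "of_int k dvO (of_int a + of_int b * w) \<longleftrightarrow> k dvd a \<and> k dvd b"
proof
  assume "of_int k dvO (of_int a + of_int b * w)"
  then obtain c d where "of_int a + of_int b * w = of_int k * (of_int c + of_int d * w)" by (auto elim!: dvE zspanE)
  then have "of_int a + of_int b * w = of_int (k * c) + of_int (k * d) * w"
    by (simp add: algebra_simps)
  from coeffs_unique[OF this] show "k dvd a \<and> k dvd b" by auto
next
  assume "k dvd a \<and> k dvd b"
  then obtain c d where "a = k * c" "b = k * d" by (auto elim!: dvdE)
  then have "of_int a + of_int b * w = of_int k * (of_int c + of_int d * w)"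
    by (simp add: algebra_simps)
  then show "of_int k dvO (of_int a + of_int b * w)" by (metis dvI zspanI)
qed

lemma dv_cmod_le: "x dvO y \<Longrightarrow> y \<noteq> 0 \<Longrightarrow> cmod x \<le> cmod y"
proof -
  assume "x dvO y" "y \<noteq> 0"
  then obtain z where "z \<in> \<O>" "y = x * z" "z \<noteq> 0" by (auto elim!: dvE)
  then show ?thesis using one_le_cmod[of z] by (simp add: norm_mult mult_le_cancel_left1)
qed

lemma dv_cnj: "x dvO y \<Longrightarrow> cnj x dvO cnj y"
  by (auto simp: dv_def)

end

text \<open>The arithmetic input in elementary form: \<open>unit\<close> records the effect of d <
  -3, \<open>bezout\<close> that of class number 1, and \<open>p_inert\<close> that p generates a
  prime ideal.\<close>

locale inert_quadratic = quadratic_ints +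
  fixes p :: nat
  assumes unit: "\<And>y. y \<in> \<O> \<Longrightarrow> cmod y = 1 \<Longrightarrow> y = 1 \<or> y = - 1"
    and bezout: "\<And>x y. x \<in> \<O> \<Longrightarrow> y \<in> \<O> \<Longrightarrow>
      \<exists>u\<in>\<O>. \<exists>v\<in>\<O>. (u * x + v * y) dvO x \<and> (u * x + v * y) dvO y"
    and p_prime: "Factorial_Ring.prime p"
    and p_inert: "\<And>x y. x \<in> \<O> \<Longrightarrow> y \<in> \<O> \<Longrightarrow> of_nat p dvO (x * y) \<Longrightarrow>
      of_nat p dvO x \<or> of_nat p dvO y"
begin

subsection \<open>Factorisation in the maximal order\<close>

text \<open>Prime elements of the maximal order; among nonzero elements, modulus 1 characterises the
  units.\<close>

definition prO :: "complex \<Rightarrow> bool" where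
  "prO q \<longleftrightarrow> q \<in> \<O> \<and> q \<noteq> 0 \<and> cmod q \<noteq> 1 \<and> (\<forall>x\<in>\<O>. \<forall>y\<in>\<O>. q dvO (x * y) \<longrightarrow> q dvO x \<or> q dvO y)"

lemma prO_in: "prO q \<Longrightarrow> q \<in> \<O>" and prO_nz: "prO q \<Longrightarrow> q \<noteq> 0" and prO_nunit: "prO q \<Longrightarrow> cmod q \<noteq> 1"
  and prO_dv_mult: "prO q \<Longrightarrow> q dvO (x * y) \<Longrightarrow> x \<in> \<O> \<Longrightarrow> y \<in> \<O> \<Longrightarrow> q dvO x \<or> q dvO y"
  by (auto simp: prO_def)

lemma prO_cmod_gt: "prO q \<Longrightarrow> cmod q > 1"
  using one_le_cmod[of q] by (auto simp: prO_def)

lemma p_gt_1: "p > 1" using p_prime prime_gt_1_nat by blast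

lemma prO_p: "prO (of_nat p)"
  using p_gt_1 p_inert by (auto simp: prO_def)

lemma prO_uminus [simp]: "prO (- q) \<longleftrightarrow> prO q"
proof -
  have "prO (- q)" if "prO q" for q
  proof -
    have "(- q) dvO x \<longleftrightarrow> q dvO x" for x
      by (simp add: dv_uminus_left)
    with that show ?thesis by (auto simp: prO_def)
  qed
  from this[of q] this[of "- q"] show ?thesis by auto
qed

text \<open>A common divisor c of q and x that is a combination of both divides q. If c is a unit, y
  becomes a sum of multiples of q; if c is an associate of q, then q divides x.\<close>

lemma irreducible_imp_prO:
  assumes q: "q \<in> \<O>" "q \<noteq> 0" "cmod q \<noteq> 1"
    and irr: "\<And>x y. x \<in> \<O> \<Longrightarrow> y \<in> \<O> \<Longrightarrow> q = x * y \<Longrightarrow> cmod x = 1 \<or> cmod y = 1"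
  shows "prO q"
  unfolding prO_def
proof (intro conjI ballI impI q)
  fix x y assume xy: "x \<in> \<O>" "y \<in> \<O>" "q dvO (x * y)"
  obtain u v where uv: "u \<in> \<O>" "v \<in> \<O>" "(u * q + v * x) dvO q" "(u * q + v * x) dvO x"
    using bezout[OF q(1) xy(1)] by blast
  define c where "c = u * q + v * x"
  have c: "c \<in> \<O>" unfolding c_def using uv q xy by simp
  obtain z where z: "z \<in> \<O>" "q = c * z" using uv(3) unfolding c_def[symmetric] by (rule dvE)
  from irr[OF c z] show "q dvO x \<or> q dvO y"
  proof
    assume "cmod c = 1"
    then have "c * c = 1" using unit[OF c] by auto
    then have "y = c * (c * y)" by (simp flip: mult.assoc)
    also have "c * y = q * (u * y) + (x * y) * v"
      unfolding c_def by (simp add: algebra_simps)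
    finally have *: "y = c * (q * (u * y) + (x * y) * v)" .
    have "q dvO (q * (u * y))" "q dvO ((x * y) * v)"
      using uv(1,2) xy by (auto intro: dvI dv_mult(1))
    then have "q dvO (c * (q * (u * y) + (x * y) * v))"
      using c by (intro dv_mult(2)[OF dv_add])
    then show ?thesis using * by simp
  next
    assume "cmod z = 1"
    then have "z * z = 1" using unit[OF z(1)] by auto
    then have "c = q * z" using z by (simp add: mult.assoc)
    then have "q dvO c" using dvI[OF z(1), of q] by simp
    then show ?thesis using dv_trans[of q c x] uv(4) c_def by simp
  qed
qed

text \<open>If q divides x, then |x| is at least |q| = |x| |y|, which forces |y| to be 1.\<close>

lemma prO_irreducible:
  assumes "prO q" "q = x * y" "x \<in> \<O>" "y \<in> \<O>"
  shows "cmod x = 1 \<or> cmod y = 1"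
proof -
  have nz: "x \<noteq> 0" "y \<noteq> 0" using assms prO_nz[of q] by auto
  have "cmod q = cmod x * cmod y" using assms by (simp add: norm_mult)
  moreover have "q dvO x \<or> q dvO y" using assms prO_dv_mult[of q x y] by simp
  moreover have "q dvO x \<Longrightarrow> cmod q \<le> cmod x" "q dvO y \<Longrightarrow> cmod q \<le> cmod y"
    using dv_cmod_le nz by auto
  moreover have ge: "cmod x \<ge> 1" "cmod y \<ge> 1" using one_le_cmod assms nz by auto
  ultimately have "cmod x * cmod y \<le> cmod x * 1 \<or> cmod x * cmod y \<le> 1 * cmod y" by auto
  then have "cmod y \<le> 1 \<or> cmod x \<le> 1"
    unfolding mult_le_cancel_left mult_le_cancel_right using ge by auto
  then show ?thesis using ge by auto
qed

text \<open>Squared moduli are natural numbers, so descent along the real-valued modulus is well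
  founded on the ring.\<close>

lemma norm_induct [consumes 1, case_names less]:
  assumes "x \<in> \<O>"
    and "\<And>x. x \<in> \<O> \<Longrightarrow> (\<And>y. y \<in> \<O> \<Longrightarrow> cmod y < cmod x \<Longrightarrow> P y) \<Longrightarrow> P x"
  shows "P x"
  using assms(1)
proof (induction "nat \<lfloor>(cmod x)^2\<rfloor>" arbitrary: x rule: less_induct)
  case less
  show ?case
  proof (rule assms(2)[OF less(2)])
    fix y assume y: "y \<in> \<O>" "cmod y < cmod x"
    obtain k :: nat where k: "(cmod x)^2 = real k" using norm_int[OF less(2)] by metis
    obtain l :: nat where l: "(cmod y)^2 = real l" using norm_int[OF y(1)] by metis
    have "(cmod y)^2 < (cmod x)^2" using y by (intro power_strict_mono) auto
    then show "P y" using less(1)[of y] y k l by simp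
  qed
qed

lemma exists_prO_factorization:
  assumes "x \<in> \<O>" "x \<noteq> 0"
  shows "\<exists>A u. (\<forall>q\<in>#A. prO q) \<and> (u = 1 \<or> u = - 1) \<and> x = u * prod_mset A"
  using assms
proof (induction x rule: norm_induct)
  case (less x)
  show ?case
  proof (cases "cmod x = 1 \<or> prO x")
    case True
    then show ?thesis
    proof
      assume "cmod x = 1"
      then have "x = 1 \<or> x = -1" using unit less by blast
      then show ?thesis by (intro exI[of _ "{#}"]) auto
    next
      assume "prO x"
      then show ?thesis by (intro exI[of _ "{#x#}"]) auto
    qed
  next
    case False
    then obtain y z where yz: "y \<in> \<O>" "z \<in> \<O>" "x = y * z" "cmod y \<noteq> 1" "cmod z \<noteq> 1"
      using irreducible_imp_prO less by blast
    have nz: "y \<noteq> 0" "z \<noteq> 0" using yz less by auto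
    then have "cmod y > 1" "cmod z > 1" using one_le_cmod[of y] one_le_cmod[of z] yz by auto
    then have "cmod y < cmod x" "cmod z < cmod x" using yz nz by (auto simp: norm_mult)
    then obtain A B u v where "\<forall>q\<in>#A. prO q" "u = 1 \<or> u = - 1" "y = u * prod_mset A"
        "\<forall>q\<in>#B. prO q" "v = 1 \<or> v = - 1" "z = v * prod_mset B"
      using less.IH[OF yz(1)] less.IH[OF yz(2)] nz by blast
    then show ?thesis using yz
      by (intro exI[of _ "A + B"] exI[of _ "u * v"]) auto
  qed
qed

lemma exists_prO_dv:
  assumes "x \<in> \<O>" "x \<noteq> 0" "cmod x \<noteq> 1"
  shows "\<exists>q. prO q \<and> q dvO x"
proof -
  obtain A u where A: "\<forall>q\<in>#A. prO q" "u = 1 \<or> u = - 1" "x = u * prod_mset A"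
    using exists_prO_factorization assms by blast
  then have "A \<noteq> {#}" using assms by auto
  then obtain q B where B: "A = add_mset q B" by (metis multiset_cases)
  have "prod_mset B \<in> \<O>" using A B prO_in by auto
  moreover have "x = q * (u * prod_mset B)" using A B by simp
  ultimately have "q dvO x" using A(2) by (metis dvI mult_minus1 mult_1 zspan_uminus)
  then show ?thesis using A B by auto
qed

lemma prO_dv_prO:
  assumes "prO q" "prO r" "q dvO r"
  shows "q = r \<or> q = - r"
proof -
  obtain z where z: "z \<in> \<O>" "r = q * z" using assms(3) by (rule dvE)
  then have "cmod z = 1" using prO_irreducible[OF assms(2), of q z] assms prO_in prO_nunit by blast
  then have "z = 1 \<or> z = - 1" using unit z by simp
  then show ?thesis using z by auto
qed

lemma prO_dv_prod_mset:
  assumes "prO q" "\<forall>r\<in>#A. r \<in> \<O>" "q dvO prod_mset A"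
  shows "\<exists>r\<in>#A. q dvO r"
  using assms(2,3)
proof (induction A)
  case empty
  then show ?case using dv_cmod_le[of q 1] prO_cmod_gt[OF assms(1)] by auto
next
  case (add r A)
  then show ?case using prO_dv_mult[OF assms(1), of r "prod_mset A"] by auto
qed

text \<open>Unique factorisation, in the form used for \<open>W\<close>: any weight that ignores
  signs gives the same total. Each prime of A is matched with an associate in B and cancelled, and
  the sign is absorbed into u.\<close>

lemma factorization_weight_unique:
  fixes f :: "complex \<Rightarrow> nat"
  assumes f: "\<And>q. f (- q) = f q"
    and "\<forall>q\<in>#A. prO q" "\<forall>q\<in>#B. prO q" "prod_mset A = u * prod_mset B" "u = 1 \<or> u = - 1"
  shows "(\<Sum>q\<in>#A. f q) = (\<Sum>q\<in>#B. f q)"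
  using assms(2-)
proof (induction A arbitrary: B u)
  case empty
  have "B = {#}"
  proof (rule ccontr)
    assume "B \<noteq> {#}"
    then obtain q C where C: "B = add_mset q C" by (metis multiset_cases)
    then have "prod_mset C \<in> \<O>" using empty prO_in by auto
    then have "q dvO prod_mset B" using C dvI by simp
    then have "q dvO (u * prod_mset B)" using empty(4) by auto
    then have "q dvO 1" using empty(3) by simp
    then show False using dv_cmod_le[of q 1] prO_cmod_gt[of q] empty C by auto
  qed
  then show ?case by simp
next
  case (add q A)
  have q: "prO q" "\<forall>q\<in>#A. prO q" using add.prems by auto
  have "prod_mset A \<in> \<O>" using q prO_in by auto
  then have "q dvO prod_mset (add_mset q A)" using dvI by simp
  then have "q dvO prod_mset B" using add.prems(3,4) by auto
  then obtain r where r: "r \<in># B" "q dvO r" using prO_dv_prod_mset[OF q(1)] add.prems(2) prO_in by blast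
  then have qr: "q = r \<or> q = - r" using prO_dv_prO[OF q(1)] add.prems(2) by blast
  then obtain v where v: "r = v * q" "v = 1 \<or> v = - 1"
    by (metis minus_minus mult_1 mult_minus1)
  obtain C where C: "B = add_mset r C" using r by (metis multi_member_split)
  have "q * prod_mset A = q * ((u * v) * prod_mset C)"
    using add.prems(3) C v(1) by (simp add: mult_ac)
  then have "prod_mset A = (u * v) * prod_mset C" using prO_nz[OF q(1)] by simp
  then have "(\<Sum>q\<in>#A. f q) = (\<Sum>q\<in>#C. f q)"
    using add.IH[OF q(2), of C "u * v"] add.prems C v(2) by auto
  then show ?case using C qr f by auto
qed

text \<open>In \<open>x * z = q ^ Suc k\<close> the prime q divides x or z; cancelling it there
  lowers the exponent.\<close>

lemma dv_prO_power:
  assumes "prO q" "x \<in> \<O>" "x dvO q ^ k"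
  shows "\<exists>j\<le>k. x = q ^ j \<or> x = - (q ^ j)"
  using assms(2,3)
proof (induction k arbitrary: x)
  case 0
  then have "cmod x \<le> 1" "x \<noteq> 0" using dv_cmod_le[of x 1] by auto
  then have "cmod x = 1" using one_le_cmod[of x] 0 by auto
  then show ?case using unit 0 by auto
next
  case (Suc k)
  obtain z where z: "z \<in> \<O>" "q * q ^ k = x * z" using Suc.prems(2) by (auto elim: dvE)
  then have "q dvO x \<or> q dvO z" using prO_dv_mult[OF assms(1), of x z] Suc.prems
    by (metis assms(1) dvI power_in prO_in)
  then show ?case
  proof
    assume "q dvO x"
    then obtain y where y: "y \<in> \<O>" "x = q * y" by (rule dvE)
    then have "q ^ k = y * z" using z prO_nz[OF assms(1)] by simp
    then have "\<exists>j\<le>k. y = q ^ j \<or> y = - (q ^ j)" using Suc.IH[OF y(1)] z by (metis dvI)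
    then obtain j where "j \<le> k" "y = q ^ j \<or> y = - (q ^ j)" by blast
    then show ?thesis using y by (intro exI[of _ "Suc j"]) auto
  next
    assume "q dvO z"
    then obtain y where y: "y \<in> \<O>" "z = q * y" by (rule dvE)
    then have "q ^ k = x * y" using z prO_nz[OF assms(1)] by simp
    then show ?thesis using Suc.IH[OF Suc.prems(1)] y by (metis dvI le_SucI)
  qed
qed

lemma prO_cnj: "prO q \<Longrightarrow> prO (cnj q)"
proof -
  assume q: "prO q"
  have "cnj q dvO x \<longleftrightarrow> q dvO cnj x" for x
    using dv_cnj[of "cnj q" x] dv_cnj[of q "cnj x"] by auto
  then show ?thesis using q cnj_in by (auto simp: prO_def)
qed

end

section \<open>Subsets of the complex numbers as rings with carrier\<close>

lemma complex_ring_simps [simp]: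
  "carrier (complex_ring S) = S" "monoid.mult (complex_ring S) = (*)" "one (complex_ring S) = 1"
  "ring.zero (complex_ring S) = 0" "add (complex_ring S) = (+)"
  by (auto simp: complex_ring_def ring_of_type_algebra_def)

lemma cring_complex_ring:
  assumes "1 \<in> S" "\<And>x y. x \<in> S \<Longrightarrow> y \<in> S \<Longrightarrow> x + y \<in> S" "\<And>x. x \<in> S \<Longrightarrow> - x \<in> S"
    "\<And>x y. x \<in> S \<Longrightarrow> y \<in> S \<Longrightarrow> x * y \<in> S"
  shows "cring (complex_ring S)"
proof -
  have "0 \<in> S" using assms(2)[OF assms(1) assms(3)[OF assms(1)]] by simp
  then show ?thesis
    by (intro cringI abelian_groupI comm_monoidI)
      (auto simp: assms algebra_simps intro!: bexI[of _ "- x" for x])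
qed

context quadratic_ints
begin

lemma cring_O: "cring (complex_ring \<O>)"
  by (intro cring_complex_ring) auto

end

section \<open>The residue field modulo p\<close>

context inert_quadratic
begin

text \<open>A complete residue system modulo p, obtained by reducing both coordinates.\<close>

definition reps :: "complex set" where
  "reps = (\<lambda>(a, b). of_int a + of_int b * w) ` ({0..<int p} \<times> {0..<int p})"

lemma finite_reps: "finite reps" and reps_in: "r \<in> reps \<Longrightarrow> r \<in> \<O>"
  by (auto simp: reps_def)

lemma p_dv_iff: "of_nat p dvO (of_int a + of_int b * w) \<longleftrightarrow> int p dvd a \<and> int p dvd b"
  using of_int_dv_iff[of "int p" a b] by simp

lemma p_dv_of_int_iff: "of_nat p dvO of_int a \<longleftrightarrow> int p dvd a"
  using p_dv_iff[of a 0] by simp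

lemma reps_cover: "x \<in> \<O> \<Longrightarrow> \<exists>r\<in>reps. of_nat p dvO (x - r)"
proof (elim zspanE)
  fix a b assume x: "x = of_int a + of_int b * w"
  let ?r = "of_int (a mod int p) + of_int (b mod int p) * w"
  have "x - ?r = of_int (a - a mod int p) + of_int (b - b mod int p) * w"
    unfolding x by (simp add: algebra_simps)
  then have "of_nat p dvO (x - ?r)" by (simp only: p_dv_iff) auto
  moreover have "?r \<in> reps" using p_gt_1 by (auto simp: reps_def)
  ultimately show ?thesis by blast
qed

lemma reps_unique: "r \<in> reps \<Longrightarrow> s \<in> reps \<Longrightarrow> of_nat p dvO (r - s) \<Longrightarrow> r = s"
proof -
  assume rs: "r \<in> reps" "s \<in> reps" and dv: "of_nat p dvO (r - s)"
  obtain a b c d where *: "r = of_int a + of_int b * w" "s = of_int c + of_int d * w"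
      "a \<in> {0..<int p}" "b \<in> {0..<int p}" "c \<in> {0..<int p}" "d \<in> {0..<int p}"
    using rs by (auto simp: reps_def)
  have "r - s = of_int (a - c) + of_int (b - d) * w" unfolding * by (simp add: algebra_simps)
  with dv have "int p dvd a - c" "int p dvd b - d" by (simp_all only: p_dv_iff)
  then have "a mod int p = c mod int p" "b mod int p = d mod int p" by (simp_all add: mod_eq_dvd_iff)
  then show "r = s" using * by simp
qed

text \<open>Since p is inert and divides neither x nor its conjugate, the norm of x is an integer
  prime to p; its inverse modulo p times the conjugate inverts x.\<close>

lemma inverse_mod_p:
  assumes "x \<in> \<O>" "\<not> of_nat p dvO x"
  shows "\<exists>y\<in>\<O>. of_nat p dvO (x * y - 1)"
proof -
  obtain k :: nat where k: "x * cnj x = of_nat k" using norm_int[OF assms(1)] by metis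
  have "\<not> of_nat p dvO cnj x" using dv_cnj[of "of_nat p" "cnj x"] assms by auto
  then have "\<not> of_nat p dvO of_int (int k)" using p_inert[of x "cnj x"] assms k by auto
  then have "\<not> p dvd k" unfolding p_dv_of_int_iff by simp
  then have "coprime (int k) (int p)"
    using p_prime prime_imp_coprime[of p k] by (simp add: coprime_commute)
  then obtain e where "[int k * e = 1] (mod int p)" using cong_solve_coprime_int by blast
  then have "int p dvd int k * e - 1" by (simp add: cong_iff_dvd_diff)
  then have "of_nat p dvO of_int (int k * e - 1)" by (simp only: p_dv_of_int_iff)
  moreover have "of_int (int k * e - 1) = x * (of_int e * cnj x) - 1"
    using k by simp
  ultimately show ?thesis by (metis cnj_in of_int_mult_in assms(1))
qed

text \<open>The quotient by p is a field by \<open>inverse_mod_p\<close> and finite by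
  \<open>reps_cover\<close>, so its multiplicative group is cyclic. A generator is lifted to the
  ring.\<close>

lemma exists_generator:
  "\<exists>g\<in>\<O>. \<not> of_nat p dvO g \<and> (\<forall>x\<in>\<O>. \<not> of_nat p dvO x \<longrightarrow> (\<exists>i. of_nat p dvO (x - g ^ i)))"
proof -
  define R where "R = complex_ring \<O>"
  interpret cring R unfolding R_def by (rule cring_O)
  have Rs: "carrier R = \<O>" "monoid.mult R = (*)" "one R = 1" "ring.zero R = 0" "add R = (+)"
    by (simp_all add: R_def)
  define I where "I = PIdl\<^bsub>R\<^esub> (of_nat p)"
  have I: "x \<in> I \<longleftrightarrow> of_nat p dvO x" for x
    by (auto simp: I_def cgenideal_def Rs dv_def mult.commute)
  interpret I: ideal I R unfolding I_def by (rule cgenideal_ideal) (simp add: Rs)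
  define Q where "Q = R Quot I"
  interpret Q: cring Q unfolding Q_def by (rule I.quotient_is_cring) (rule is_cring)
  define h where "h = a_r_coset R I"
  have hom: "h \<in> ring_hom R Q" unfolding h_def Q_def by (rule I.rcos_ring_hom)
  have h_mult: "h (x * y) = h x \<otimes>\<^bsub>Q\<^esub> h y" if "x \<in> \<O>" "y \<in> \<O>" for x y
    using ring_hom_mult[OF hom, of x y] that by (simp add: Rs)
  have h_one: "h 1 = \<one>\<^bsub>Q\<^esub>" using ring_hom_one[OF hom] by (simp add: Rs)
  have h_mem: "z \<in> h x \<longleftrightarrow> of_nat p dvO (z - x)" for x z
  proof -
    have "h x = (\<Union>i\<in>I. {i + x})" by (simp add: h_def a_r_coset_def' Rs)
    then show ?thesis using I by (force simp: algebra_simps)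
  qed
  have h_eq: "h x = h y \<longleftrightarrow> of_nat p dvO (x - y)" for x y
  proof
    assume "h x = h y"
    then show "of_nat p dvO (x - y)" using h_mem[of x x] h_mem[of x y] by simp
  next
    assume *: "of_nat p dvO (x - y)"
    show "h x = h y"
    proof (intro Set.set_eqI)
      fix z
      show "z \<in> h x \<longleftrightarrow> z \<in> h y"
        using dv_add[OF _ *, of "z - x"] dv_diff[OF _ *, of "z - y"] by (auto simp: h_mem)
    qed
  qed
  have car: "carrier Q = h ` \<O>"
    by (auto simp: Q_def FactRing_def A_RCOSETS_def' h_def Rs)
  have zero: "\<zero>\<^bsub>Q\<^esub> = h 0" using ring_hom_zero[OF hom ring_axioms Q.ring_axioms] by (simp add: Rs)
  have "field Q"
  proof (rule Q.cring_fieldI2)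
    have "\<not> of_nat p dvO (0 - 1)" using p_dv_of_int_iff[of "- 1"] p_gt_1 by simp
    then show "\<zero>\<^bsub>Q\<^esub> \<noteq> \<one>\<^bsub>Q\<^esub>" unfolding zero h_one[symmetric] h_eq by simp
  next
    fix a assume "a \<in> carrier Q" "a \<noteq> \<zero>\<^bsub>Q\<^esub>"
    then obtain x where x: "x \<in> \<O>" "a = h x" "h x \<noteq> h 0" using car zero by auto
    then have "\<not> of_nat p dvO x" using h_eq[of x 0] by simp
    then obtain y where y: "y \<in> \<O>" "of_nat p dvO (x * y - 1)" using inverse_mod_p x by blast
    then have "h (x * y) = h 1" using h_eq[of "x * y" 1] x by simp
    then show "\<exists>b\<in>carrier Q. a \<otimes>\<^bsub>Q\<^esub> b = \<one>\<^bsub>Q\<^esub>" using h_mult h_one x y car by auto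
  qed
  then interpret Q: field Q .
  have "carrier Q \<subseteq> h ` reps"
  proof
    fix a assume "a \<in> carrier Q"
    then obtain x where x: "x \<in> \<O>" "a = h x" using car by auto
    then obtain r where "r \<in> reps" "of_nat p dvO (x - r)" using reps_cover by blast
    then show "a \<in> h ` reps" using x h_eq[of x r] reps_in by auto
  qed
  then have "finite (carrier Q)" using finite_reps by (meson finite_surj)
  from Q.finite_field_mult_group_has_gen[OF this] obtain a where a: "a \<in> carrier Q - {\<zero>\<^bsub>Q\<^esub>}" "carrier Q - {\<zero>\<^bsub>Q\<^esub>} = {a [^]\<^bsub>Q\<^esub> i | i::nat. i \<in> UNIV}"
    unfolding Multiplicative_Group.carrier_mult_of by (elim bexE)
  obtain g where g: "g \<in> \<O>" "a = h g" "h g \<noteq> h 0" using a(1) car zero by auto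
  have pow: "h (g ^ i) = a [^]\<^bsub>Q\<^esub> i" for i
  proof (induction i)
    case (Suc i)
    have "h (g ^ Suc i) = h (g ^ i) \<otimes>\<^bsub>Q\<^esub> h g" using h_mult[of "g ^ i" g] g by (simp add: mult.commute)
    then show ?case using Suc g by simp
  qed (simp add: h_one)
  show ?thesis
  proof (intro bexI[of _ g] conjI ballI impI)
    show "\<not> of_nat p dvO g" using g h_eq[of g 0] by simp
  next
    fix x assume x: "x \<in> \<O>" "\<not> of_nat p dvO x"
    then have "h x \<in> carrier Q - {\<zero>\<^bsub>Q\<^esub>}" using car zero h_eq[of x 0] by auto
    then obtain i where "h x = a [^]\<^bsub>Q\<^esub> (i::nat)" using a(2) by auto
    then have "h x = h (g ^ i)" using pow by simp
    then show "\<exists>i. of_nat p dvO (x - g ^ i)" using h_eq[of x "g ^ i"] x g by auto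
  qed (use g in auto)
qed

section \<open>The order of conductor p\<close>

abbreviation SS :: "complex set" ("\<S>") where "\<S> \<equiv> zspan (of_nat p * w)"

lemma sub_iff: "of_int a + of_int b * w \<in> \<S> \<longleftrightarrow> int p dvd b"
proof
  assume "of_int a + of_int b * w \<in> \<S>"
  then obtain c d where "of_int a + of_int b * w = of_int c + of_int d * (of_nat p * w)"
    by (elim zspanE)
  then have "of_int a + of_int b * w = of_int c + of_int (d * int p) * w" by (simp add: mult.assoc)
  from coeffs_unique(2)[OF this] show "int p dvd b" by simp
next
  assume "int p dvd b"
  then obtain d where "b = int p * d" by (elim dvdE)
  then have "of_int a + of_int b * w = of_int a + of_int d * (of_nat p * w)" by simp
  then show "of_int a + of_int b * w \<in> \<S>" by (metis zspanI)
qed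

lemma sub_in: "x \<in> \<S> \<Longrightarrow> x \<in> \<O>"
proof (elim zspanE)
  fix a b assume "x = of_int a + of_int b * (of_nat p * w)"
  then have "x = of_int a + of_int (b * int p) * w" by simp
  then show "x \<in> \<O>" by (metis zspanI)
qed

lemma p_mult_sub: "x \<in> \<O> \<Longrightarrow> of_nat p * x \<in> \<S>"
proof (elim zspanE)
  fix a b assume "x = of_int a + of_int b * w"
  then have "of_nat p * x = of_int (int p * a) + of_int b * (of_nat p * w)" by (simp add: algebra_simps)
  then show "of_nat p * x \<in> \<S>" by (metis zspanI)
qed

lemma p_dv_sub: "of_nat p dvO x \<Longrightarrow> x \<in> \<S>"
  using p_mult_sub by (auto elim: dvE)

lemma sub_mult [simp]: "x \<in> \<S> \<Longrightarrow> y \<in> \<S> \<Longrightarrow> x * y \<in> \<S>"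
proof -
  assume xy: "x \<in> \<S>" "y \<in> \<S>"
  then obtain a b c d where "x = of_int a + of_int b * (of_nat p * w)" "y = of_int c + of_int d * (of_nat p * w)"
    by (metis zspanE)
  then have "x * y = (of_int (a * c) + of_int (a * d + b * c) * (of_nat p * w))
      + of_nat p * (of_int (b * d) * of_nat p * (w * w))"
    by (simp add: algebra_simps)
  moreover have "of_nat p * (of_int (b * d) * of_nat p * (w * w)) \<in> \<S>" by (intro p_mult_sub) auto
  ultimately show ?thesis by (metis zspanI zspan_add)
qed

text \<open>Modulo p the element x is an integer a prime to p, so the coefficient of
  \<open>w\<close> in \<open>x * y\<close> is a times that of y.\<close>

lemma sub_cancel:
  assumes "x \<in> \<S>" "\<not> of_nat p dvO x" "y \<in> \<O>" "x * y \<in> \<S>"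
  shows "y \<in> \<S>"
proof -
  obtain a b where x: "x = of_int a + of_int b * (of_nat p * w)" using assms(1) by (elim zspanE)
  obtain c d where y: "y = of_int c + of_int d * w" using assms(3) by (elim zspanE)
  have "of_int a + of_int (b * int p) * w = x" unfolding x by simp
  then have "\<not> int p dvd a" using assms(2) p_dv_iff[of a "b * int p"] by auto
  have "of_nat p * (of_int b * w * y) \<in> \<S>" using assms(3) by (intro p_mult_sub) auto
  then have "x * y - of_nat p * (of_int b * w * y) \<in> \<S>" using assms(4) by simp
  also have "x * y - of_nat p * (of_int b * w * y) = of_int (a * c) + of_int (a * d) * w"
    unfolding x y by (simp add: algebra_simps)
  finally have "int p dvd a * d" by (simp only: sub_iff)
  then have "int p dvd d" using \<open>\<not> int p dvd a\<close> p_prime prime_dvd_mult_iff[of "int p" a d] by simp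
  then show ?thesis unfolding y by (simp only: sub_iff)
qed

text \<open>All multiples of p lie in the order, so membership depends on the residue modulo p
  alone.\<close>

lemma p_dv_diff_sub: "of_nat p dvO (x - y) \<Longrightarrow> y \<in> \<S> \<Longrightarrow> x \<in> \<S>"
  using zspan_add[of "x - y" "of_nat p * w" y] p_dv_sub by simp

lemma p_not_dv_mult: "x \<in> \<O> \<Longrightarrow> y \<in> \<O> \<Longrightarrow> \<not> of_nat p dvO (x * y) \<longleftrightarrow> \<not> of_nat p dvO x \<and> \<not> of_nat p dvO y"
  using p_inert dv_mult by blast

lemma p_not_dv_power: "x \<in> \<O> \<Longrightarrow> \<not> of_nat p dvO x \<Longrightarrow> \<not> of_nat p dvO (x ^ n)"
proof (induction n)
  case 0
  then show ?case using p_dv_of_int_iff[of 1] p_gt_1 by simp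
next
  case (Suc n)
  then show ?case using p_not_dv_mult[of x "x ^ n"] by simp
qed

lemma p_not_dv_1: "\<not> of_nat p dvO 1"
  using p_dv_of_int_iff[of 1] p_gt_1 by simp

end

text \<open>\<open>ind\<close> is a discrete logarithm on \<open>(\<O>/p)\<^sup>* / (\<int>/p)\<^sup>*\<close>; its values at multiples of \<open>p\<close> are arbitrary.\<close>

locale inert_index = inert_quadratic +
  fixes ind :: "complex \<Rightarrow> nat"
  assumes ind_less: "\<And>x. x \<in> \<O> \<Longrightarrow> \<not> of_nat p dvO x \<Longrightarrow> ind x < p + 1"
    and ind_mult: "\<And>x y. x \<in> \<O> \<Longrightarrow> \<not> of_nat p dvO x \<Longrightarrow> y \<in> \<O> \<Longrightarrow> \<not> of_nat p dvO y \<Longrightarrow>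
      ind (x * y) = (ind x + ind y) mod (p + 1)"
    and ind_eq_0_iff: "\<And>x. x \<in> \<O> \<Longrightarrow> \<not> of_nat p dvO x \<Longrightarrow> ind x = 0 \<longleftrightarrow> x \<in> \<S>"
    and ind_1: "\<exists>x\<in>\<O>. \<not> of_nat p dvO x \<and> ind x = 1"

section \<open>Existence of the discrete logarithm\<close>

context inert_quadratic
begin

lemma add_w_not_sub: "of_int a + w \<notin> \<S>"
  using sub_iff[of a 1] p_gt_1 by simp

lemma not_p_dv_add_w: "\<not> of_nat p dvO (of_int a + w)"
  using p_dv_sub add_w_not_sub by blast

text \<open>Let g generate the residue field and let m be the order of its class modulo the
  integers. The index of x is the exponent of g congruent to x, taken modulo m; counting classes
  gives m = p + 1.\<close>

lemma exists_index: "\<exists>ind. inert_index w p ind"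
proof -
  obtain g where g: "g \<in> \<O>" "\<not> of_nat p dvO g"
    and gen: "\<And>x. x \<in> \<O> \<Longrightarrow> \<not> of_nat p dvO x \<Longrightarrow> \<exists>i. of_nat p dvO (x - g ^ i)"
    using exists_generator by blast
  have gpow: "\<not> of_nat p dvO (g ^ i)" for i using p_not_dv_power g by blast
  define m where "m = (LEAST m. m > 0 \<and> g ^ m \<in> \<S>)"
  \<comment> \<open>The conjugate of g is congruent to some \<open>g ^ i\<close>, so
    \<open>g ^ Suc i\<close> is congruent to the norm of g, an integer.\<close>
  have ex: "\<exists>m>0. g ^ m \<in> \<S>"
  proof -
    have "\<not> of_nat p dvO cnj g" using dv_cnj[of "of_nat p" "cnj g"] g by auto
    then obtain i where i: "of_nat p dvO (cnj g - g ^ i)" using gen[of "cnj g"] g by auto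
    then have "of_nat p dvO (g * (cnj g - g ^ i))" using g by (intro dv_mult(2))
    then have "of_nat p dvO (g ^ Suc i - g * cnj g)"
      by (subst dv_uminus[symmetric]) (simp add: algebra_simps)
    moreover have "g * cnj g \<in> \<S>" using norm_int[OF g(1)] by (metis of_nat_in_zspan)
    ultimately have "g ^ Suc i \<in> \<S>" using p_dv_diff_sub by blast
    then show ?thesis by blast
  qed
  have m: "m > 0" "g ^ m \<in> \<S>" using LeastI_ex[OF ex] unfolding m_def by blast+
  have least: "g ^ k \<notin> \<S>" if "k > 0" "k < m" for k
    using not_less_Least[where P = "\<lambda>m. m > 0 \<and> g ^ m \<in> \<S>", folded m_def] that by auto
  have m_pow: "g ^ (m * k) \<in> \<S>" for k
    by (induction k) (simp_all add: power_add m)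
  have sub_pow: "g ^ i \<in> \<S> \<longleftrightarrow> m dvd i" for i
  proof
    assume *: "g ^ i \<in> \<S>"
    have "g ^ (m * (i div m)) * g ^ (i mod m) \<in> \<S>" using * by (simp flip: power_add)
    then have "g ^ (i mod m) \<in> \<S>" using sub_cancel[OF m_pow gpow, of "g ^ (i mod m)"] g by simp
    moreover have "i mod m < m" using m by simp
    ultimately have "i mod m = 0" using least[of "i mod m"] by auto
    then show "m dvd i" by blast
  next
    assume "m dvd i"
    then obtain k where "i = m * k" by (rule dvdE)
    then show "g ^ i \<in> \<S>" using m_pow by simp
  qed
  have pow_cong: "i mod m = j mod m" if "of_nat p dvO (g ^ i - g ^ j)" for i j
    using that
  proof (induction i j rule: linorder_wlog)
    case (sym i j)
    then show ?case by (metis dv_uminus minus_diff_eq)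
  next
    case (le i j)
    have "g ^ i - g ^ j = g ^ i * (1 - g ^ (j - i))" using le(1) by (simp add: algebra_simps flip: power_add)
    then have "of_nat p dvO (1 - g ^ (j - i))" using p_inert[of "g ^ i" "1 - g ^ (j - i)"] le g gpow by simp
    then have "of_nat p dvO (g ^ (j - i) - 1)" by (metis dv_uminus minus_diff_eq)
    then have "m dvd j - i" using p_dv_diff_sub sub_pow one_in_zspan by blast
    then show ?case using mod_eq_dvd_iff_nat[OF le(1), of m] by simp
  qed
  \<comment> \<open>Any exponent will do: by \<open>pow_cong\<close> its residue modulo m does not
    depend on the choice.\<close>
  define lg where "lg x = (SOME i. of_nat p dvO (x - g ^ i))" for x
  have lg: "of_nat p dvO (x - g ^ lg x)" if "x \<in> \<O>" "\<not> of_nat p dvO x" for x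
    unfolding lg_def by (rule someI_ex[OF gen[OF that]])
  define ind where "ind x = lg x mod m" for x
  have ind_eqI: "ind x = i mod m" if "of_nat p dvO (x - g ^ i)" "x \<in> \<O>" "\<not> of_nat p dvO x" for x i
    using dv_diff[OF that(1) lg[OF that(2,3)]] pow_cong[of "lg x" i] by (simp add: ind_def)
  have ind_pow: "ind (g ^ i) = i mod m" for i
    by (rule ind_eqI) (use g gpow in auto)
  have ind_0: "ind x = 0 \<longleftrightarrow> x \<in> \<S>" if x: "x \<in> \<O>" "\<not> of_nat p dvO x" for x
  proof -
    have "of_nat p dvO (g ^ lg x - x)" using lg[OF x] by (metis dv_uminus minus_diff_eq)
    then have "x \<in> \<S> \<longleftrightarrow> g ^ lg x \<in> \<S>" using p_dv_diff_sub lg[OF x] by blast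
    then show ?thesis by (auto simp: sub_pow ind_def)
  qed
  have ind_mult: "ind (x * y) = (ind x + ind y) mod m"
    if x: "x \<in> \<O>" "\<not> of_nat p dvO x" and y: "y \<in> \<O>" "\<not> of_nat p dvO y" for x y
  proof -
    have "x * y - g ^ (lg x + lg y) = (x - g ^ lg x) * y + (y - g ^ lg y) * g ^ lg x"
      by (simp add: algebra_simps power_add)
    moreover have "of_nat p dvO ((x - g ^ lg x) * y)" "of_nat p dvO ((y - g ^ lg y) * g ^ lg x)"
      using lg[OF x] lg[OF y] g y by (intro dv_mult(1); simp)+
    ultimately have "of_nat p dvO (x * y - g ^ (lg x + lg y))" using dv_add by metis
    then have "ind (x * y) = (lg x + lg y) mod m"
      using x y p_not_dv_mult by (intro ind_eqI) auto
    then show ?thesis by (simp add: ind_def mod_add_eq)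
  qed
  have ind_m: "ind x < m" for x using m by (simp add: ind_def)
  \<comment> \<open>Coset representatives of the classes of \<open>(\<O>/p)\<^sup>*\<close> modulo \<open>(\<int>/p)\<^sup>*\<close>: the points of a projective line.\<close>
  define T where "T = {1} \<union> (\<lambda>a. of_int a + w) ` {0..<int p}"
  have T_in: "x \<in> \<O>" "\<not> of_nat p dvO x" if "x \<in> T" for x
    using that p_not_dv_1 not_p_dv_add_w by (auto simp: T_def)
  \<comment> \<open>Equal indices would put (a + w) times the conjugate of (b + w) into the order,
    but there the coefficient of w is b - a.\<close>
  have add_w_ind: "ind (of_int a + w) \<noteq> ind (of_int b + w)" if "a \<noteq> b" "a \<in> {0..<int p}" "b \<in> {0..<int p}" for a b
  proof
    let ?a = "of_int a + w" and ?b = "of_int b + w"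
    assume eq: "ind ?a = ind ?b"
    have *: "\<not> of_nat p dvO cnj ?b" using dv_cnj[of "of_nat p" "cnj ?b"] not_p_dv_add_w[of b] by auto
    have b: "?b \<in> \<O>" "cnj ?b \<in> \<O>" by (auto intro!: cnj_in simp del: complex_cnj_add)
    have "?b * cnj ?b \<in> \<S>" using norm_int[of ?b] b by (metis of_nat_in_zspan)
    then have "ind (?b * cnj ?b) = 0" using ind_0 p_not_dv_mult[OF b] b * not_p_dv_add_w by simp
    then have "(ind ?b + ind (cnj ?b)) mod m = 0" using ind_mult[of ?b "cnj ?b"] b * not_p_dv_add_w by simp
    then have "ind (?a * cnj ?b) = 0" using eq ind_mult[of ?a "cnj ?b"] b * not_p_dv_add_w by simp
    then have "?a * cnj ?b \<in> \<S>" using ind_0[of "?a * cnj ?b"] p_not_dv_mult[of ?a "cnj ?b"] b * not_p_dv_add_w by simp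
    moreover obtain t where t: "cnj w = of_int t - w" using trace_int by (metis Ints_cases add_diff_cancel_left')
    obtain k where "w * cnj w = of_nat k" using norm_int[OF w_in] by metis
    then have "?a * cnj ?b = of_int (a * b + a * t + int k) + of_int (b - a) * w"
      by (simp add: algebra_simps t)
    ultimately have "int p dvd b - a" by (simp only: sub_iff)
    then have "a mod int p = b mod int p" by (metis mod_eq_dvd_iff)
    then show False using that by simp
  qed
  have "inj_on ind T"
  proof (rule inj_onI)
    fix x y assume xy: "x \<in> T" "y \<in> T" "ind x = ind y"
    have 1: "ind 1 = 0" using ind_0[of 1] p_not_dv_1 by simp
    have 2: "ind (of_int a + w) \<noteq> 0" for a using ind_0[of "of_int a + w"] not_p_dv_add_w add_w_not_sub by auto
    show "x = y" using xy 1 2 add_w_ind unfolding T_def by (auto; metis)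
  qed
  moreover have "ind ` T = {..<m}"
  proof
    show "{..<m} \<subseteq> ind ` T"
    proof
      fix i assume "i \<in> {..<m}"
      then have i: "ind (g ^ i) = i" using ind_pow[of i] by simp
      obtain c d where cd: "g ^ i = of_int c + of_int d * w" using power_in[OF g(1), of i] by (elim zspanE)
      show "i \<in> ind ` T"
      proof (cases "int p dvd d")
        case True
        then have "g ^ i \<in> \<S>" unfolding cd by (simp only: sub_iff)
        then have "i = ind 1" using i ind_0[of "g ^ i"] ind_0[of 1] g gpow p_not_dv_1 by simp
        then show ?thesis by (auto simp: T_def)
      next
        case False
        \<comment> \<open>An integer e inverse to d modulo p has index 0. Multiplying by it keeps
          the index and makes the coefficient of w congruent to 1, which leads to an element of
          T.\<close>
        then have "coprime d (int p)"
          using p_prime prime_imp_coprime[of "int p" d] by (simp add: coprime_commute)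
        then obtain e where "[d * e = 1] (mod int p)" using cong_solve_coprime_int by blast
        then have e: "int p dvd d * e - 1" by (simp add: cong_iff_dvd_diff)
        have "\<not> int p dvd e"
        proof
          assume "int p dvd e"
          from dvd_diff[OF dvd_mult[OF this] e] have "int p dvd d * e - (d * e - 1)" .
          then show False using p_gt_1 by simp
        qed
        then have e': "\<not> of_nat p dvO of_int e" by (simp add: p_dv_of_int_iff)
        let ?x = "of_int ((e * c) mod int p) + w"
        have "of_int e * g ^ i - ?x = of_int (e * c - (e * c) mod int p) + of_int (d * e - 1) * w"
          unfolding cd by (simp add: algebra_simps)
        then have *: "of_nat p dvO (of_int e * g ^ i - ?x)" using e by (simp only: p_dv_iff) auto
        have "ind (of_int e * g ^ i) = i"
          using ind_mult[of "of_int e" "g ^ i"] e' g gpow i ind_0[of "of_int e"] ind_m[of "g ^ i"] by simp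
        moreover have nd: "\<not> of_nat p dvO (of_int e * g ^ i)" using p_not_dv_mult[of "of_int e" "g ^ i"] e' gpow g by simp
        have "ind ?x = ind (of_int e * g ^ i)"
        proof -
          have "of_nat p dvO ((of_int e * g ^ i) - g ^ lg ?x)"
            using dv_add[OF * lg[of ?x]] not_p_dv_add_w by simp
          then show ?thesis using ind_eqI[of "of_int e * g ^ i" "lg ?x"] nd g by (simp add: ind_def)
        qed
        moreover have "?x \<in> T" using p_gt_1 by (auto simp: T_def)
        ultimately show ?thesis by (metis image_eqI)
      qed
    qed
  qed (use ind_m in auto)
  ultimately have "card T = m" by (metis card_image card_lessThan)
  moreover have "card T = p + 1"
  proof -
    have "1 \<notin> (\<lambda>a. of_int a + w) ` {0..<int p}"
    proof
      assume "1 \<in> (\<lambda>a. of_int a + w) ` {0..<int p}"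
      then obtain a where "1 = of_int a + w" by (rule imageE)
      then show False using add_w_not_sub[of a] by (metis one_in_zspan)
    qed
    moreover have "inj_on (\<lambda>a. of_int a + w) {0..<int p}" by (auto simp: inj_on_def)
    ultimately show ?thesis by (simp add: T_def card_image)
  qed
  ultimately have "m = p + 1" by simp
  then have "inert_index w p ind"
    using ind_m ind_mult ind_0 ind_pow[of 1] g p_gt_1
    by unfold_locales (auto intro!: bexI[of _ g])
  then show ?thesis by blast
qed

end

section \<open>Rules for the index and the Davenport constant\<close>

context inert_index
begin

text \<open>Multiplying by an inverse z of x modulo p sends x and y into the order, so both have
  index opposite to that of z.\<close>

lemma ind_cong:
  assumes "of_nat p dvO (x - y)" "x \<in> \<O>" "y \<in> \<O>" "\<not> of_nat p dvO x"
  shows "ind x = ind y"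
proof -
  have y: "\<not> of_nat p dvO y" using dv_add[OF assms(1), of y] assms(4) by auto
  obtain z where z: "z \<in> \<O>" "of_nat p dvO (x * z - 1)" using inverse_mod_p assms by blast
  have z': "\<not> of_nat p dvO z"
  proof
    assume "of_nat p dvO z"
    from dv_diff[OF dv_mult(2)[OF this assms(2)] z(2)]
    show False using p_not_dv_1 by simp
  qed
  have xz: "x * z \<in> \<S>" using p_dv_diff_sub z by simp
  have "(x - y) * z = x * z - y * z" by (simp add: algebra_simps)
  then have "of_nat p dvO (x * z - y * z)" using dv_mult(1)[OF assms(1), of z] z by simp
  then have "of_nat p dvO (y * z - x * z)" by (metis dv_uminus minus_diff_eq)
  then have yz: "y * z \<in> \<S>" using p_dv_diff_sub xz by blast
  have "ind (x * z) = 0" using xz ind_eq_0_iff[of "x * z"] assms z z' p_not_dv_mult[of x z] by simp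
  moreover have "ind (y * z) = 0" using yz ind_eq_0_iff[of "y * z"] assms y z z' p_not_dv_mult[of y z] by simp
  ultimately have "(ind x + ind z) mod (p + 1) = (ind y + ind z) mod (p + 1)"
    using ind_mult[of x z] ind_mult[of y z] assms y z z' by simp
  then have "ind x mod (p + 1) = ind y mod (p + 1)"
    by (metis cong_add_rcancel_nat cong_def)
  then show ?thesis using ind_less[of x] ind_less[of y] assms y by simp
qed

lemma ind_one [simp]: "ind 1 = 0" and ind_minus_one [simp]: "ind (- 1) = 0"
  using ind_eq_0_iff[of 1] ind_eq_0_iff[of "- 1"] p_not_dv_1 by auto

lemma p_not_dv_cnj: "\<not> of_nat p dvO x \<Longrightarrow> \<not> of_nat p dvO (cnj x)"
  using dv_cnj[of "of_nat p" "cnj x"] by auto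

text \<open>The norm is an integer, so conjugation inverts the class.\<close>

lemma ind_cnj: "x \<in> \<O> \<Longrightarrow> \<not> of_nat p dvO x \<Longrightarrow> (ind x + ind (cnj x)) mod (p + 1) = 0"
proof -
  assume x: "x \<in> \<O>" "\<not> of_nat p dvO x"
  have "x * cnj x \<in> \<S>" using norm_int[OF x(1)] by (metis of_nat_in_zspan)
  then show ?thesis
    using ind_mult[of x "cnj x"] ind_eq_0_iff[of "x * cnj x"] x p_not_dv_cnj p_not_dv_mult[of x "cnj x"] by simp
qed

lemma ind_power: "x \<in> \<O> \<Longrightarrow> \<not> of_nat p dvO x \<Longrightarrow> ind (x ^ n) = (n * ind x) mod (p + 1)"
proof (induction n)
  case (Suc n)
  then show ?case using ind_mult[of x "x ^ n"] p_not_dv_power[of x n]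
    by (simp add: mod_simps)
qed simp

lemma prod_list_props:
  assumes "\<forall>x\<in>set xs. x \<in> \<O> \<and> \<not> of_nat p dvO x"
  shows "prod_list xs \<in> \<O>" "\<not> of_nat p dvO prod_list xs"
  using assms p_not_dv_1 by (induction xs) (auto simp: p_not_dv_mult)

text \<open>The p + 2 prefix products have only p + 1 possible indices. Two prefixes agree, and the
  block between them has trivial class.\<close>

lemma zero_sum_sublist:
  assumes U: "\<forall>x\<in>set xs. x \<in> \<O> \<and> \<not> of_nat p dvO x" and len: "length xs = p + 1"
  shows "\<exists>B. B \<noteq> {#} \<and> B \<subseteq># mset xs \<and> prod_mset B \<in> \<S>"
proof -
  let ?f = "\<lambda>i. ind (prod_list (take i xs))"
  have tk: "prod_list (take i xs) \<in> \<O>" "\<not> of_nat p dvO prod_list (take i xs)" for i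
    using prod_list_props[of "take i xs"] U by (meson in_set_takeD)+
  have "?f ` {..p + 1} \<subseteq> {..<p + 1}" using ind_less[OF tk] by auto
  then have "card (?f ` {..p + 1}) < card {..p + 1}"
    using card_mono[of "{..<p + 1}" "?f ` {..p + 1}"] by simp
  then have "\<not> inj_on ?f {..p + 1}" using pigeonhole by blast
  then obtain i j where ij: "i < j" "j \<le> p + 1" "?f i = ?f j"
    unfolding inj_on_def by (metis atMost_iff linorder_neqE_nat)
  let ?ys = "drop i (take j xs)"
  have ys: "prod_list ?ys \<in> \<O>" "\<not> of_nat p dvO prod_list ?ys"
    using prod_list_props[of ?ys] U by (meson in_set_takeD in_set_dropD)+
  have "take j xs = take i xs @ ?ys" using ij by (metis append_take_drop_id min.absorb1 order.strict_implies_order take_take)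
  then have "prod_list (take j xs) = prod_list (take i xs) * prod_list ?ys" by (metis prod_list.append)
  then have "?f i = (?f i + ind (prod_list ?ys)) mod (p + 1)"
    using ind_mult[OF tk[of i] ys] ij by simp
  then have "[?f i + 0 = ?f i + ind (prod_list ?ys)] (mod (p + 1))"
    using ind_less[OF tk[of i]] by (simp add: cong_def)
  then have "ind (prod_list ?ys) = 0"
    using ind_less[OF ys] by (simp only: cong_add_lcancel_nat) (simp add: cong_def)
  then have "prod_list ?ys \<in> \<S>" using ind_eq_0_iff[OF ys] by simp
  moreover have "?ys \<noteq> []" using ij len by simp
  moreover have "mset ?ys \<subseteq># mset xs"
    by (metis append_take_drop_id mset_append mset_subset_eq_add_left mset_subset_eq_add_right subset_mset.order_trans)
  ultimately show ?thesis by (intro exI[of _ "mset ?ys"]) (simp add: prod_mset_prod_list)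
qed

end

context inert_quadratic
begin

subsection \<open>A length function on the maximal order\<close>

definition fact_of :: "complex \<Rightarrow> complex multiset \<Rightarrow> bool" where
  "fact_of x A \<longleftrightarrow> (\<forall>q\<in>#A. prO q) \<and> (\<exists>u. (u = 1 \<or> u = - 1) \<and> x = u * prod_mset A)"

text \<open>For a prime prime to p, membership in the order means trivial class; p itself also lies
  in the order and so gets weight 2.\<close>

definition wt :: "complex \<Rightarrow> nat" where
  "wt q = (if q \<in> \<S> then 2 else 1)"

text \<open>The factorisation is an arbitrary one; \<open>W_eq\<close> shows that the value does not
  depend on it.\<close>

definition W :: "complex \<Rightarrow> nat" where
  "W x = (\<Sum>q\<in>#(SOME A. fact_of x A). wt q)"

lemma fact_of_exists: "x \<in> \<O> \<Longrightarrow> x \<noteq> 0 \<Longrightarrow> \<exists>A. fact_of x A"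
  using exists_prO_factorization unfolding fact_of_def by metis

lemma W_eq:
  assumes "fact_of x A" shows "W x = (\<Sum>q\<in>#A. wt q)"
proof -
  define B where "B = (SOME A. fact_of x A)"
  have "fact_of x B" unfolding B_def using assms by (rule someI)
  then obtain u where B: "\<forall>q\<in>#B. prO q" "u = 1 \<or> u = - 1" "x = u * prod_mset B"
    unfolding fact_of_def by metis
  obtain v where A: "\<forall>q\<in>#A. prO q" "v = 1 \<or> v = - 1" "x = v * prod_mset A"
    using assms unfolding fact_of_def by metis
  have "prod_mset B = u * (u * prod_mset B)" using B(2) by auto
  also have "\<dots> = (u * v) * prod_mset A" using A(3) B(3) by (simp add: mult.assoc)
  finally have "prod_mset B = (u * v) * prod_mset A" .
  moreover have "u * v = 1 \<or> u * v = - 1" using A(2) B(2) by auto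
  ultimately show ?thesis unfolding W_def B_def[symmetric] using A(1) B(1)
    by (intro factorization_weight_unique[of wt _ _ "u * v"]) (auto simp: wt_def)
qed

lemma fact_of_mult: "fact_of x A \<Longrightarrow> fact_of y B \<Longrightarrow> fact_of (x * y) (A + B)"
proof -
  assume A: "fact_of x A" and B: "fact_of y B"
  obtain u where u: "u = 1 \<or> u = - 1" "x = u * prod_mset A" using A unfolding fact_of_def by metis
  obtain v where v: "v = 1 \<or> v = - 1" "y = v * prod_mset B" using B unfolding fact_of_def by metis
  have "x * y = (u * v) * prod_mset (A + B)" using u(2) v(2) by simp
  moreover have "u * v = 1 \<or> u * v = - 1" using u(1) v(1) by auto
  moreover have "\<forall>q\<in>#A + B. prO q" using A B by (auto simp: fact_of_def)
  ultimately show ?thesis unfolding fact_of_def by (intro conjI exI[of _ "u * v"])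
qed

lemma W_mult: "x \<in> \<O> \<Longrightarrow> x \<noteq> 0 \<Longrightarrow> y \<in> \<O> \<Longrightarrow> y \<noteq> 0 \<Longrightarrow> W (x * y) = W x + W y"
proof -
  assume "x \<in> \<O>" "x \<noteq> 0" "y \<in> \<O>" "y \<noteq> 0"
  then obtain A B where AB: "fact_of x A" "fact_of y B" using fact_of_exists by meson
  show ?thesis using W_eq[OF fact_of_mult[OF AB]] W_eq[OF AB(1)] W_eq[OF AB(2)] by simp
qed

lemma W_prod_list: "(\<forall>x\<in>set xs. x \<in> \<O> \<and> x \<noteq> 0) \<Longrightarrow> W (prod_list xs) = (\<Sum>x\<leftarrow>xs. W x)"
proof (induction xs)
  case Nil
  have "fact_of 1 {#}" by (simp add: fact_of_def)
  then show ?case using W_eq by simp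
next
  case (Cons x xs)
  have "prod_list xs \<in> \<O>" "prod_list xs \<noteq> 0" using Cons.prems by (induction xs) auto
  then show ?case using Cons W_mult by simp
qed

lemma W_prO: "prO q \<Longrightarrow> W q = wt q"
proof -
  assume "prO q"
  then have "fact_of q {#q#}" by (auto simp: fact_of_def)
  then show ?thesis using W_eq by simp
qed

lemma cmod_prod_mset_gt_1:
  assumes "\<forall>q\<in>#A. prO q" "A \<noteq> {#}" shows "cmod (prod_mset A) > 1"
  using assms
proof (induction A)
  case (add q A)
  have q: "cmod q > 1" using prO_cmod_gt add by simp
  show ?case
  proof (cases "A = {#}")
    case False
    then have "cmod (prod_mset A) > 1" using add by auto
    then have "1 * 1 < cmod q * cmod (prod_mset A)" using q by (intro mult_strict_mono) auto
    then show ?thesis by (simp add: norm_mult)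
  qed (use q in simp)
qed simp

lemma prod_mset_prO_in: "\<forall>q\<in>#A. prO q \<Longrightarrow> prod_mset A \<in> \<O>"
  using prO_in by simp

text \<open>The units of \<^term>\<open>\<S>\<close> are its elements of absolute value \<open>1\<close>.\<close>

definition irrS :: "complex \<Rightarrow> bool" where
  "irrS x \<longleftrightarrow> x \<in> \<S> \<and> x \<noteq> 0 \<and> cmod x \<noteq> 1 \<and> (\<forall>a\<in>\<S>. \<forall>b\<in>\<S>. x = a * b \<longrightarrow> cmod a = 1 \<or> cmod b = 1)"

lemma irrSD: "irrS x \<Longrightarrow> a \<in> \<S> \<Longrightarrow> b \<in> \<S> \<Longrightarrow> x = a * b \<Longrightarrow> cmod a = 1 \<or> cmod b = 1"
  by (auto simp: irrS_def)

text \<open>Translates irreducibility phrased through proper factors into a condition on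
  factorisations \<open>x = a * b\<close>.\<close>

lemma Irr_sub: "Irr (quad_order (of_nat p * w)) = {x. irrS x}"
proof -
  have qo: "quad_order (of_nat p * w) = complex_ring \<S>" by (simp add: quad_order_def zspan_def)
  have unit_iff: "x \<in> Units (complex_ring \<S>) \<longleftrightarrow> cmod x = 1" if x: "x \<in> \<S>" for x
  proof
    assume "x \<in> Units (complex_ring \<S>)"
    then obtain y where y: "y \<in> \<S>" "x * y = 1" unfolding Units_def complex_ring_simps by auto
    then have "x dvO 1" "x \<noteq> 0" using dvI[OF sub_in[OF y(1)], of x] by auto
    then show "cmod x = 1" using dv_cmod_le[of x 1] one_le_cmod[of x] sub_in[OF x] by simp
  next
    assume "cmod x = 1"
    then have "x * x = 1" using unit[OF sub_in[OF x]] by auto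
    then show "x \<in> Units (complex_ring \<S>)" using x by (auto simp: Units_def)
  qed
  have "ring_irreducible\<^bsub>complex_ring \<S>\<^esub> x \<longleftrightarrow> irrS x" if x: "x \<in> \<S>" for x
  proof
    assume irr: "ring_irreducible\<^bsub>complex_ring \<S>\<^esub> x"
    have "cmod a = 1 \<or> cmod b = 1" if ab: "a \<in> \<S>" "b \<in> \<S>" "x = a * b" for a b
    proof (cases "properfactor (complex_ring \<S>) a x")
      case True
      then show ?thesis using irr unit_iff[OF ab(1)] ab(1) by (auto simp: ring_irreducible_def irreducible_def)
    next
      case False
      \<comment> \<open>Here x divides a as well, and cancelling a shows that b is
        invertible.\<close>
      then obtain c where c: "c \<in> \<S>" "a = x * c" using ab by (auto simp: properfactor_def factor_def)
      have "x \<noteq> 0" using irr by (auto simp: ring_irreducible_def)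
      then have "a \<noteq> 0" using ab by auto
      moreover have "a * 1 = a * (b * c)" using c ab by (simp add: mult.assoc)
      ultimately have "1 = b * c" using mult_cancel_left[of a 1 "b * c"] by metis
      then have "c * b = 1" "b * c = 1" by (simp_all add: mult.commute)
      then have "b \<in> Units (complex_ring \<S>)" using ab(2) c(1) unfolding Units_def complex_ring_simps by blast
      then show ?thesis using unit_iff ab by simp
    qed
    then show "irrS x"
      using irr x unit_iff[OF x] by (auto simp: irrS_def ring_irreducible_def irreducible_def)
  next
    assume irr: "irrS x"
    have "b \<in> Units (complex_ring \<S>)" if b: "b \<in> \<S>" "properfactor (complex_ring \<S>) b x" for b
    proof -
      obtain c where c: "c \<in> \<S>" "x = b * c" and nd: "\<not> (\<exists>d\<in>\<S>. b = x * d)"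
        using b by (auto simp: properfactor_def factor_def)
      have "cmod c \<noteq> 1"
      proof
        assume "cmod c = 1"
        then have "c * c = 1" using unit[OF sub_in[OF c(1)]] by auto
        then have "b = x * c" using c(2) by (simp add: mult.assoc)
        then show False using nd c by blast
      qed
      then show ?thesis using irrSD[OF irr b(1) c] unit_iff b by simp
    qed
    then show "ring_irreducible\<^bsub>complex_ring \<S>\<^esub> x"
      using irr unit_iff[OF x] by (auto simp: irrS_def ring_irreducible_def irreducible_def)
  qed
  moreover have "irrS x \<Longrightarrow> x \<in> \<S>" for x by (simp add: irrS_def)
  ultimately show ?thesis unfolding qo Irr_def complex_ring_simps by auto
qed

lemma list_product_sub: "list_product (quad_order x) xs = prod_list xs"
  unfolding list_product_def quad_order_def complex_ring_simps by (induction xs) auto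

lemma cmod_p_mult: "x \<in> \<O> \<Longrightarrow> x \<noteq> 0 \<Longrightarrow> cmod (of_nat p * x) \<noteq> 1"
proof -
  assume "x \<in> \<O>" "x \<noteq> 0"
  then have "1 * 1 < real p * cmod x" using one_le_cmod[of x] p_gt_1 by (intro mult_less_le_imp_less) auto
  then show ?thesis by (simp add: norm_mult)
qed

end

section \<open>Weights of irreducibles and the elasticity\<close>

context inert_index
begin

text \<open>Looking only at the first p + 1 entries is what bounds the size of B.\<close>

lemma zero_sum_submultiset:
  assumes U: "\<forall>x\<in>#A. x \<in> \<O> \<and> \<not> of_nat p dvO x" and size: "size A \<ge> p + 1"
  shows "\<exists>B. B \<noteq> {#} \<and> B \<subseteq># A \<and> size B \<le> p + 1 \<and> prod_mset B \<in> \<S>"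
proof -
  obtain xs where xs: "mset xs = A" using ex_mset by blast
  let ?ys = "take (p + 1) xs"
  have "\<forall>x\<in>set ?ys. x \<in> \<O> \<and> \<not> of_nat p dvO x"
    using U xs by (metis in_set_takeD set_mset_mset)
  moreover have "length ?ys = p + 1" using size xs by auto
  ultimately obtain B where B: "B \<noteq> {#}" "B \<subseteq># mset ?ys" "prod_mset B \<in> \<S>"
    using zero_sum_sublist by metis
  moreover have "mset ?ys \<subseteq># A"
    unfolding xs[symmetric] by (metis append_take_drop_id mset_append mset_subset_eq_add_left)
  moreover have "size B \<le> p + 1" using size_mset_mono[OF B(2)] by simp
  ultimately show ?thesis by (meson subset_mset.order_trans)
qed

text \<open>If p divides x, the cofactor is a zero-sum free product of at most p primes of weight 1,
  to which p adds 2. Otherwise x is a single prime of weight 2 or a minimal zero-sum product of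
  between 2 and p + 1 primes of weight 1.\<close>

lemma weight_bounds:
  assumes irr: "irrS x" shows "2 \<le> W x" "W x \<le> p + 2"
proof -
  have x: "x \<in> \<S>" "x \<noteq> 0" "cmod x \<noteq> 1" using irr by (auto simp: irrS_def)
  have "2 \<le> W x \<and> W x \<le> p + 2"
  proof (cases "of_nat p dvO x")
    case True
    then obtain y where y: "y \<in> \<O>" "x = of_nat p * y" by (rule dvE)
    then have y0: "y \<noteq> 0" using x by auto
    obtain A u where A: "\<forall>q\<in>#A. prO q" "u = 1 \<or> u = - 1" "y = u * prod_mset A"
      using exists_prO_factorization[OF y(1) y0] by blast
    have u: "u \<in> \<O>" using A(2) by auto
    \<comment> \<open>If the square of p divided x, then x = p (p z) would be a proper splitting, as
      every multiple of p lies in the order.\<close>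
    have nd: "\<not> of_nat p dvO y"
    proof
      assume "of_nat p dvO y"
      then obtain z where z: "z \<in> \<O>" "y = of_nat p * z" by (rule dvE)
      then have "z \<noteq> 0" using y0 by auto
      then show False using irrSD[OF irr, of "of_nat p" "of_nat p * z"] y z cmod_p_mult[of z] p_mult_sub[of z] p_gt_1 by simp
    qed
    \<comment> \<open>A part of trivial class could be split off, because p times the remaining
      primes lies in the order whatever their class.\<close>
    have free: "prod_mset B \<notin> \<S>" if B: "B \<subseteq># A" "B \<noteq> {#}" for B
    proof
      assume s: "prod_mset B \<in> \<S>"
      obtain C where C: "A = B + C" using B(1) by (metis subset_mset.le_iff_add)
      have "x = prod_mset B * (of_nat p * (u * prod_mset C))" unfolding y A(3) C by (simp add: mult_ac)
      moreover have c: "u * prod_mset C \<in> \<O>" using A(1) C u prod_mset_prO_in[of C] by simp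
      moreover have "u * prod_mset C \<noteq> 0" using y0 A C by auto
      ultimately have "cmod (prod_mset B) = 1"
        using irrSD[OF irr s p_mult_sub[OF c]] cmod_p_mult by blast
      then show False using cmod_prod_mset_gt_1[of B] A(1) B C by simp
    qed
    have "size A \<le> p"
    proof (rule ccontr)
      assume "\<not> size A \<le> p"
      moreover have "\<forall>q\<in>#A. q \<in> \<O> \<and> \<not> of_nat p dvO q"
      proof (intro ballI conjI notI)
        fix q assume q: "q \<in># A"
        then show "q \<in> \<O>" using A prO_in by blast
        assume p: "of_nat p dvO q"
        obtain C where C: "A = add_mset q C" using q by (metis multi_member_split)
        have "of_nat p dvO (q * (u * prod_mset C))"
          using p u A(1) C prod_mset_prO_in[of C] by (intro dv_mult(1)) auto
        then show False using nd A(3) C by (simp add: mult_ac)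
      qed
      ultimately show False using zero_sum_submultiset[of A] free by auto
    qed
    moreover have "(\<Sum>q\<in>#A. wt q) = size A"
    proof -
      have "wt q = 1" if "q \<in># A" for q
        using free[of "{#q#}"] that by (auto simp: wt_def)
      then have "image_mset wt A = image_mset (\<lambda>_. 1) A" by (intro image_mset_cong) auto
      then show ?thesis by simp
    qed
    moreover have "fact_of y A" using A by (auto simp: fact_of_def)
    then have "W y = (\<Sum>q\<in>#A. wt q)" by (rule W_eq)
    moreover have "W x = 2 + W y" using y y0 W_mult[of "of_nat p" y] p_gt_1 W_prO[OF prO_p] by (simp add: wt_def)
    ultimately show ?thesis by simp
  next
    case nd: False
    obtain A u where A: "\<forall>q\<in>#A. prO q" "u = 1 \<or> u = - 1" "x = u * prod_mset A"
      using exists_prO_factorization[OF sub_in[OF x(1)] x(2)] by blast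
    have u: "u \<in> \<O>" "cmod u = 1" using A(2) by auto
    have "fact_of x A" using A by (auto simp: fact_of_def)
    then have W: "W x = (\<Sum>q\<in>#A. wt q)" by (rule W_eq)
    \<comment> \<open>When p does not divide x, \<open>sub_cancel\<close> puts the complement of a
      zero-sum part into the order too, so irreducibility makes that complement empty.\<close>
    have all: "C = {#}" if B: "A = B + C" "B \<noteq> {#}" "prod_mset B \<in> \<S>" for B C
    proof (rule ccontr)
      assume C: "C \<noteq> {#}"
      have c: "u * prod_mset C \<in> \<O>" using A(1) B u prod_mset_prO_in[of C] by simp
      have b: "prod_mset B \<in> \<O>" using A(1) B prod_mset_prO_in[of B] by simp
      have eq: "x = prod_mset B * (u * prod_mset C)" unfolding A(3) B(1) by (simp add: mult_ac)
      then have "u * prod_mset C \<in> \<S>" using sub_cancel[OF B(3) _ c] nd x p_not_dv_mult[OF b c] by simp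
      then have "cmod (prod_mset B) = 1 \<or> cmod (u * prod_mset C) = 1" using irrSD[OF irr B(3) _ eq] by simp
      then show False using cmod_prod_mset_gt_1[of B] cmod_prod_mset_gt_1[of C] A(1) B C u by (auto simp: norm_mult)
    qed
    have ne: "A \<noteq> {#}" using A x by auto
    show ?thesis
    proof (cases "\<exists>q\<in>#A. q \<in> \<S>")
      case True
      then obtain q C where q: "A = add_mset q C" "q \<in> \<S>" by (metis multi_member_split)
      then have "C = {#}" using all[of "{#q#}" C] by simp
      then show ?thesis using W q by (simp add: wt_def)
    next
      case False
      have "image_mset wt A = image_mset (\<lambda>_. 1) A" using False by (intro image_mset_cong) (auto simp: wt_def)
      then have "W x = size A" using W by simp
      \<comment> \<open>A single prime would be x up to sign and hence lie in the order, which this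
        case excludes.\<close>
      moreover have "size A \<noteq> 1"
      proof
        assume "size A = 1"
        then obtain q where "A = {#q#}" by (metis size_1_singleton_mset)
        then show False using A x False by auto
      qed
      \<comment> \<open>With more than p + 1 primes, a zero-sum part of at most p + 1 of them leaves
        a nonempty complement, against \<open>all\<close>.\<close>
      moreover have "size A \<le> p + 1"
      proof (rule ccontr)
        assume s: "\<not> size A \<le> p + 1"
        have "\<forall>q\<in>#A. q \<in> \<O> \<and> \<not> of_nat p dvO q"
          using A(1) False p_dv_sub prO_in by blast
        then obtain B where B: "B \<noteq> {#}" "B \<subseteq># A" "size B \<le> p + 1" "prod_mset B \<in> \<S>"
          using zero_sum_submultiset[of A] s by auto
        obtain C where C: "A = B + C" using B(2) by (metis subset_mset.le_iff_add)
        then show False using all[OF C B(1,4)] B s by simp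
      qed
      moreover have "size A \<noteq> 0" using ne by simp
      ultimately show ?thesis by linarith
    qed
  qed
  then show "2 \<le> W x" "W x \<le> p + 2" by auto
qed

lemma irrS_p: "irrS (of_nat p)"
  using p_gt_1 prO_irreducible[OF prO_p] sub_in by (auto simp: irrS_def)

text \<open>Both 1 and p, which is -1, are invertible modulo p + 1.\<close>

lemma index_generator_mult:
  assumes "ind q = 1 \<or> ind q = p" "(j * ind q) mod (p + 1) = 0" "j \<le> p"
  shows "j = 0"
proof -
  have "(p + 1) dvd j * ind q" using assms(2) by presburger
  moreover have "coprime (p + 1) (ind q)" using assms(1) by (auto simp: coprime_Suc_left_nat)
  ultimately have "(p + 1) dvd j" by (simp add: coprime_dvd_mult_left_iff)
  then show ?thesis using assms(3) by (metis add.commute dvd_imp_le gr0I not_less_eq_eq plus_1_eq_Suc)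
qed

text \<open>One factor absorbs p; the other divides \<open>q ^ p\<close> and so is
  \<open>q ^ j\<close> up to sign with j at most p. Since the class of q has order p + 1, lying in
  the order forces j = 0.\<close>

lemma irrS_p_mult_power:
  assumes q: "prO q" "\<not> of_nat p dvO q" "ind q = 1 \<or> ind q = p"
  shows "irrS (of_nat p * q ^ p)"
proof -
  note qO = prO_in[OF q(1)]
  have aux: "cmod b = 1" if b: "b \<in> \<S>" and a: "a \<in> \<S>" "of_nat p * q ^ p = a * b" "of_nat p dvO a" for a b
  proof -
    obtain a' where a': "a' \<in> \<O>" "a = of_nat p * a'" using a(3) by (rule dvE)
    then have "q ^ p = b * a'" using a(2) p_gt_1 by simp
    then have "b dvO q ^ p" using a'(1) dvI by simp
    then obtain j where j: "j \<le> p" "b = q ^ j \<or> b = - (q ^ j)"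
      using dv_prO_power[OF q(1) sub_in[OF b]] by blast
    have qj: "q ^ j \<in> \<O>" "\<not> of_nat p dvO (q ^ j)" using qO p_not_dv_power q by auto
    have "q ^ j \<in> \<S>" using b j by auto
    then have "ind (q ^ j) = 0" using ind_eq_0_iff[OF qj] by simp
    then have "j = 0" using index_generator_mult[OF q(3) _ j(1)] ind_power[OF qO q(2)] by simp
    then show ?thesis using j by auto
  qed
  show ?thesis
    unfolding irrS_def
  proof (intro conjI ballI impI)
    show "of_nat p * q ^ p \<in> \<S>" by (rule p_mult_sub) (use qO in simp)
    show "of_nat p * q ^ p \<noteq> 0" using p_gt_1 prO_nz[OF q(1)] by simp
    show "cmod (of_nat p * q ^ p) \<noteq> 1" using qO prO_nz[OF q(1)] by (intro cmod_p_mult) auto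
    fix a b assume ab: "a \<in> \<S>" "b \<in> \<S>" "of_nat p * q ^ p = a * b"
    have "of_nat p dvO (a * b)" unfolding ab(3)[symmetric] by (rule dvI) (use qO in simp)
    then have "of_nat p dvO a \<or> of_nat p dvO b" using p_inert ab sub_in by blast
    then show "cmod a = 1 \<or> cmod b = 1"
      using aux[OF ab(2,1,3)] aux[OF ab(1,2)] ab(3) by (auto simp: mult.commute)
  qed
qed

text \<open>In a proper splitting, the factor divisible by q would be q up to sign, which is outside
  the order.\<close>

lemma irrS_norm:
  assumes q: "prO q" "\<not> of_nat p dvO q" "ind q \<noteq> 0"
  shows "irrS (q * cnj q)"
proof -
  note qO = prO_in[OF q(1)]
  have qS: "q \<notin> \<S>" using ind_eq_0_iff qO q by simp
  have aux: "cmod b = 1" if b: "b \<in> \<S>" and a: "a \<in> \<S>" "q * cnj q = a * b" "q dvO a" for a b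
  proof -
    obtain a' where a': "a' \<in> \<O>" "a = q * a'" using a(3) by (rule dvE)
    then have "cnj q = a' * b" using a(2) prO_nz[OF q(1)] by simp
    then have "cmod a' = 1 \<or> cmod b = 1"
      using prO_irreducible[OF prO_cnj[OF q(1)]] a'(1) sub_in[OF b] by blast
    moreover have "cmod a' \<noteq> 1"
    proof
      assume "cmod a' = 1"
      then have "a = q \<or> a = - q" using unit[OF a'(1)] a' by auto
      then show False using qS a(1) by auto
    qed
    ultimately show ?thesis by blast
  qed
  have gt: "cmod q * cmod q > 1 * 1" using prO_cmod_gt[OF q(1)] by (intro mult_strict_mono) auto
  show ?thesis
    unfolding irrS_def
  proof (intro conjI ballI impI)
    show "q * cnj q \<in> \<S>" using norm_int[OF qO] by (metis of_nat_in_zspan)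
    show "q * cnj q \<noteq> 0" using prO_nz[OF q(1)] by simp
    show "cmod (q * cnj q) \<noteq> 1" using gt by (simp add: norm_mult)
    fix a b assume ab: "a \<in> \<S>" "b \<in> \<S>" "q * cnj q = a * b"
    have "q dvO (a * b)" unfolding ab(3)[symmetric] by (rule dvI) (use qO in simp)
    then have "q dvO a \<or> q dvO b" using prO_dv_mult[OF q(1)] ab sub_in by blast
    then show "cmod a = 1 \<or> cmod b = 1"
      using aux[OF ab(2,1,3)] aux[OF ab(1,2)] ab(3) by (auto simp: mult.commute)
  qed
qed

text \<open>Upper bound: the common value of \<open>W\<close> is at least 2 per entry of
  \<open>as\<close> and at most p + 2 per entry of \<open>bs\<close>. One explicit identity attains
  it.\<close>

lemma elasticity_eq:
  assumes q: "prO q" "\<not> of_nat p dvO q" "ind q = 1 \<or> ind q = p"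
  shows "elasticity (quad_order (of_nat p * w)) = ereal (1 + real p / 2)"
proof -
  let ?R = "quad_order (of_nat p * w)"
  have le: "real (length as) / real (length bs) \<le> 1 + real p / 2"
    if bs: "bs \<noteq> []" "set as \<subseteq> Irr ?R" "set bs \<subseteq> Irr ?R" "list_product ?R as = list_product ?R bs" for as bs
  proof -
    have irr: "\<forall>x\<in>set as. irrS x" "\<forall>x\<in>set bs. irrS x" using bs(2,3) unfolding Irr_sub by auto
    have nz: "irrS x \<Longrightarrow> x \<in> \<O> \<and> x \<noteq> 0" for x using sub_in by (auto simp: irrS_def)
    have eq: "(\<Sum>x\<leftarrow>as. W x) = (\<Sum>x\<leftarrow>bs. W x)"
      using W_prod_list[of as] W_prod_list[of bs] irr nz bs(4) unfolding list_product_sub by auto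
    have "2 * length as \<le> (\<Sum>x\<leftarrow>as. W x)"
      using irr(1) weight_bounds(1) by (induction as) fastforce+
    moreover have "(\<Sum>x\<leftarrow>bs. W x) \<le> (p + 2) * length bs"
      using irr(2) weight_bounds(2) by (induction bs) fastforce+
    ultimately have "2 * length as \<le> (p + 2) * length bs" using eq by simp
    then have "2 * real (length as) \<le> (real p + 2) * real (length bs)"
      by (metis (mono_tags, opaque_lifting) of_nat_add of_nat_le_iff of_nat_mult of_nat_numeral)
    then show ?thesis using bs(1) by (simp add: field_simps)
  qed
  \<comment> \<open>Two factorisations of the same element, of lengths p + 2 and 2.\<close>
  let ?as = "[of_nat p, of_nat p] @ replicate p (q * cnj q)"
  let ?bs = "[of_nat p * q ^ p, of_nat p * cnj q ^ p]"
  note qO = prO_in[OF q(1)]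
  \<comment> \<open>The two indices lie below p + 1 and add up to a positive multiple of p + 1,
    hence to p + 1 itself; so the conjugate also has index 1 or p.\<close>
  have "ind (cnj q) < p + 1" using ind_less[of "cnj q"] qO p_not_dv_cnj[OF q(2)] by simp
  moreover have "ind q < p + 1" using ind_less[OF qO q(2)] .
  ultimately have lt: "ind q + ind (cnj q) < (p + 1) * 2" by simp
  have "(p + 1) dvd ind q + ind (cnj q)" using ind_cnj[OF qO q(2)] by (rule mod_0_imp_dvd)
  then obtain k where k: "ind q + ind (cnj q) = (p + 1) * k" by (rule dvdE)
  have "k < 2" using lt unfolding k by (simp only: mult_less_cancel1)
  moreover have "k \<noteq> 0"
  proof
    assume "k = 0"
    then have "ind q = 0" using k by simp
    then show False using q(3) p_gt_1 by simp
  qed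
  ultimately have "k = 1" by linarith
  then have "ind (cnj q) = 1 \<or> ind (cnj q) = p" using k q(3) by auto
  then have "irrS (of_nat p * cnj q ^ p)"
    using irrS_p_mult_power[OF prO_cnj[OF q(1)] p_not_dv_cnj[OF q(2)]] by blast
  then have sets: "set ?bs \<subseteq> Irr ?R" "set ?as \<subseteq> Irr ?R"
    using irrS_p_mult_power[OF q] irrS_norm[OF q(1,2)] irrS_p q(3) p_gt_1 unfolding Irr_sub by auto
  have "list_product ?R ?as = list_product ?R ?bs"
    unfolding list_product_sub by (simp add: power_mult_distrib mult_ac prod_list_replicate)
  moreover have "?as \<noteq> []" "?bs \<noteq> []" by simp_all
  ultimately have "ereal (real (length ?as) / real (length ?bs)) \<le> elasticity ?R"
    unfolding elasticity_def using sets
    by (intro Sup_upper CollectI exI[of _ ?as] exI[of _ ?bs] conjI refl)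
  moreover have "real (length ?as) / real (length ?bs) = 1 + real p / 2" by (simp add: field_simps)
  ultimately have "ereal (1 + real p / 2) \<le> elasticity ?R" by metis
  moreover have "elasticity ?R \<le> ereal (1 + real p / 2)"
    unfolding elasticity_def using le by (intro Sup_least) auto
  ultimately show ?thesis by (rule antisym[OF _ , rotated])
qed

end

subsection \<open>Lattice sums\<close>

text \<open>Comparison with an integral: the mean value theorem bounds each term by a difference of
  consecutive values of \<open>x powr (- s)\<close> divided by s, and these telescope.\<close>

lemma sum_powr_le:
  fixes s :: real
  assumes "s > 0"
  shows "(\<Sum>m=1..N. real m powr (- 1 - s)) \<le> 1 + 1 / s"
proof -
  have "(\<Sum>m=1..Suc N. real m powr (- 1 - s)) \<le> 1 + (1 - real (Suc N) powr (- s)) / s" for N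
  proof (induction N)
    case 0
    then show ?case by simp
  next
    case (Suc N)
    define x where "x = real (Suc N)"
    have x: "x > 0" by (simp add: x_def)
    have "\<exists>z. x < z \<and> z < x + 1 \<and> (x + 1) powr (- s) - x powr (- s) = (x + 1 - x) * (- s * z powr (- s - 1))"
      using x by (intro MVT2) (auto intro!: derivative_eq_intros)
    then obtain z where z: "x < z" "z < x + 1" "(x + 1) powr (- s) - x powr (- s) = - s * z powr (- s - 1)"
      by auto
    have "(x + 1) powr (- s - 1) \<le> z powr (- s - 1)"
      using z x assms by (intro powr_mono2') auto
    then have "s * (x + 1) powr (- s - 1) \<le> s * z powr (- s - 1)"
      using assms by (intro mult_left_mono) auto
    then have "s * (x + 1) powr (- 1 - s) \<le> x powr (- s) - (x + 1) powr (- s)"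
      using z(3) unfolding minus_diff_commute[of s 1] by linarith
    then have "(x + 1) powr (- 1 - s) \<le> (x powr (- s) - (x + 1) powr (- s)) / s"
      using assms by (simp add: field_simps)
    moreover have "real (Suc (Suc N)) = x + 1" by (simp add: x_def)
    ultimately show ?case using Suc.IH
      by (simp add: x_def[symmetric] diff_divide_distrib add.commute[of 1 x])
  qed
  from this[of "N - 1"] have "N > 0 \<Longrightarrow> (\<Sum>m=1..N. real m powr (- 1 - s)) \<le> 1 + (1 - real N powr (- s)) / s"
    by simp
  moreover have "(1 - real N powr (- s)) / s \<le> 1 / s" using assms by (intro divide_right_mono) auto
  ultimately show ?thesis using assms by (cases "N = 0") auto
qed

text \<open>Each a leaves at most two choices of b, and the crude count 2 (2 m + 1) is at most 6 m
  because m is positive.\<close>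

lemma card_diamond_le:
  assumes "m > 0"
  shows "finite {(a :: int, b :: int). \<bar>a\<bar> + \<bar>b\<bar> = int m}"
    and "card {(a :: int, b :: int). \<bar>a\<bar> + \<bar>b\<bar> = int m} \<le> 6 * m"
proof -
  let ?f = "\<lambda>(a :: int, s :: int). (a, s * (int m - \<bar>a\<bar>))"
  have sub: "{(a, b). \<bar>a\<bar> + \<bar>b\<bar> = int m} \<subseteq> ?f ` ({- int m..int m} \<times> {- 1, 1})"
  proof safe
    fix a b :: int assume *: "\<bar>a\<bar> + \<bar>b\<bar> = int m"
    show "(a, b) \<in> ?f ` ({- int m..int m} \<times> {- 1, 1})"
      using * by (intro image_eqI[of _ _ "(a, if b < 0 then - 1 else 1)"]) auto
  qed
  have fin: "finite ({- int m..int m} \<times> {- 1, 1 :: int})" by simp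
  show "finite {(a :: int, b :: int). \<bar>a\<bar> + \<bar>b\<bar> = int m}" using finite_subset[OF sub] fin by blast
  have "card {(a :: int, b :: int). \<bar>a\<bar> + \<bar>b\<bar> = int m} \<le> card ({- int m..int m} \<times> {- 1, 1 :: int})"
    using surj_card_le[OF fin sub] .
  also have "\<dots> \<le> 6 * m" using assms by (simp add: card_cartesian_product)
  finally show "card {(a :: int, b :: int). \<bar>a\<bar> + \<bar>b\<bar> = int m} \<le> 6 * m" .
qed

context quadratic_ints
begin

text \<open>The imaginary part controls b, and the triangle inequality then controls a.\<close>

lemma coeffs_le_cmod: "\<exists>M\<ge>1. \<forall>a b. real_of_int (\<bar>a\<bar> + \<bar>b\<bar>) \<le> M * cmod (of_int a + of_int b * w)"
proof (intro exI[of _ "1 + (cmod w + 1) / Im w"] conjI allI)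
  show "1 \<le> 1 + (cmod w + 1) / Im w" using Im_pos by simp
  fix a b :: int
  let ?z = "of_int a + of_int b * w"
  have "\<bar>Im ?z\<bar> \<le> cmod ?z" by (rule abs_Im_le_cmod)
  then have b: "\<bar>real_of_int b\<bar> \<le> cmod ?z / Im w" using Im_pos by (simp add: abs_mult field_simps)
  have "cmod (of_int a) = cmod (?z - of_int b * w)" by simp
  also have "\<dots> \<le> cmod ?z + cmod (of_int b * w)" by (rule norm_triangle_ineq4)
  finally have a: "\<bar>real_of_int a\<bar> \<le> cmod ?z + \<bar>real_of_int b\<bar> * cmod w" by (simp add: norm_mult)
  have "\<bar>real_of_int b\<bar> * (cmod w + 1) \<le> cmod ?z / Im w * (cmod w + 1)"
    using b by (intro mult_right_mono) auto
  then show "real_of_int (\<bar>a\<bar> + \<bar>b\<bar>) \<le> (1 + (cmod w + 1) / Im w) * cmod ?z"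
    using a by (simp add: algebra_simps)
qed

text \<open>Group the points by |a| + |b| = m: there are at most 6 m of them, each of modulus at
  least m / M, so the sum is dominated by a multiple of the sum of
  \<open>m powr (1 - t)\<close>.\<close>

lemma lattice_sum_bound:
  "\<exists>C>0. \<forall>t\<in>{2<..3}. \<forall>A. finite A \<longrightarrow> A \<subseteq> \<O> \<longrightarrow> (\<Sum>x\<in>A. cmod x powr (- t)) \<le> C / (t - 2)"
proof -
  obtain M where M: "M \<ge> 1" and cf: "\<And>a b. real_of_int (\<bar>a\<bar> + \<bar>b\<bar>) \<le> M * cmod (of_int a + of_int b * w)"
    using coeffs_le_cmod by blast
  have "(\<Sum>x\<in>A. cmod x powr (- t)) \<le> 12 * M ^ 3 / (t - 2)"
    if t: "t \<in> {2<..3}" and A: "finite A" "A \<subseteq> \<O>" for t A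
  proof -
    define e where "e = (\<lambda>(a, b). of_int a + of_int b * w)"
    have inj: "inj e" using coeffs_unique by (auto simp: inj_on_def e_def)
    define D where "D m = {(a :: int, b :: int). \<bar>a\<bar> + \<bar>b\<bar> = int m}" for m
    define h where "h = (\<lambda>(a :: int, b :: int). nat (\<bar>a\<bar> + \<bar>b\<bar>))"
    have D_h: "y \<in> D m \<longleftrightarrow> h y = m" for y m by (cases y) (auto simp: D_def h_def)
    define B where "B = e -` (A - {0})"
    have finB: "finite B" unfolding B_def using A inj by (intro finite_vimageI) auto
    have AB: "A - {0} = e ` B"
    proof
      show "A - {0} \<subseteq> e ` B"
      proof
        fix x assume x: "x \<in> A - {0}"
        then have "x \<in> \<O>" using A by auto
        then obtain a b where "x = e (a, b)" by (auto simp: e_def elim!: zspanE)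
        then show "x \<in> e ` B" using x by (auto simp: B_def)
      qed
    qed (auto simp: B_def)
    define N where "N = Max (insert 0 (h ` B))"
    have hB: "y \<in> (\<Union>m\<in>{1..N}. D m)" if "y \<in> B" for y
    proof -
      have "h y \<le> N" unfolding N_def using finB that by (intro Max_ge) auto
      moreover have "e y \<noteq> 0" using that by (auto simp: B_def)
      have "h y \<noteq> 0"
      proof
        assume "h y = 0"
        moreover obtain a b where y: "y = (a, b)" by (cases y)
        ultimately have "a = 0" "b = 0" by (simp_all add: h_def)
        then show False using \<open>e y \<noteq> 0\<close> y by (simp add: e_def)
      qed
      ultimately show ?thesis by (simp add: D_h)
    qed
    have Dm: "finite (D m)" "card (D m) \<le> 6 * m" if "m \<in> {1..N}" for m
      using card_diamond_le[of m] that by (auto simp: D_def)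
    have "(\<Sum>x\<in>A. cmod x powr (- t)) = (\<Sum>x\<in>A - {0}. cmod x powr (- t))"
      using A by (intro sum.mono_neutral_right) auto
    also have "\<dots> = (\<Sum>y\<in>B. cmod (e y) powr (- t))"
      unfolding AB using inj by (subst sum.reindex) (auto intro: inj_on_subset)
    also have "\<dots> \<le> (\<Sum>y\<in>(\<Union>m\<in>{1..N}. D m). cmod (e y) powr (- t))"
      using hB Dm by (intro sum_mono2) auto
    also have "\<dots> = (\<Sum>m=1..N. \<Sum>y\<in>D m. cmod (e y) powr (- t))"
      using Dm by (intro sum.UNION_disjoint) (auto simp: D_h)
    also have "\<dots> \<le> (\<Sum>m=1..N. 6 * M ^ 3 * real m powr (- 1 - (t - 2)))"
    proof (rule sum_mono)
      fix m assume m: "m \<in> {1..N}"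
      have "cmod (e y) powr (- t) \<le> M ^ 3 * real m powr (- t)" if "y \<in> D m" for y
      proof -
        obtain a b where y: "y = (a, b)" by (cases y)
        have "\<bar>a\<bar> + \<bar>b\<bar> = int m" using that y by (simp add: D_def)
        then have "real m \<le> M * cmod (e y)" using cf[of a b] by (simp add: e_def y)
        then have "real m / M \<le> cmod (e y)" using M by (simp add: field_simps)
        then have "cmod (e y) powr (- t) \<le> (real m / M) powr (- t)"
          using M m t by (intro powr_mono2') auto
        also have "\<dots> = M powr t * real m powr (- t)"
          using M m by (simp add: powr_divide powr_minus field_simps)
        \<comment> \<open>The restriction to t at most 3 keeps the constant independent of
          t.\<close>
        also have "M powr t \<le> M powr 3" using M t by (intro powr_mono) auto
        also have "M powr 3 = M ^ 3" using M by simp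
        finally show ?thesis by (simp add: mult_right_mono)
      qed
      then have "(\<Sum>y\<in>D m. cmod (e y) powr (- t)) \<le> of_nat (card (D m)) * (M ^ 3 * real m powr (- t))"
        by (rule sum_bounded_above)
      also have "\<dots> \<le> real (6 * m) * (M ^ 3 * real m powr (- t))"
        using Dm[OF m] M by (intro mult_right_mono) auto
      also have "real m powr (- 1 - (t - 2)) = real m powr (1 + (- t))" by simp
      then have "real (6 * m) * (M ^ 3 * real m powr (- t)) = 6 * M ^ 3 * real m powr (- 1 - (t - 2))"
        using m by (simp only: powr_add) simp
      finally show "(\<Sum>y\<in>D m. cmod (e y) powr (- t)) \<le> 6 * M ^ 3 * real m powr (- 1 - (t - 2))" .
    qed
    also have "\<dots> = 6 * M ^ 3 * (\<Sum>m=1..N. real m powr (- 1 - (t - 2)))" by (simp only: sum_distrib_left)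
    also have "\<dots> \<le> 6 * M ^ 3 * (1 + 1 / (t - 2))"
      using M t by (intro mult_left_mono sum_powr_le) auto
    \<comment> \<open>On this range the summand 1 is absorbed into the pole, which doubles the
      constant 6 to 12.\<close>
    also have "1 \<le> 1 / (t - 2)" using t by simp
    then have "6 * M ^ 3 * (1 + 1 / (t - 2)) \<le> 6 * M ^ 3 * (2 / (t - 2))"
      using M by (intro mult_left_mono) auto
    finally show ?thesis by simp
  qed
  then show ?thesis using M by (intro exI[of _ "12 * M ^ 3"]) auto
qed

lemma summable_cmod_powr:
  assumes "t \<in> {2<..3}" shows "(\<lambda>x. cmod x powr (- t)) summable_on \<O>"
proof -
  obtain C where "\<And>A. finite A \<Longrightarrow> A \<subseteq> \<O> \<Longrightarrow> (\<Sum>x\<in>A. cmod x powr (- t)) \<le> C / (t - 2)"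
    using lattice_sum_bound assms by meson
  then show ?thesis
    by (intro nonneg_bdd_above_summable_on bdd_aboveI2[where M = "C / (t - 2)"]) auto
qed

lemma infsum_cmod_powr_le:
  "\<exists>C>0. \<forall>t\<in>{2<..3}. (\<Sum>\<^sub>\<infinity>x\<in>\<O>. cmod x powr (- t)) \<le> C / (t - 2)"
proof -
  obtain C where C: "C > 0" "\<And>t A. t \<in> {2<..3} \<Longrightarrow> finite A \<Longrightarrow> A \<subseteq> \<O> \<Longrightarrow> (\<Sum>x\<in>A. cmod x powr (- t)) \<le> C / (t - 2)"
    using lattice_sum_bound by meson
  then show ?thesis using summable_cmod_powr
    by (intro exI[of _ C] conjI ballI infsum_le_finite_sums) auto
qed

end

lemma cis_index_mod:
  assumes "n > 0"
  shows "cis (2 * pi * real j * real (k mod n) / real n) = cis (2 * pi * real j * real k / real n)"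
proof -
  have "real k = real (n * (k div n) + k mod n)" by simp
  also have "\<dots> = real n * real (k div n) + real (k mod n)" by (simp only: of_nat_add of_nat_mult)
  finally have "2 * pi * real j * real k / real n
      = 2 * pi * real (j * (k div n)) + 2 * pi * real j * real (k mod n) / real n"
    using assms by (simp add: field_simps)
  then have "cis (2 * pi * real j * real k / real n)
      = cis (2 * pi * real (j * (k div n))) * cis (2 * pi * real j * real (k mod n) / real n)"
    by (simp only: cis_mult)
  moreover have "cis (2 * pi * real (j * (k div n))) = 1" by (intro cis_multiple_2pi) simp
  ultimately show ?thesis by simp
qed

text \<open>Real part of the expansion of \<open>ln (1 - z)\<close>. The quadratic error is what
  makes the remainders summable over all primes.\<close>

lemma ln_cmod_one_minus:
  assumes "cmod z \<le> 1 / 2"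
  shows "\<bar>ln (cmod (1 - z)) + Re z\<bar> \<le> 2 * (cmod z)\<^sup>2"
proof -
  have ne: "1 - z \<noteq> 0" using assms by auto
  have "cmod (ln (1 + - z) - - z) \<le> (cmod (- z))\<^sup>2 / (1 - cmod (- z))"
    using assms by (intro Ln_approx_linear) simp
  also have "\<dots> \<le> (cmod z)\<^sup>2 / (1 / 2)"
    using assms by (simp only: norm_minus_cancel) (intro divide_left_mono; simp)
  finally have "cmod (ln (1 - z) + z) \<le> 2 * (cmod z)\<^sup>2" by simp
  moreover have "\<bar>Re (ln (1 - z) + z)\<bar> \<le> cmod (ln (1 - z) + z)" by (rule abs_Re_le_cmod)
  moreover have "Re (ln (1 - z) + z) = ln (cmod (1 - z)) + Re z" using ne by simp
  ultimately show ?thesis by simp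
qed

context inert_index
begin

subsection \<open>Characters and the sieve\<close>

text \<open>For j from 0 to p these are all the characters of the cyclic class group, read off from
  the index and extended by 0 to multiples of p; j = 0 is the trivial one.\<close>

definition chi :: "nat \<Rightarrow> complex \<Rightarrow> complex" where
  "chi j x = (if x \<in> \<O> \<and> \<not> of_nat p dvO x then cis (2 * pi * real j * real (ind x) / real (p + 1)) else 0)"

definition lterm :: "nat \<Rightarrow> real \<Rightarrow> complex \<Rightarrow> complex" where
  "lterm j t x = chi j x * of_real (cmod x powr (- t))"

text \<open>The exponent is that of the absolute value, not of the norm, so the pole is at \<open>t = 2\<close>. The term at \<open>0\<close>
  vanishes, and every nonzero ideal is counted twice, once for each generator.\<close>

definition L :: "nat \<Rightarrow> real \<Rightarrow> complex" where
  "L j t = (\<Sum>\<^sub>\<infinity>x\<in>\<O>. lterm j t x)"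

lemma chi_mult: "x \<in> \<O> \<Longrightarrow> y \<in> \<O> \<Longrightarrow> chi j (x * y) = chi j x * chi j y"
proof (cases "of_nat p dvO x \<or> of_nat p dvO y")
  case True
  assume "x \<in> \<O>" "y \<in> \<O>"
  then show ?thesis using True p_not_dv_mult[of x y] by (auto simp: chi_def)
next
  case False
  assume xy: "x \<in> \<O>" "y \<in> \<O>"
  have "chi j (x * y) = cis (2 * pi * real j * real ((ind x + ind y) mod (p + 1)) / real (p + 1))"
    using xy False p_not_dv_mult[of x y] ind_mult[of x y] by (simp add: chi_def)
  also have "\<dots> = cis (2 * pi * real j * real (ind x + ind y) / real (p + 1))"
    by (rule cis_index_mod) simp
  also have "\<dots> = chi j x * chi j y"
    using xy False by (simp add: chi_def cis_mult add_divide_distrib algebra_simps)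
  finally show ?thesis .
qed

lemma chi_one [simp]: "chi j 1 = 1" and chi_minus_one [simp]: "chi j (- 1) = 1"
  using p_not_dv_1 by (simp_all add: chi_def)

lemma chi_cong: "of_nat p dvO (x - y) \<Longrightarrow> x \<in> \<O> \<Longrightarrow> y \<in> \<O> \<Longrightarrow> chi j x = chi j y"
proof -
  assume *: "of_nat p dvO (x - y)" "x \<in> \<O>" "y \<in> \<O>"
  have "of_nat p dvO x \<longleftrightarrow> of_nat p dvO y"
    using dv_add[OF *(1), of y] dv_diff[of "of_nat p" x "x - y"] *(1) by auto
  then show ?thesis using * ind_cong[of x y] by (auto simp: chi_def)
qed

lemma norm_chi_le: "cmod (chi j x) \<le> 1"
  by (simp add: chi_def)

text \<open>The angles for j and p + 1 - j add up to a multiple of a full turn.\<close>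

lemma chi_cnj: "j \<le> p + 1 \<Longrightarrow> chi (p + 1 - j) x = cnj (chi j x)"
proof (cases "x \<in> \<O> \<and> \<not> of_nat p dvO x")
  case True
  assume j: "j \<le> p + 1"
  have "chi (p + 1 - j) x = cis (2 * pi * real (ind x) + - (2 * pi * real j * real (ind x) / real (p + 1)))"
    using True j by (simp add: chi_def of_nat_diff field_simps)
  also have "\<dots> = cis (2 * pi * real (ind x)) * cis (- (2 * pi * real j * real (ind x) / real (p + 1)))"
    by (simp only: cis_mult)
  also have "cis (2 * pi * real (ind x)) = 1" by (intro cis_multiple_2pi) simp
  finally show ?thesis using True by (simp add: chi_def cis_cnj)
qed (auto simp: chi_def)

lemma norm_lterm_le: "cmod (lterm j t x) \<le> cmod x powr (- t)"
  using mult_right_mono[OF norm_chi_le[of j x], of "cmod x powr (- t)"] by (simp add: lterm_def norm_mult)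

lemma lterm_mult: "x \<in> \<O> \<Longrightarrow> y \<in> \<O> \<Longrightarrow> lterm j t (x * y) = lterm j t x * lterm j t y"
  by (simp add: lterm_def chi_mult norm_mult powr_mult)

lemma lterm_zero [simp]: "lterm j t 0 = 0"
  by (simp add: lterm_def)

lemma abs_summable_lterm: "t \<in> {2<..3} \<Longrightarrow> A \<subseteq> \<O> \<Longrightarrow> (\<lambda>x. cmod (lterm j t x)) summable_on A"
  by (rule Infinite_Sum.abs_summable_on_comparison_test'[OF summable_on_subset[OF summable_cmod_powr] norm_lterm_le])

lemma summable_lterm: "t \<in> {2<..3} \<Longrightarrow> A \<subseteq> \<O> \<Longrightarrow> lterm j t summable_on A"
  using abs_summable_summable[OF abs_summable_lterm] .

text \<open>Selects one of each pair q, -q of associate primes, so that no Euler factor is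
  repeated.\<close>

definition PP :: "complex set" where
  "PP = {q. prO q \<and> (Im q > 0 \<or> Im q = 0 \<and> Re q > 0)}"

lemma PP_dv: "q \<in> PP \<Longrightarrow> r \<in> PP \<Longrightarrow> q dvO r \<Longrightarrow> q = r"
  using prO_dv_prO[of q r] by (auto simp: PP_def)

lemma PP_prO: "q \<in> PP \<Longrightarrow> prO q"
  by (simp add: PP_def)

lemma prO_PP: "prO q \<Longrightarrow> q \<in> PP \<or> - q \<in> PP"
proof -
  assume q: "prO q"
  then have "Re q \<noteq> 0 \<or> Im q \<noteq> 0" using prO_nz complex_eq_0 by (metis complex_eq_iff zero_complex.sel)
  then show ?thesis using q by (auto simp: PP_def)
qed

definition sifted :: "complex set \<Rightarrow> complex set" where
  "sifted F = {x \<in> \<O>. \<forall>q\<in>F. \<not> q dvO x}"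

lemma sifted_sub: "sifted F \<subseteq> \<O>"
  by (auto simp: sifted_def)

text \<open>No prime of F divides q, so the elements of \<open>sifted F\<close> divisible by q are
  exactly q times elements of \<open>sifted F\<close>.\<close>

lemma sifted_insert:
  assumes "q \<in> PP" "F \<subseteq> PP" "q \<notin> F"
  shows "sifted F = sifted (insert q F) \<union> (*) q ` sifted F" "sifted (insert q F) \<inter> (*) q ` sifted F = {}"
proof -
  have q: "prO q" "q \<in> \<O>" using assms PP_prO prO_in by auto
  have sub: "(*) q ` sifted F \<subseteq> sifted F"
  proof
    fix x assume "x \<in> (*) q ` sifted F"
    then obtain y where y: "y \<in> \<O>" "\<forall>r\<in>F. \<not> r dvO y" "x = q * y" by (auto simp: sifted_def)
    have "\<not> r dvO (q * y)" if r: "r \<in> F" for r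
    proof
      assume "r dvO (q * y)"
      then have "r dvO q" using prO_dv_mult[of r q y] r assms PP_prO q y by blast
      then have "r = q" using PP_dv[of r q] r assms by blast
      then show False using r assms by blast
    qed
    then show "x \<in> sifted F" using y q by (simp add: sifted_def)
  qed
  show "sifted F = sifted (insert q F) \<union> (*) q ` sifted F"
  proof (intro Set.equalityI Set.subsetI)
    fix x assume x: "x \<in> sifted F"
    show "x \<in> sifted (insert q F) \<union> (*) q ` sifted F"
    proof (cases "q dvO x")
      case True
      then obtain y where y: "y \<in> \<O>" "x = q * y" by (rule dvE)
      have "\<not> r dvO y" if "r \<in> F" for r
        using x that y q dv_mult(2)[of r y q] by (auto simp: sifted_def)
      then show ?thesis using y by (auto simp: sifted_def)
    qed (use x in \<open>auto simp: sifted_def\<close>)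
  next
    fix x assume "x \<in> sifted (insert q F) \<union> (*) q ` sifted F"
    then show "x \<in> sifted F" using sub by (auto simp: sifted_def)
  qed
  show "sifted (insert q F) \<inter> (*) q ` sifted F = {}"
    using dvI[of _ q] by (auto simp: sifted_def)
qed

text \<open>An exact finite Euler product: by multiplicativity, sieving by one more prime q
  multiplies the sum by \<open>1 - lterm j t q\<close>.\<close>

lemma infsum_sifted:
  assumes t: "t \<in> {2<..3}" and F: "finite F" "F \<subseteq> PP"
  shows "(\<Sum>\<^sub>\<infinity>x\<in>sifted F. lterm j t x) = L j t * (\<Prod>q\<in>F. 1 - lterm j t q)"
  using F
proof (induction F rule: finite_induct)
  case empty
  have "sifted {} = \<O>" by (auto simp: sifted_def)
  then show ?case by (simp add: L_def)
next
  case (insert q F)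
  have q: "q \<in> PP" "F \<subseteq> PP" "q \<notin> F" "q \<in> \<O>" "q \<noteq> 0" using insert PP_prO prO_in prO_nz by auto
  let ?S = "\<lambda>A. infsum (lterm j t) A"
  have "?S (sifted F) = ?S (sifted (insert q F)) + ?S ((*) q ` sifted F)"
  proof (subst sifted_insert(1)[OF q(1-3)], rule infsum_Un_disjoint)
    show "lterm j t summable_on sifted (insert q F)" by (intro summable_lterm t sifted_sub)
    have "(*) q ` sifted F \<subseteq> \<O>" using q(4) by (auto dest: subsetD[OF sifted_sub])
    then show "lterm j t summable_on (*) q ` sifted F" by (intro summable_lterm t)
  qed (rule sifted_insert(2)[OF q(1-3)])
  also have "?S ((*) q ` sifted F) = (\<Sum>\<^sub>\<infinity>x\<in>sifted F. lterm j t (q * x))"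
    using q(5) by (subst infsum_reindex) (auto simp: inj_on_def o_def)
  also have "\<dots> = (\<Sum>\<^sub>\<infinity>x\<in>sifted F. lterm j t q * lterm j t x)"
    using q(4) sifted_sub by (intro infsum_cong lterm_mult) auto
  also have "\<dots> = lterm j t q * ?S (sifted F)" by (rule infsum_cmult_right')
  finally have "?S (sifted (insert q F)) + lterm j t q * ?S (sifted F) = ?S (sifted F)" by (rule sym)
  then have "?S (sifted (insert q F)) = (1 - lterm j t q) * ?S (sifted F)"
    by (simp only: left_diff_distrib mult_1_left eq_diff_eq)
  then show ?case using insert q by (simp add: mult_ac)
qed

text \<open>A finite set A carries all of the absolute sum except at most 1. Sieving by a prime
  divisor of each nonzero nonunit of A leaves 1 and -1, which contribute 2, the harmless 0, and
  points outside A. The choice is the same for every j.\<close>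

lemma exists_sieve_primes:
  assumes t: "t \<in> {2<..3}"
  shows "\<exists>F. finite F \<and> F \<subseteq> PP \<and> (\<forall>j. cmod ((\<Sum>\<^sub>\<infinity>x\<in>sifted F. lterm j t x) - 2) \<le> 1)"
proof -
  let ?g = "\<lambda>x. cmod x powr (- t)"
  have sg: "?g summable_on A" if "A \<subseteq> \<O>" for A using summable_on_subset[OF summable_cmod_powr[OF t] that] .
  obtain A where A: "finite A" "A \<subseteq> \<O>" "dist (sum ?g A) (infsum ?g \<O>) \<le> 1"
    using infsum_finite_approximation[OF summable_cmod_powr[OF t], of 1] by auto
  have "infsum ?g \<O> = infsum ?g (A \<union> (\<O> - A))" using A by (simp add: Un_absorb1)
  also have "\<dots> = sum ?g A + infsum ?g (\<O> - A)"
    using A sg[of "\<O> - A"] by (subst infsum_Un_disjoint) auto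
  finally have tail: "infsum ?g (\<O> - A) \<le> 1" using A(3) by (simp add: dist_real_def)
  have "\<exists>q\<in>PP. q dvO x" if x: "x \<in> A" "x \<noteq> 0" "cmod x \<noteq> 1" for x
  proof -
    obtain q where q: "prO q" "q dvO x" using exists_prO_dv[of x] x A by auto
    then have "- q dvO x" by simp
    then show ?thesis using prO_PP[OF q(1)] q(2) by blast
  qed
  then obtain f where f: "\<And>x. x \<in> A \<Longrightarrow> x \<noteq> 0 \<Longrightarrow> cmod x \<noteq> 1 \<Longrightarrow> f x \<in> PP \<and> f x dvO x" by metis
  define F where "F = f ` {x \<in> A. x \<noteq> 0 \<and> cmod x \<noteq> 1}"
  have F: "finite F" "F \<subseteq> PP" using A f by (auto simp: F_def)
  have nA: "x \<notin> A" if x: "x \<in> sifted F - {0, 1, - 1}" for x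
  proof
    assume "x \<in> A"
    moreover have "cmod x \<noteq> 1" using unit[of x] x sifted_sub by auto
    ultimately have "f x \<in> F" "f x dvO x" using x f by (auto simp: F_def)
    then show False using x by (auto simp: sifted_def)
  qed
  have one: "1 \<in> sifted F"
  proof -
    have "\<not> q dvO 1" if "q \<in> F" for q
      using dv_cmod_le[of q 1] prO_cmod_gt[of q] PP_prO that F by auto
    then show ?thesis by (simp add: sifted_def)
  qed
  then have mone: "- 1 \<in> sifted F" by (simp add: sifted_def)
  have "cmod ((\<Sum>\<^sub>\<infinity>x\<in>sifted F. lterm j t x) - 2) \<le> 1" for j
  proof -
    have "(\<Sum>\<^sub>\<infinity>x\<in>sifted F. lterm j t x) = (\<Sum>\<^sub>\<infinity>x\<in>{1, - 1} \<union> (sifted F - {0, 1, - 1}). lterm j t x)"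
      using one mone by (intro infsum_cong_neutral) auto
    also have "\<dots> = (\<Sum>\<^sub>\<infinity>x\<in>{1, - 1}. lterm j t x) + (\<Sum>\<^sub>\<infinity>x\<in>sifted F - {0, 1, - 1}. lterm j t x)"
      using sifted_sub[of F] by (intro infsum_Un_disjoint summable_lterm t) auto
    also have "(\<Sum>\<^sub>\<infinity>x\<in>{1, - 1}. lterm j t x) = 2" by (simp add: lterm_def)
    finally have "(\<Sum>\<^sub>\<infinity>x\<in>sifted F. lterm j t x) - 2 = (\<Sum>\<^sub>\<infinity>x\<in>sifted F - {0, 1, - 1}. lterm j t x)" by simp
    also have "cmod \<dots> \<le> (\<Sum>\<^sub>\<infinity>x\<in>sifted F - {0, 1, - 1}. cmod (lterm j t x))"
      using sifted_sub[of F] by (intro norm_infsum_bound abs_summable_lterm t) auto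
    also have "\<dots> \<le> infsum ?g (\<O> - A)"
      using sifted_sub[of F] nA norm_lterm_le
      by (intro infsum_mono_neutral abs_summable_lterm t sg) auto
    finally show ?thesis using tail by simp
  qed
  then show ?thesis using F by blast
qed

text \<open>Take logarithms in the sieve identity. The sifted sum has modulus between 1 and 3, which
  costs ln 3, and the quadratic errors cost 2 C. The set F varies with t, but K is uniform.\<close>

lemma log_L_prime_sum:
  "\<exists>K. \<forall>t\<in>{2<..3}. \<exists>F. finite F \<and> F \<subseteq> PP \<and>
     (\<forall>j. L j t \<noteq> 0 \<and> \<bar>ln (cmod (L j t)) - (\<Sum>q\<in>F. Re (lterm j t q))\<bar> \<le> K)"
proof -
  \<comment> \<open>The lattice bound at t = 3, where the denominator is 1.\<close>
  obtain C where C: "\<And>A. finite A \<Longrightarrow> A \<subseteq> \<O> \<Longrightarrow> (\<Sum>x\<in>A. cmod x powr (- 3)) \<le> C"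
  proof -
    obtain C where "\<forall>t\<in>{2<..3}. \<forall>A. finite A \<longrightarrow> A \<subseteq> \<O> \<longrightarrow> (\<Sum>x\<in>A. cmod x powr (- t)) \<le> C / (t - 2)"
      using lattice_sum_bound by blast
    from bspec[OF this, of 3] show ?thesis by (intro that[of C]) auto
  qed
  show ?thesis
  proof (intro exI[of _ "ln 3 + 2 * C"] ballI)
    fix t :: real assume t: "t \<in> {2<..3}"
    obtain F where F: "finite F" "F \<subseteq> PP" and near: "\<And>j. cmod ((\<Sum>\<^sub>\<infinity>x\<in>sifted F. lterm j t x) - 2) \<le> 1"
      using exists_sieve_primes[OF t] by blast
    have "L j t \<noteq> 0 \<and> \<bar>ln (cmod (L j t)) - (\<Sum>q\<in>F. Re (lterm j t q))\<bar> \<le> ln 3 + 2 * C" for j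
    proof -
      define S where "S = (\<Sum>\<^sub>\<infinity>x\<in>sifted F. lterm j t x)"
      have S: "S = L j t * (\<Prod>q\<in>F. 1 - lterm j t q)" unfolding S_def by (rule infsum_sifted[OF t F])
      have "cmod (S - 2) \<le> 1" using near unfolding S_def .
      then have S13: "1 \<le> cmod S" "cmod S \<le> 3"
        using norm_triangle_ineq2[of 2 "2 - S"] norm_triangle_ineq[of "S - 2" 2]
        by (auto simp: norm_minus_commute)
      then have S0: "S \<noteq> 0" by auto
      \<comment> \<open>Prime elements have norm at least 2, which keeps the terms in the range of
        the logarithm estimate. The exponent -3 is weaker than the available -4 but lies within the
        range of the lattice bound.\<close>
      have fq: "cmod (lterm j t q) \<le> 1 / 2" "(cmod (lterm j t q))\<^sup>2 \<le> cmod q powr (- 3)" if "q \<in> F" for q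
      proof -
        have q: "q \<in> \<O>" "q \<noteq> 0" "cmod q \<noteq> 1" "cmod q > 1"
          using that F PP_prO prO_in prO_nz prO_nunit prO_cmod_gt by blast+
        have "cmod (lterm j t q) \<le> cmod q powr (- t)" by (rule norm_lterm_le)
        also have "\<dots> \<le> cmod q powr (- 2)" using q t by (intro powr_mono) auto
        also have "\<dots> = 1 / (cmod q)\<^sup>2" using q by (simp add: powr_minus_divide powr_numeral)
        finally have le: "cmod (lterm j t q) \<le> 1 / (cmod q)\<^sup>2" .
        also have "\<dots> \<le> 1 / 2" using two_le_cmod_square[OF q(1-3)] by (intro divide_left_mono) auto
        finally show "cmod (lterm j t q) \<le> 1 / 2" .
        have "(cmod (lterm j t q))\<^sup>2 \<le> (1 / (cmod q)\<^sup>2)\<^sup>2" using le by (intro power_mono) auto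
        also have "\<dots> = cmod q powr (- 4)" using q
          by (simp add: powr_minus_divide powr_numeral power_divide flip: power_mult)
        also have "\<dots> \<le> cmod q powr (- 3)" using q by (intro powr_mono) auto
        finally show "(cmod (lterm j t q))\<^sup>2 \<le> cmod q powr (- 3)" .
      qed
      have "ln (cmod S) = ln (cmod (L j t)) + (\<Sum>q\<in>F. ln (cmod (1 - lterm j t q)))"
      proof -
        have "cmod S = cmod (L j t) * (\<Prod>q\<in>F. cmod (1 - lterm j t q))" by (simp add: S norm_mult prod_norm)
        moreover have "cmod (1 - lterm j t q) > 0" if "q \<in> F" for q using fq(1)[OF that] by auto
        moreover from this have "(\<Prod>q\<in>F. cmod (1 - lterm j t q)) > 0" by (rule prod_pos)
        ultimately show ?thesis using S0 S F(1) by (simp add: ln_mult ln_prod)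
      qed
      moreover have "\<bar>\<Sum>q\<in>F. ln (cmod (1 - lterm j t q)) + Re (lterm j t q)\<bar> \<le> 2 * C"
      proof -
        have "\<bar>\<Sum>q\<in>F. ln (cmod (1 - lterm j t q)) + Re (lterm j t q)\<bar> \<le> (\<Sum>q\<in>F. 2 * cmod q powr (- 3))"
          using ln_cmod_one_minus[OF fq(1)] fq(2)
          by (intro order_trans[OF sum_abs] sum_mono) (fastforce intro: order_trans)
        also have "\<dots> = 2 * (\<Sum>q\<in>F. cmod q powr (- 3))" by (simp only: sum_distrib_left)
        also have "\<dots> \<le> 2 * C" using C[of F] F PP_prO prO_in by (simp add: subset_iff)
        finally show ?thesis .
      qed
      moreover have "0 \<le> ln (cmod S)" "ln (cmod S) \<le> ln 3"
        using S13 by (simp, subst ln_le_cancel_iff) auto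
      ultimately have "\<bar>ln (cmod (L j t)) - (\<Sum>q\<in>F. Re (lterm j t q))\<bar> \<le> ln 3 + 2 * C"
        unfolding sum.distrib by linarith
      moreover have "L j t \<noteq> 0" using S0 S by auto
      ultimately show ?thesis by blast
    qed
    then show "\<exists>F. finite F \<and> F \<subseteq> PP \<and>
        (\<forall>j. L j t \<noteq> 0 \<and> \<bar>ln (cmod (L j t)) - (\<Sum>q\<in>F. Re (lterm j t q))\<bar> \<le> ln 3 + 2 * C)"
      using F by blast
  qed
qed

end

section \<open>Lipschitz estimates for real powers\<close>

text \<open>The left side is the derivative of \<open>ln x * x powr (- t)\<close>. Trading the
  logarithm for a square root leaves exponent -5/2, which is still summable over the
  lattice.\<close>

lemma ln_mult_powr_deriv_bound:
  fixes x t :: real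
  assumes "x \<ge> 1" "t \<in> {2..3}"
  shows "\<bar>x powr (- t - 1) * (1 - t * ln x)\<bar> \<le> 6 * x powr (- 5 / 2)"
proof -
  have "ln x = 2 * ln (sqrt x)" using assms by (simp add: ln_sqrt)
  also have "\<dots> \<le> 2 * (sqrt x - 1)" using assms by (intro mult_left_mono ln_le_minus_one) auto
  finally have ln: "ln x \<le> 2 * sqrt x - 2" by simp
  have "0 \<le> t * ln x" using assms by simp
  moreover have "t * ln x \<le> 3 * ln x" using assms by (intro mult_right_mono) auto
  ultimately have "\<bar>1 - t * ln x\<bar> \<le> 6 * sqrt x" using ln by (simp add: abs_le_iff)
  moreover have "x powr (- t - 1) \<le> x powr (- 3)" using assms by (intro powr_mono) auto
  ultimately have "x powr (- t - 1) * \<bar>1 - t * ln x\<bar> \<le> x powr (- 3) * (6 * sqrt x)"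
    by (intro mult_mono) auto
  also have "\<dots> = 6 * (x powr (- 3) * x powr (1 / 2))" using assms by (simp add: powr_half_sqrt)
  also have "\<dots> = 6 * x powr (- 5 / 2)" by (simp flip: powr_add)
  finally show ?thesis by (simp add: abs_mult)
qed

lemma has_derivative_powr_minus:
  fixes x :: real
  assumes "x > 0"
  shows "((\<lambda>u. x powr (- u)) has_field_derivative - (ln x * x powr (- u))) (at u within S)"
proof -
  have "((\<lambda>u. exp (- u * ln x)) has_field_derivative - (ln x * exp (- u * ln x))) (at u within S)"
    by (auto intro!: derivative_eq_intros)
  then show ?thesis using assms by (simp add: powr_def)
qed

text \<open>A mixed second difference: the mean value bound is applied first in the exponent, and to
  the resulting derivative once more in the base.\<close>

lemma powr_diff_lipschitz:
  fixes x y m s t :: real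
  assumes m: "1 \<le> m" "m \<le> x" "m \<le> y" and st: "s \<in> {2..3}" "t \<in> {2..3}"
  shows "\<bar>(x powr (- s) - y powr (- s)) - (x powr (- t) - y powr (- t))\<bar>
    \<le> 6 * m powr (- 5 / 2) * \<bar>x - y\<bar> * \<bar>s - t\<bar>"
proof -
  have inner: "\<bar>ln x * x powr (- u) - ln y * y powr (- u)\<bar> \<le> 6 * m powr (- 5 / 2) * \<bar>x - y\<bar>"
    if u: "u \<in> {2..3}" for u
  proof -
    have "norm (ln x * x powr (- u) - ln y * y powr (- u)) \<le> (6 * m powr (- 5 / 2)) * norm (x - y)"
    proof (rule field_differentiable_bound[where S = "{m..}" and f' = "\<lambda>z. z powr (- u - 1) * (1 - u * ln z)"])
      fix z assume z: "z \<in> {m..}"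
      then have z1: "z \<ge> 1" using m by auto
      have "((\<lambda>z. ln z * z powr (- u)) has_field_derivative
          (1 / z * z powr (- u) + ln z * (- u * z powr (- u - 1)))) (at z within {m..})"
        using z1 by (auto intro!: derivative_eq_intros)
      also have "1 / z * z powr (- u) = z powr (- u - 1)" using z1 by (simp add: powr_diff)
      also have "z powr (- u - 1) + ln z * (- u * z powr (- u - 1)) = z powr (- u - 1) * (1 - u * ln z)"
        by (simp add: algebra_simps)
      finally show "((\<lambda>z. ln z * z powr (- u)) has_field_derivative z powr (- u - 1) * (1 - u * ln z))
          (at z within {m..})" .
      have "\<bar>z powr (- u - 1) * (1 - u * ln z)\<bar> \<le> 6 * z powr (- 5 / 2)"
        using ln_mult_powr_deriv_bound[OF z1 u] .
      also have "z powr (- 5 / 2) \<le> m powr (- 5 / 2)" using m z by (intro powr_mono2') auto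
      finally show "norm (z powr (- u - 1) * (1 - u * ln z)) \<le> 6 * m powr (- 5 / 2)" by simp
    qed (use m in auto)
    then show ?thesis by simp
  qed
  have "norm ((x powr (- s) - y powr (- s)) - (x powr (- t) - y powr (- t)))
      \<le> (6 * m powr (- 5 / 2) * \<bar>x - y\<bar>) * norm (s - t)"
  proof (rule field_differentiable_bound[where S = "{2..3}"
        and f' = "\<lambda>u. - (ln x * x powr (- u)) - - (ln y * y powr (- u))"])
    fix u :: real assume u: "u \<in> {2..3}"
    show "((\<lambda>u. x powr (- u) - y powr (- u)) has_field_derivative
        - (ln x * x powr (- u)) - - (ln y * y powr (- u))) (at u within {2..3})"
      using m by (intro DERIV_diff has_derivative_powr_minus) auto
    show "norm (- (ln x * x powr (- u)) - - (ln y * y powr (- u))) \<le> 6 * m powr (- 5 / 2) * \<bar>x - y\<bar>"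
      using inner[OF u] by (simp add: abs_minus_commute)
  qed (use st in auto)
  then show ?thesis by simp
qed

text \<open>A cruder bound for the finitely many small lattice points; x = 0 is allowed because such
  a point may be 0.\<close>

lemma powr_lipschitz:
  fixes x s t :: real
  assumes x: "x = 0 \<or> 1 \<le> x" and st: "s \<in> {2..3}" "t \<in> {2..3}"
  shows "\<bar>x powr (- s) - x powr (- t)\<bar> \<le> ln x * \<bar>s - t\<bar>"
proof (cases "x = 0")
  case False
  then have x1: "1 \<le> x" using x by auto
  have "norm (x powr (- s) - x powr (- t)) \<le> ln x * norm (s - t)"
  proof (rule field_differentiable_bound[where S = "{2..3}" and f' = "\<lambda>u. - (ln x * x powr (- u))"])
    fix u :: real assume u: "u \<in> {2..3}"
    show "((\<lambda>u. x powr (- u)) has_field_derivative - (ln x * x powr (- u))) (at u within {2..3})"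
      using x1 by (intro has_derivative_powr_minus) auto
    have "x powr (- u) \<le> x powr 0" using x1 u by (intro powr_mono) auto
    then show "norm (- (ln x * x powr (- u))) \<le> ln x"
      using x1 mult_left_mono[of "x powr (- u)" 1 "ln x"] by (simp add: abs_mult)
  qed (use st in auto)
  then show ?thesis by simp
qed simp

context quadratic_ints
begin

lemma finite_cmod_less: "finite {x \<in> \<O>. cmod x < B}"
proof -
  obtain M where M: "M \<ge> 1" and cf: "\<And>a b. real_of_int (\<bar>a\<bar> + \<bar>b\<bar>) \<le> M * cmod (of_int a + of_int b * w)"
    using coeffs_le_cmod by blast
  let ?k = "\<lceil>M * B\<rceil>"
  have "{x \<in> \<O>. cmod x < B} \<subseteq> (\<lambda>(a, b). of_int a + of_int b * w) ` ({- ?k..?k} \<times> {- ?k..?k})"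
  proof
    fix x assume "x \<in> {x \<in> \<O>. cmod x < B}"
    then obtain a b where x: "x = of_int a + of_int b * w" "cmod x < B" by (auto elim!: zspanE)
    have "M * cmod x \<le> M * B" using x M by (intro mult_left_mono) auto
    moreover have "real_of_int (\<bar>a\<bar> + \<bar>b\<bar>) \<le> M * cmod x" unfolding x(1) by (rule cf)
    ultimately have "real_of_int (\<bar>a\<bar> + \<bar>b\<bar>) \<le> M * B" by linarith
    then have "\<bar>a\<bar> + \<bar>b\<bar> \<le> ?k" by linarith
    then show "x \<in> (\<lambda>(a, b). of_int a + of_int b * w) ` ({- ?k..?k} \<times> {- ?k..?k})"
      using x by (intro image_eqI[of _ _ "(a, b)"]) auto
  qed
  then show ?thesis by (rule finite_subset) auto
qed

end

lemma cis_eq_1_imp_dvd: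
  assumes "n > 0" "cis (2 * pi * real_of_int k / real n) = 1"
  shows "int n dvd k"
proof -
  have "cos (2 * pi * real_of_int k / real n) = 1" using arg_cong[OF assms(2), of Re] by simp
  then obtain m :: int where "2 * pi * real_of_int k / real n = real_of_int m * 2 * pi"
    using cos_one_2pi_int by blast
  then have "real_of_int k = real_of_int (m * int n)" using assms(1) by (simp add: field_simps)
  then have "k = m * int n" by (simp only: of_int_eq_iff)
  then show ?thesis by simp
qed

lemma has_sum_minus:
  fixes f g :: "'a \<Rightarrow> real"
  assumes "(f has_sum a) A" "(g has_sum b) A"
  shows "((\<lambda>x. f x - g x) has_sum (a - b)) A"
  using has_sum_add[OF assms(1), of "\<lambda>x. - g x" "- b"] has_sum_uminus[of g A "- b"] assms(2) by simp

lemma summable_on_minus: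
  fixes f g :: "'a \<Rightarrow> real"
  assumes "f summable_on A" "g summable_on A"
  shows "(\<lambda>x. f x - g x) summable_on A"
  using has_sum_minus[OF has_sum_infsum[OF assms(1)] has_sum_infsum[OF assms(2)]] by (rule has_sum_imp_summable)

context inert_index
begin

subsection \<open>Behaviour of the series near the pole\<close>

text \<open>Multiplication by an element g of index 1 permutes the residues, so the sum equals
  \<open>chi j g\<close> times itself, and \<open>chi j g\<close> is not 1.\<close>

lemma sum_chi_reps:
  assumes j: "0 < j" "j \<le> p"
  shows "(\<Sum>r\<in>reps. chi j r) = 0"
proof -
  obtain g where g: "g \<in> \<O>" "\<not> of_nat p dvO g" "ind g = 1" using ind_1 by blast
  have "\<forall>r\<in>reps. \<exists>s\<in>reps. of_nat p dvO (g * r - s)"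
    using reps_cover g reps_in by auto
  then obtain m where m: "\<And>r. r \<in> reps \<Longrightarrow> m r \<in> reps \<and> of_nat p dvO (g * r - m r)" by metis
  have inj: "inj_on m reps"
  proof (rule inj_onI)
    fix r s assume rs: "r \<in> reps" "s \<in> reps" "m r = m s"
    have "of_nat p dvO ((g * r - m r) - (g * s - m s))"
      by (rule dv_diff[OF conjunct2[OF m[OF rs(1)]] conjunct2[OF m[OF rs(2)]]])
    also have "(g * r - m r) - (g * s - m s) = g * (r - s)" using rs by (simp add: algebra_simps)
    finally have "of_nat p dvO (r - s)" using p_inert[of g "r - s"] g rs reps_in by auto
    then show "r = s" using reps_unique rs by blast
  qed
  have img: "m ` reps = reps" using m by (intro endo_inj_surj finite_reps inj) auto
  have "(\<Sum>r\<in>reps. chi j r) = (\<Sum>r\<in>m ` reps. chi j r)" by (simp only: img)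
  also have "\<dots> = (\<Sum>r\<in>reps. chi j (m r))" using inj by (simp add: sum.reindex)
  also have "\<dots> = (\<Sum>r\<in>reps. chi j g * chi j r)"
  proof (rule sum.cong)
    fix r assume r: "r \<in> reps"
    have "chi j (g * r) = chi j (m r)" using m[OF r] r g reps_in by (intro chi_cong) auto
    then show "chi j (m r) = chi j g * chi j r" using chi_mult g r reps_in by simp
  qed simp
  also have "\<dots> = chi j g * (\<Sum>r\<in>reps. chi j r)" by (simp only: sum_distrib_left)
  finally have "(1 - chi j g) * (\<Sum>r\<in>reps. chi j r) = 0" by (simp only: left_diff_distrib) simp
  moreover have "chi j g \<noteq> 1"
  proof
    assume "chi j g = 1"
    then have "cis (2 * pi * real_of_int (int j) / real (p + 1)) = 1" using g by (simp add: chi_def)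
    then have "int (p + 1) dvd int j" by (intro cis_eq_1_imp_dvd) auto
    then show False using j zdvd_imp_le[of "int (p + 1)" "int j"] by simp
  qed
  ultimately show ?thesis by simp
qed

lemma bij_residue: "bij_betw (\<lambda>(r, y). of_nat p * y + r) (reps \<times> \<O>) \<O>"
  unfolding bij_betw_def
proof
  show "inj_on (\<lambda>(r, y). of_nat p * y + r) (reps \<times> \<O>)"
  proof (rule inj_onI, clarify)
    fix r y s z assume *: "r \<in> reps" "y \<in> \<O>" "s \<in> reps" "z \<in> \<O>" "of_nat p * y + r = of_nat p * z + s"
    then have "r - s = of_nat p * (z - y)" by (simp add: algebra_simps)
    then have "of_nat p dvO (r - s)" using dvI[of "z - y" "of_nat p"] * by simp
    then have "r = s" using reps_unique * by blast
    then show "r = s \<and> y = z" using * p_gt_1 by simp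
  qed
  show "(\<lambda>(r, y). of_nat p * y + r) ` (reps \<times> \<O>) = \<O>"
  proof
    show "(\<lambda>(r, y). of_nat p * y + r) ` (reps \<times> \<O>) \<subseteq> \<O>" using reps_in by auto
    show "\<O> \<subseteq> (\<lambda>(r, y). of_nat p * y + r) ` (reps \<times> \<O>)"
    proof
      fix x assume "x \<in> \<O>"
      then obtain r where r: "r \<in> reps" "of_nat p dvO (x - r)" using reps_cover by blast
      then obtain y where "y \<in> \<O>" "x - r = of_nat p * y" by (elim dvE)
      then show "x \<in> (\<lambda>(r, y). of_nat p * y + r) ` (reps \<times> \<O>)"
        using r by (intro image_eqI[of _ _ "(r, y)"]) (auto simp: algebra_simps)
    qed
  qed
qed

definition shift_term :: "complex \<Rightarrow> real \<Rightarrow> complex \<Rightarrow> real" where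
  "shift_term r t y = cmod (of_nat p * y + r) powr (- t)"

lemma summable_shift_term:
  assumes "t \<in> {2<..3}" "r \<in> \<O>"
  shows "shift_term r t summable_on \<O>"
proof -
  have inj: "inj_on (\<lambda>y. of_nat p * y + r) \<O>" using p_gt_1 by (auto simp: inj_on_def)
  have "(\<lambda>x. cmod x powr (- t)) summable_on (\<lambda>y. of_nat p * y + r) ` \<O>"
    using assms(2) by (intro summable_on_subset[OF summable_cmod_powr[OF assms(1)]]) auto
  then show ?thesis by (simp add: summable_on_reindex[OF inj] o_def shift_term_def[abs_def])
qed

definition H :: "complex \<Rightarrow> real \<Rightarrow> real" where
  "H r t = (\<Sum>\<^sub>\<infinity>y\<in>\<O>. shift_term r t y - shift_term 0 t y)"

text \<open>Subtracting the sum over \<^term>\<open>of_nat p * y\<close> from every residue class costs nothing, as the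
  character values add up to zero; the differences converge up to and beyond \<^term>\<open>t = 2\<close>.\<close>

lemma L_eq_sum_H:
  assumes j: "0 < j" "j \<le> p" and t: "t \<in> {2<..3}"
  shows "L j t = (\<Sum>r\<in>reps. chi j r * of_real (H r t))"
proof -
  have "L j t = (\<Sum>\<^sub>\<infinity>z\<in>reps \<times> \<O>. lterm j t ((\<lambda>(r, y). of_nat p * y + r) z))"
    unfolding L_def by (rule infsum_reindex_bij_betw[OF bij_residue, symmetric])
  also have "\<dots> = (\<Sum>\<^sub>\<infinity>r\<in>reps. \<Sum>\<^sub>\<infinity>y\<in>\<O>. lterm j t (of_nat p * y + r))"
  proof -
    have "(\<lambda>z. lterm j t ((\<lambda>(r, y). of_nat p * y + r) z)) summable_on reps \<times> \<O>"
      using summable_lterm[OF t order_refl] summable_on_reindex_bij_betw[OF bij_residue, of "lterm j t"] by blast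
    from infsum_Sigma_banach[OF this] show ?thesis by simp
  qed
  also have "\<dots> = (\<Sum>r\<in>reps. \<Sum>\<^sub>\<infinity>y\<in>\<O>. lterm j t (of_nat p * y + r))"
    by (rule infsum_finite[OF finite_reps])
  also have "\<dots> = (\<Sum>r\<in>reps. chi j r * of_real (H r t + infsum (shift_term 0 t) \<O>))"
  proof (rule sum.cong)
    fix r assume r: "r \<in> reps"
    have "(\<Sum>\<^sub>\<infinity>y\<in>\<O>. lterm j t (of_nat p * y + r)) = (\<Sum>\<^sub>\<infinity>y\<in>\<O>. chi j r * of_real (shift_term r t y))"
    proof (rule infsum_cong)
      fix y assume y: "y \<in> \<O>"
      have "chi j (of_nat p * y + r) = chi j r"
        using dvI[OF y, of "of_nat p"] y r reps_in by (intro chi_cong) auto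
      then show "lterm j t (of_nat p * y + r) = chi j r * of_real (shift_term r t y)"
        by (simp add: lterm_def shift_term_def)
    qed
    also have "\<dots> = chi j r * (\<Sum>\<^sub>\<infinity>y\<in>\<O>. of_real (shift_term r t y))" by (rule infsum_cmult_right')
    also have "(\<Sum>\<^sub>\<infinity>y\<in>\<O>. complex_of_real (shift_term r t y)) = of_real (infsum (shift_term r t) \<O>)"
      using summable_shift_term[OF t reps_in[OF r]] by (intro infsumI has_sum_of_real has_sum_infsum)
    also have "infsum (shift_term r t) \<O> = H r t + infsum (shift_term 0 t) \<O>"
    proof -
      have "infsum (\<lambda>y. (shift_term r t y - shift_term 0 t y) + shift_term 0 t y) \<O>
          = H r t + infsum (shift_term 0 t) \<O>"
        unfolding H_def using summable_shift_term[OF t reps_in[OF r]] summable_shift_term[OF t zero_in_zspan]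
        by (intro infsum_add summable_on_minus)
      then show ?thesis by simp
    qed
    finally show "(\<Sum>\<^sub>\<infinity>y\<in>\<O>. lterm j t (of_nat p * y + r))
        = chi j r * of_real (H r t + infsum (shift_term 0 t) \<O>)" .
  qed simp
  also have "\<dots> = (\<Sum>r\<in>reps. chi j r * of_real (H r t)) + (\<Sum>r\<in>reps. chi j r) * of_real (infsum (shift_term 0 t) \<O>)"
    by (simp add: algebra_simps sum.distrib sum_distrib_left)
  finally show ?thesis using sum_chi_reps[OF j] by simp
qed

text \<open>Termwise bound: away from a disc the mixed difference is of order
  \<open>cmod y powr (- 5 / 2)\<close>, which is summable; the finitely many y inside use
  \<open>powr_lipschitz\<close>.\<close>

lemma H_lipschitz:
  assumes r: "r \<in> \<O>"
  shows "\<exists>K. \<forall>s\<in>{2<..3}. \<forall>t\<in>{2<..3}. \<bar>H r s - H r t\<bar> \<le> K * \<bar>s - t\<bar>"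
proof -
  \<comment> \<open>Outside E both \<open>of_nat p * y\<close> and \<open>of_nat p * y + r\<close>
    have modulus at least |y|, and |y| is at least 1, so m = |y| is admissible in
    \<open>powr_diff_lipschitz\<close>.\<close>
  define E where "E = {y \<in> \<O>. cmod y < cmod r + 1}"
  define c where "c y = (if y \<in> E then ln (cmod (of_nat p * y + r)) + ln (cmod (of_nat p * y))
      else 6 * cmod y powr (- 5 / 2) * cmod r)" for y
  have E: "finite E" "E \<subseteq> \<O>" using finite_cmod_less by (auto simp: E_def)
  have "c summable_on (\<O> - E)"
  proof -
    have "(\<lambda>y. 6 * cmod y powr (- (5 / 2)) * cmod r) summable_on (\<O> - E)"
      by (intro summable_on_cmult_left summable_on_cmult_right summable_on_subset[OF summable_cmod_powr]) auto
    moreover have "c y = 6 * cmod y powr (- (5 / 2)) * cmod r" if "y \<in> \<O> - E" for y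
      using that by (simp add: c_def)
    ultimately show ?thesis by (subst summable_on_cong)
  qed
  then have "c summable_on ((\<O> - E) \<union> E)" using E by (intro summable_on_union) auto
  then have csum: "c summable_on \<O>" using E by (simp add: Un_absorb2)
  let ?d = "\<lambda>t y. shift_term r t y - shift_term 0 t y"
  have bound: "\<bar>?d s y - ?d t y\<bar> \<le> c y * \<bar>s - t\<bar>"
    if y: "y \<in> \<O>" and st: "s \<in> {2<..3}" "t \<in> {2<..3}" for y s t
  proof (cases "y \<in> E")
    case True
    have in1: "of_nat p * y + r \<in> \<O>" "of_nat p * y \<in> \<O>" using y r by auto
    have "\<bar>cmod (of_nat p * y + r) powr (- s) - cmod (of_nat p * y + r) powr (- t)\<bar>
        \<le> ln (cmod (of_nat p * y + r)) * \<bar>s - t\<bar>"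
      using one_le_cmod[OF in1(1)] st by (intro powr_lipschitz) auto
    moreover have "\<bar>cmod (of_nat p * y) powr (- s) - cmod (of_nat p * y) powr (- t)\<bar>
        \<le> ln (cmod (of_nat p * y)) * \<bar>s - t\<bar>"
      using one_le_cmod[OF in1(2)] st by (intro powr_lipschitz) auto
    ultimately show ?thesis using True by (simp add: c_def shift_term_def distrib_right)
  next
    case False
    then have ry: "cmod r + 1 \<le> cmod y" using y by (simp add: E_def)
    then have y1: "1 \<le> cmod y" by (rule order_trans[rotated]) simp
    have "2 * cmod y \<le> real p * cmod y" using p_gt_1 by (intro mult_right_mono) auto
    then have py: "2 * cmod y \<le> cmod (of_nat p * y)" by (simp add: norm_mult)
    have tri: "\<bar>cmod (of_nat p * y + r) - cmod (of_nat p * y)\<bar> \<le> cmod r"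
      using norm_triangle_ineq3[of "of_nat p * y + r" "of_nat p * y"] by simp
    have "\<bar>?d s y - ?d t y\<bar> \<le> 6 * cmod y powr (- 5 / 2)
        * \<bar>cmod (of_nat p * y + r) - cmod (of_nat p * y)\<bar> * \<bar>s - t\<bar>"
      unfolding shift_term_def add_0_right using y1 py tri ry st
      by (intro powr_diff_lipschitz) auto
    also have "\<dots> \<le> 6 * cmod y powr (- 5 / 2) * cmod r * \<bar>s - t\<bar>"
      using tri by (intro mult_right_mono mult_left_mono) auto
    finally show ?thesis using False by (simp add: c_def)
  qed
  have "\<bar>H r s - H r t\<bar> \<le> infsum c \<O> * \<bar>s - t\<bar>" if st: "s \<in> {2<..3}" "t \<in> {2<..3}" for s t
  proof -
    have sm: "?d u summable_on \<O>" if "u \<in> {2<..3}" for u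
      using summable_shift_term[OF that r] summable_shift_term[OF that zero_in_zspan] by (rule summable_on_minus)
    have "((\<lambda>y. ?d s y - ?d t y) has_sum (H r s - H r t)) \<O>"
      unfolding H_def using sm st by (intro has_sum_minus has_sum_infsum)
    moreover have "((\<lambda>y. c y * \<bar>s - t\<bar>) has_sum (infsum c \<O> * \<bar>s - t\<bar>)) \<O>"
      using csum by (intro has_sum_cmult_left has_sum_infsum)
    ultimately have "norm (H r s - H r t) \<le> infsum c \<O> * \<bar>s - t\<bar>"
      by (rule norm_infsum_le) (use bound st in auto)
    then show ?thesis by simp
  qed
  then show ?thesis by blast
qed

text \<open>Replaces differentiability at the edge t = 2: a nontrivial L that tends to 0 there does
  so at least linearly.\<close>

lemma L_lipschitz:
  assumes j: "0 < j" "j \<le> p"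
  shows "\<exists>K>0. \<forall>s\<in>{2<..3}. \<forall>t\<in>{2<..3}. cmod (L j s - L j t) \<le> K * \<bar>s - t\<bar>"
proof -
  have "\<forall>r\<in>reps. \<exists>K. \<forall>s\<in>{2<..3}. \<forall>t\<in>{2<..3}. \<bar>H r s - H r t\<bar> \<le> K * \<bar>s - t\<bar>"
    using H_lipschitz reps_in by blast
  then obtain K where K: "\<And>r s t. r \<in> reps \<Longrightarrow> s \<in> {2<..3} \<Longrightarrow> t \<in> {2<..3} \<Longrightarrow> \<bar>H r s - H r t\<bar> \<le> K r * \<bar>s - t\<bar>"
    by metis
  have "cmod (L j s - L j t) \<le> (1 + \<bar>\<Sum>r\<in>reps. K r\<bar>) * \<bar>s - t\<bar>" if st: "s \<in> {2<..3}" "t \<in> {2<..3}" for s t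
  proof -
    have "L j s - L j t = (\<Sum>r\<in>reps. chi j r * of_real (H r s - H r t))"
      unfolding L_eq_sum_H[OF j st(1)] L_eq_sum_H[OF j st(2)] by (simp add: algebra_simps sum_subtractf)
    also have "cmod \<dots> \<le> (\<Sum>r\<in>reps. K r * \<bar>s - t\<bar>)"
    proof (rule sum_norm_le)
      fix r assume r: "r \<in> reps"
      have "cmod (chi j r * of_real (H r s - H r t)) \<le> 1 * \<bar>H r s - H r t\<bar>"
        unfolding norm_mult norm_of_real by (intro mult_right_mono norm_chi_le) simp
      also have "1 * \<bar>H r s - H r t\<bar> \<le> K r * \<bar>s - t\<bar>" using K[OF r st] by simp
      finally show "cmod (chi j r * of_real (H r s - H r t)) \<le> K r * \<bar>s - t\<bar>" .
    qed
    also have "\<dots> = (\<Sum>r\<in>reps. K r) * \<bar>s - t\<bar>" by (simp only: sum_distrib_right)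
    also have "\<dots> \<le> (1 + \<bar>\<Sum>r\<in>reps. K r\<bar>) * \<bar>s - t\<bar>" by (intro mult_right_mono) auto
    finally show ?thesis .
  qed
  then show ?thesis by (intro exI[of _ "1 + \<bar>\<Sum>r\<in>reps. K r\<bar>"]) auto
qed

lemma L_bounded:
  assumes j: "0 < j" "j \<le> p"
  shows "\<exists>U. \<forall>t\<in>{2<..3}. cmod (L j t) \<le> U"
proof -
  obtain K where K: "K > 0" "\<And>s t. s \<in> {2<..3} \<Longrightarrow> t \<in> {2<..3} \<Longrightarrow> cmod (L j s - L j t) \<le> K * \<bar>s - t\<bar>"
    using L_lipschitz[OF j] by blast
  have "cmod (L j t) \<le> cmod (L j 3) + K" if t: "t \<in> {2<..3}" for t
  proof -
    have "cmod (L j t - L j 3) \<le> K * \<bar>t - 3\<bar>" using K(2)[OF t, of 3] by simp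
    also have "\<dots> \<le> K * 1" using K t by (intro mult_left_mono) auto
    finally show ?thesis using norm_triangle_ineq2[of "L j t" "L j 3"] by linarith
  qed
  then show ?thesis by blast
qed

lemma L0_le: "\<exists>C>0. \<forall>t\<in>{2<..3}. cmod (L 0 t) \<le> C / (t - 2)"
proof -
  obtain C where C: "C > 0" "\<And>t. t \<in> {2<..3} \<Longrightarrow> (\<Sum>\<^sub>\<infinity>x\<in>\<O>. cmod x powr (- t)) \<le> C / (t - 2)"
    using infsum_cmod_powr_le by blast
  have "cmod (L 0 t) \<le> C / (t - 2)" if t: "t \<in> {2<..3}" for t
  proof -
    have "cmod (L 0 t) \<le> (\<Sum>\<^sub>\<infinity>x\<in>\<O>. cmod (lterm 0 t x))"
      unfolding L_def by (intro norm_infsum_bound abs_summable_lterm t order_refl)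
    also have "\<dots> \<le> (\<Sum>\<^sub>\<infinity>x\<in>\<O>. cmod x powr (- t))"
      by (intro infsum_mono abs_summable_lterm summable_cmod_powr t order_refl norm_lterm_le)
    finally show ?thesis using C(2)[OF t] by simp
  qed
  then show ?thesis using C(1) by blast
qed

text \<open>A finite set of points congruent to 1 modulo p already gives a harmonic sum at t = 2,
  and a finite sum is continuous in t.\<close>

lemma L0_at_top: "filterlim (\<lambda>t. cmod (L 0 t)) at_top (at_right 2)"
  unfolding filterlim_at_top
proof
  fix Z :: real
  \<comment> \<open>Chosen so that \<open>e (k, b)\<close> has modulus at most c k.\<close>
  define c where "c = real p + 1 + real p * cmod w"
  have c: "c > 0" using p_gt_1 by (simp add: c_def add_pos_nonneg)
  \<comment> \<open>Makes the harmonic sum at least c squared times |Z| + 1. The extra 1 gives a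
    strict inequality at t = 2, which persists for t nearby.\<close>
  define N where "N = nat \<lceil>exp (c\<^sup>2 * (\<bar>Z\<bar> + 1))\<rceil>"
  have "exp (c\<^sup>2 * (\<bar>Z\<bar> + 1)) \<le> real N + 1" unfolding N_def by linarith
  then have "c\<^sup>2 * (\<bar>Z\<bar> + 1) \<le> ln (real N + 1)" by (subst ln_ge_iff) auto
  also have "\<dots> \<le> harm N" by (rule ln_le_harm)
  finally have harm: "c\<^sup>2 * (\<bar>Z\<bar> + 1) \<le> harm N" .
  \<comment> \<open>Row k has k points of modulus at most c k, hence contributes at least 1 / k
    divided by c squared.\<close>
  define e where "e = (\<lambda>(k, b). of_int (int p * int k + 1) + of_int (int p * int b) * w)"
  let ?I = "SIGMA k:{1..N}. {..<k}"
  define A where "A = e ` ?I"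
  have inj: "inj_on e ?I"
  proof (rule inj_onI, clarify)
    fix k b k' b' assume "e (k, b) = e (k', b')"
    then have "of_int (int p * int k + 1) + of_int (int p * int b) * w
        = of_int (int p * int k' + 1) + of_int (int p * int b') * w" by (simp only: e_def prod.case)
    from coeffs_unique[OF this] show "k = k' \<and> b = b'" using p_gt_1 by simp
  qed
  have A: "finite A" "A \<subseteq> \<O>" by (auto simp: A_def e_def simp del: of_int_add of_int_mult)
  have nd: "\<not> of_nat p dvO x" if "x \<in> A" for x
  proof -
    obtain k b where "x = of_int (int p * int k + 1) + of_int (int p * int b) * w"
      using \<open>x \<in> A\<close> by (auto simp: A_def e_def simp del: of_int_add of_int_mult)
    moreover have "\<not> int p dvd int p * int k + 1"
      using p_gt_1 by (simp add: dvd_add_right_iff)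
    ultimately show ?thesis by (simp only: p_dv_iff) simp
  qed
  have nz: "x \<noteq> 0" if "x \<in> A" for x using nd[OF that] by auto
  have "\<bar>Z\<bar> + 1 \<le> (\<Sum>x\<in>A. cmod x powr (- 2))"
  proof -
    have "c\<^sup>2 * (\<bar>Z\<bar> + 1) / c\<^sup>2 \<le> harm N / c\<^sup>2" using harm by (intro divide_right_mono) auto
    then have "\<bar>Z\<bar> + 1 \<le> harm N / c\<^sup>2" using c by simp
    also have "harm N / c\<^sup>2 = (\<Sum>k=1..N. \<Sum>b<k. 1 / (c * real k)\<^sup>2)"
      unfolding harm_def sum_divide_distrib
      by (intro sum.cong) (auto simp: field_simps power2_eq_square)
    also have "\<dots> = (\<Sum>(k, b)\<in>?I. 1 / (c * real k)\<^sup>2)" by (rule sum.Sigma) auto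
    also have "\<dots> \<le> (\<Sum>z\<in>?I. cmod (e z) powr (- 2))"
    proof (rule sum_mono, clarify)
      fix k b assume kb: "k \<in> {1..N}" "b < k"
      have "cmod (e (k, b)) \<le> cmod (of_int (int p * int k + 1)) + cmod (of_int (int p * int b) * w)"
        unfolding e_def prod.case by (rule norm_triangle_ineq)
      also have "\<dots> = real p * real k + 1 + real p * real b * cmod w"
        by (simp only: norm_mult norm_of_int) (simp add: abs_mult)
      also have "\<dots> \<le> real p * real k + 1 * real k + real p * real k * cmod w"
        using kb by (intro add_mono mult_right_mono mult_left_mono) auto
      also have "\<dots> = c * real k" by (simp add: c_def algebra_simps)
      finally have le: "cmod (e (k, b)) \<le> c * real k" .
      have "e (k, b) \<noteq> 0" using nz[of "e (k, b)"] kb by (auto simp: A_def)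
      then have pos: "cmod (e (k, b)) > 0" by simp
      have "1 / (c * real k)\<^sup>2 \<le> 1 / (cmod (e (k, b)))\<^sup>2"
        using le pos c kb by (intro divide_left_mono power_mono mult_pos_pos) auto
      then show "1 / (c * real k)\<^sup>2 \<le> cmod (e (k, b)) powr (- 2)"
        using pos by (simp add: powr_minus_divide powr_numeral)
    qed
    also have "\<dots> = (\<Sum>x\<in>A. cmod x powr (- 2))" unfolding A_def using inj by (simp add: sum.reindex)
    finally show ?thesis .
  qed
  moreover have "((\<lambda>t. \<Sum>x\<in>A. cmod x powr (- t)) \<longlongrightarrow> (\<Sum>x\<in>A. cmod x powr (- 2))) (at_right 2)"
    using nz by (intro tendsto_intros) auto
  ultimately have ev: "\<forall>\<^sub>F t in at_right 2. Z < (\<Sum>x\<in>A. cmod x powr (- t))"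
    by (intro order_tendstoD(1)) auto
  have "\<forall>\<^sub>F t in at_right (2::real). t \<in> {2<..3}"
    unfolding eventually_at_right_field by (intro exI[of _ 3]) auto
  with ev show "\<forall>\<^sub>F t in at_right 2. Z \<le> cmod (L 0 t)"
  proof eventually_elim
    case (elim t)
    have re: "Re (lterm 0 t x) \<ge> 0" for x by (simp add: lterm_def chi_def)
    have "(\<Sum>x\<in>A. cmod x powr (- t)) = (\<Sum>x\<in>A. Re (lterm 0 t x))"
      using nd A by (intro sum.cong) (auto simp: lterm_def chi_def)
    also have "\<dots> \<le> (\<Sum>\<^sub>\<infinity>x\<in>\<O>. Re (lterm 0 t x))"
      using A re elim by (intro finite_sum_le_infsum summable_on_Re summable_lterm) auto
    also have "\<dots> = Re (L 0 t)" unfolding L_def using elim by (intro infsum_Re summable_lterm) auto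
    also have "\<dots> \<le> cmod (L 0 t)" by (rule complex_Re_le_cmod)
    finally show ?case using elim by simp
  qed
qed

lemma cmod_L_cnj:
  assumes "j \<le> p + 1" shows "cmod (L (p + 1 - j) t) = cmod (L j t)"
proof -
  have "lterm (p + 1 - j) t x = cnj (lterm j t x)" for x
    using chi_cnj[OF assms, of x] by (simp add: lterm_def)
  then have "(\<Sum>\<^sub>\<infinity>x\<in>\<O>. lterm (p + 1 - j) t x) = (\<Sum>\<^sub>\<infinity>x\<in>\<O>. cnj (lterm j t x))"
    by (intro infsum_cong)
  then have "L (p + 1 - j) t = cnj (L j t)" by (simp only: L_def infsum_cnj)
  then show ?thesis by simp
qed

end

section \<open>Orthogonality of characters and a prime of generating class\<close>

lemma sum_cis_roots:
  assumes "n > 0"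
  shows "(\<Sum>j<n. cis (2 * pi * real_of_int k / real n * real j)) = (if int n dvd k then of_nat n else 0)"
proof -
  define z where "z = cis (2 * pi * real_of_int k / real n)"
  have eq: "cis (2 * pi * real_of_int k / real n * real j) = z ^ j" for j
    by (simp only: z_def Complex.DeMoivre mult.commute)
  show ?thesis
  proof (cases "int n dvd k")
    case True
    then obtain m where "k = int n * m" by (rule dvdE)
    then have "2 * pi * real_of_int k / real n = 2 * pi * real_of_int m" using assms by simp
    then have "z = 1" unfolding z_def by (simp only:) (intro cis_multiple_2pi, simp)
    then show ?thesis unfolding eq using True by simp
  next
    case False
    then have z: "z \<noteq> 1" unfolding z_def using cis_eq_1_imp_dvd[OF assms] by blast
    have "z ^ n = cis (2 * pi * real_of_int k)" using assms by (simp add: z_def Complex.DeMoivre)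
    also have "\<dots> = 1" by (intro cis_multiple_2pi) simp
    finally have "(\<Sum>j<n. z ^ j) = 0" using geometric_sum[OF z, of n] by simp
    then show ?thesis unfolding eq using False by simp
  qed
qed

lemma sum_cos_roots:
  assumes "n > 0"
  shows "(\<Sum>j<n. cos (2 * pi * real_of_int k / real n * real j)) = (if int n dvd k then real n else 0)"
  using arg_cong[OF sum_cis_roots[OF assms, of k], of Re] by (simp split: if_splits)

context inert_index
begin

lemma Re_lterm:
  "Re (lterm j t q) = (if q \<in> \<O> \<and> \<not> of_nat p dvO q
    then cos (2 * pi * real_of_int (int (ind q)) / real (p + 1) * real j) * cmod q powr (- t) else 0)"
  by (simp add: lterm_def chi_def mult_ac)

text \<open>By orthogonality the total is (p + 1) |q|^(-t) when q has trivial class and 0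
  otherwise.\<close>

lemma sum_Re_lterm_nonneg: "(\<Sum>j<p + 1. Re (lterm j t q)) \<ge> 0"
proof (cases "q \<in> \<O> \<and> \<not> of_nat p dvO q")
  case True
  have "(\<Sum>j<p + 1. Re (lterm j t q))
      = (\<Sum>j<p + 1. cos (2 * pi * real_of_int (int (ind q)) / real (p + 1) * real j)) * cmod q powr (- t)"
    unfolding sum_distrib_right Re_lterm using True by simp
  also have "\<dots> \<ge> 0" by (subst sum_cos_roots) simp_all
  finally show ?thesis .
qed (simp only: Re_lterm if_False sum.neutral_const order_refl)

text \<open>The product of cosines splits into cosines for \<open>ind q - 1\<close> and
  \<open>ind q + 1\<close>, so by orthogonality only the classes 1 and -1 survive.\<close>

lemma sum_cos_Re_lterm:
  assumes "\<not> (q \<in> \<O> \<and> \<not> of_nat p dvO q \<and> (ind q = 1 \<or> ind q = p))"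
  shows "(\<Sum>j<p + 1. cos (2 * pi / real (p + 1) * real j) * Re (lterm j t q)) = 0"
proof (cases "q \<in> \<O> \<and> \<not> of_nat p dvO q")
  case True
  let ?c = "\<lambda>k j. cos (2 * pi * real_of_int k / real (p + 1) * real j)"
  have "cos (2 * pi / real (p + 1) * real j) * Re (lterm j t q)
      = (?c (int (ind q) - 1) j + ?c (int (ind q) + 1) j) * (cmod q powr (- t) / 2)" for j
  proof -
    define a where "a = 2 * pi / real (p + 1) * real j"
    define b where "b = 2 * pi * real_of_int (int (ind q)) / real (p + 1) * real j"
    have "2 * pi * real_of_int (int (ind q) - 1) / real (p + 1) * real j = b - a"
      "2 * pi * real_of_int (int (ind q) + 1) / real (p + 1) * real j = b + a"
      by (simp_all add: a_def b_def algebra_simps add_divide_distrib diff_divide_distrib del: of_int_of_nat_eq)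
    moreover have "cos a * cos b = (cos (b - a) + cos (b + a)) / 2"
      by (simp add: cos_add cos_diff)
    moreover have "Re (lterm j t q) = cos b * cmod q powr (- t)"
      unfolding Re_lterm b_def using True by simp
    ultimately show ?thesis unfolding a_def[symmetric] by simp
  qed
  then have eq: "(\<Sum>j<p + 1. cos (2 * pi / real (p + 1) * real j) * Re (lterm j t q))
      = ((\<Sum>j<p + 1. ?c (int (ind q) - 1) j) + (\<Sum>j<p + 1. ?c (int (ind q) + 1) j)) * (cmod q powr (- t) / 2)"
    by (simp only: sum_distrib_right[symmetric] sum.distrib)
  have n1: "\<not> int (p + 1) dvd int (ind q) - 1"
  proof
    assume "int (p + 1) dvd int (ind q) - 1"
    then have "int (ind q) mod int (p + 1) = 1 mod int (p + 1)" by (simp only: mod_eq_dvd_iff)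
    moreover have "ind q < p + 1" using ind_less True by blast
    ultimately have "ind q = 1" using p_gt_1 by (simp flip: of_nat_mod)
    then show False using assms True by simp
  qed
  have n2: "\<not> int (p + 1) dvd int (ind q) + 1"
  proof
    assume "int (p + 1) dvd int (ind q) + 1"
    then have "int (p + 1) \<le> int (ind q) + 1" by (intro zdvd_imp_le) auto
    moreover have "ind q < p + 1" using ind_less True by blast
    ultimately have "ind q = p" by simp
    then show False using assms True by simp
  qed
  have "(\<Sum>j<p + 1. ?c k j) = 0" if "\<not> int (p + 1) dvd k" for k
  proof -
    have "0 < p + 1" by simp
    from sum_cos_roots[OF this, of k] show ?thesis by (simp only: that if_False)
  qed
  from this[OF n1] this[OF n2] show ?thesis unfolding eq by simp
next
  case False
  then have "Re (lterm j t q) = 0" for j by (simp only: Re_lterm if_False)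
  then show ?thesis by simp
qed

text \<open>If \<^term>\<open>L j\<close> tended to zero at a pair of conjugate nonreal characters, the product of all the
  series would tend to zero, while its logarithm is bounded below.\<close>

lemma L_bounded_below:
  assumes j: "0 < j" "j \<le> p" "2 * j \<noteq> p + 1"
    and lower: "\<And>t. t \<in> {2<..3} \<Longrightarrow> - B \<le> (\<Sum>j<p + 1. ln (cmod (L j t)))"
    and nz: "\<And>j t. t \<in> {2<..3} \<Longrightarrow> L j t \<noteq> 0"
    and U: "U \<ge> 1" "\<And>j t. 0 < j \<Longrightarrow> j \<le> p \<Longrightarrow> t \<in> {2<..3} \<Longrightarrow> cmod (L j t) \<le> U"
  shows "\<exists>d>0. \<forall>\<^sub>F t in at_right 2. d \<le> cmod (L j t)"
proof -
  obtain C where C: "C > 0" "\<And>t. t \<in> {2<..3} \<Longrightarrow> cmod (L 0 t) \<le> C / (t - 2)" using L0_le by blast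
  define a where "a = (B + ln C + real (p + 1) * ln U) / 2"
  \<comment> \<open>The pole enters the sum of logarithms once and the conjugate pair twice, while
    all other terms are bounded above; so the modulus decays no faster than the square root of t -
    2.\<close>
  have sqrt_le: "exp (- a) * sqrt (t - 2) \<le> cmod (L j t)" if t: "t \<in> {2<..3}" for t
  proof -
    let ?l = "\<lambda>j. ln (cmod (L j t))"
    let ?k = "p + 1 - j"
    let ?R = "{..<p + 1} - {0, j, ?k}"
    \<comment> \<open>The three split-off indices are distinct because \<open>2 * j\<close> is not p
      + 1.\<close>
    have "(\<Sum>j<p + 1. ?l j) = (\<Sum>j\<in>{0, j, ?k} \<union> ?R. ?l j)"
      using j by (intro sum.cong) auto
    also have "\<dots> = (\<Sum>j\<in>{0, j, ?k}. ?l j) + (\<Sum>j\<in>?R. ?l j)"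
      by (intro sum.union_disjoint) auto
    also have "(\<Sum>j\<in>{0, j, ?k}. ?l j) = ?l 0 + 2 * ?l j"
      using j cmod_L_cnj[of j t] by auto
    also have "(\<Sum>j\<in>?R. ?l j) \<le> real (card ?R) * ln U"
      using U t nz[OF t] by (intro sum_bounded_above) (auto simp: ln_le_cancel_iff)
    also have "\<dots> \<le> real (p + 1) * ln U"
      using U(1) card_mono[of "{..<p + 1}" ?R] by (intro mult_right_mono) auto
    also have "?l 0 \<le> ln (C / (t - 2))" using C t nz[OF t] by (subst ln_le_cancel_iff) auto
    also have "ln (C / (t - 2)) = ln C - ln (t - 2)" using C t by (simp add: ln_div)
    finally have "(\<Sum>j<p + 1. ?l j) \<le> ln C - ln (t - 2) + 2 * ?l j + real (p + 1) * ln U" by simp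
    then have "ln (t - 2) / 2 - a \<le> ?l j" using lower[OF t] by (simp add: a_def field_simps)
    then have "exp (ln (t - 2) / 2 - a) \<le> exp (?l j)" by simp
    also have "exp (?l j) = cmod (L j t)" using nz[OF t] by simp
    also have "ln (t - 2) / 2 = ln (sqrt (t - 2))" using t by (simp add: ln_sqrt)
    also have "exp (ln (sqrt (t - 2)) - a) = exp (- a) * sqrt (t - 2)"
      using t by (simp add: exp_diff exp_minus field_simps)
    finally show ?thesis .
  qed
  obtain K where K: "K > 0" "\<And>s t. s \<in> {2<..3} \<Longrightarrow> t \<in> {2<..3} \<Longrightarrow> cmod (L j s - L j t) \<le> K * \<bar>s - t\<bar>"
    using L_lipschitz[OF j(1,2)] by blast
  \<comment> \<open>Small enough that the variation K u over the interval is at most half of the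
    lower bound at 2 + u.\<close>
  define u where "u = min 1 ((exp (- a) / (2 * K))\<^sup>2)"
  have u: "0 < u" "u \<le> 1" using K by (auto simp: u_def)
  have "sqrt u \<le> sqrt ((exp (- a) / (2 * K))\<^sup>2)" unfolding u_def by (intro real_sqrt_le_mono) simp
  also have "\<dots> = exp (- a) / (2 * K)" using K by simp
  finally have "K * sqrt u \<le> exp (- a) / 2" using K by (simp add: field_simps)
  then have "(K * sqrt u) * sqrt u \<le> (exp (- a) / 2) * sqrt u" using u by (intro mult_right_mono) auto
  then have Ku: "K * u \<le> exp (- a) * sqrt u / 2" using u by (simp add: mult.assoc)
  have "exp (- a) * sqrt u / 2 \<le> cmod (L j t)" if t: "2 < t" "t < 2 + u" for t
  proof -
    have "cmod (L j (2 + u) - L j t) \<le> K * \<bar>2 + u - t\<bar>" using t u by (intro K) auto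
    also have "\<dots> \<le> K * u" using K t by (intro mult_left_mono) auto
    also note Ku
    finally have "cmod (L j (2 + u)) - cmod (L j t) \<le> exp (- a) * sqrt u / 2"
      using norm_triangle_ineq2[of "L j (2 + u)" "L j t"] by linarith
    then show ?thesis using sqrt_le[of "2 + u"] u by simp
  qed
  then have "\<forall>\<^sub>F t in at_right 2. exp (- a) * sqrt u / 2 \<le> cmod (L j t)"
    unfolding eventually_at_right_field using u by (intro exI[of _ "2 + u"]) auto
  moreover have "exp (- a) * sqrt u / 2 > 0" using u by simp
  ultimately show ?thesis by blast
qed

lemma exists_prO_index_generator:
  "\<exists>q. prO q \<and> \<not> of_nat p dvO q \<and> (ind q = 1 \<or> ind q = p)"
proof (rule ccontr)
  assume none: "\<not> ?thesis"
  let ?n = "p + 1"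
  obtain K where K: "\<And>t. t \<in> {2<..3} \<Longrightarrow> \<exists>F. finite F \<and> F \<subseteq> PP \<and>
     (\<forall>j. L j t \<noteq> 0 \<and> \<bar>ln (cmod (L j t)) - (\<Sum>q\<in>F. Re (lterm j t q))\<bar> \<le> K)"
    using log_L_prime_sum by blast
  have nz: "L j t \<noteq> 0" if "t \<in> {2<..3}" for j t using K[OF that] by blast
  \<comment> \<open>The set F is common to all j, so the sums over characters and primes can be
    exchanged. Plain summation gives the lower bound; the cosine weights annihilate every prime term
    and give the upper one.\<close>
  have lower: "- (real ?n * K) \<le> (\<Sum>j<?n. ln (cmod (L j t)))"
    and upper: "(\<Sum>j<?n. cos (2 * pi / real ?n * real j) * ln (cmod (L j t))) \<le> real ?n * K"
    if t: "t \<in> {2<..3}" for t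
  proof -
    obtain F where F: "finite F" "F \<subseteq> PP"
      and near: "\<And>j. \<bar>ln (cmod (L j t)) - (\<Sum>q\<in>F. Re (lterm j t q))\<bar> \<le> K"
      using K[OF t] by blast
    let ?S = "\<lambda>j. \<Sum>q\<in>F. Re (lterm j t q)"
    have "(\<Sum>j<?n. ?S j) = (\<Sum>q\<in>F. \<Sum>j<?n. Re (lterm j t q))" by (rule sum.swap)
    also have "\<dots> \<ge> 0" by (intro sum_nonneg sum_Re_lterm_nonneg)
    finally have S: "(\<Sum>j<?n. ?S j) \<ge> 0" .
    have "(\<Sum>j<?n. ?S j - ln (cmod (L j t))) \<le> real (card {..<?n}) * K"
      using near by (intro sum_bounded_above) (simp add: abs_le_iff)
    then have "(\<Sum>j<?n. ?S j) - (\<Sum>j<?n. ln (cmod (L j t))) \<le> real ?n * K"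
      unfolding sum_subtractf by simp
    with S show "- (real ?n * K) \<le> (\<Sum>j<?n. ln (cmod (L j t)))" by linarith
    let ?c = "\<lambda>j. cos (2 * pi / real ?n * real j)"
    have "(\<Sum>j<?n. ?c j * ?S j) = (\<Sum>q\<in>F. \<Sum>j<?n. ?c j * Re (lterm j t q))"
      unfolding sum_distrib_left by (rule sum.swap)
    also have "\<dots> = (\<Sum>q\<in>F. 0)"
    proof (rule sum.cong)
      fix q assume "q \<in> F"
      then have "prO q" using F PP_prO by blast
      then show "(\<Sum>j<?n. ?c j * Re (lterm j t q)) = 0" using none by (intro sum_cos_Re_lterm) blast
    qed simp
    finally have S0: "(\<Sum>j<?n. ?c j * ?S j) = 0" by simp
    have "(\<Sum>j<?n. ?c j * (ln (cmod (L j t)) - ?S j)) \<le> real (card {..<?n}) * K"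
    proof (rule sum_bounded_above)
      fix j
      have "?c j * (ln (cmod (L j t)) - ?S j) \<le> \<bar>?c j\<bar> * \<bar>ln (cmod (L j t)) - ?S j\<bar>"
        by (simp flip: abs_mult)
      also have "\<dots> \<le> 1 * K" using near[of j] by (intro mult_mono abs_cos_le_one) auto
      finally show "?c j * (ln (cmod (L j t)) - ?S j) \<le> K" by simp
    qed
    then show "(\<Sum>j<?n. ?c j * ln (cmod (L j t))) \<le> real ?n * K"
      using S0 by (simp add: right_diff_distrib sum_subtractf)
  qed
  have "\<forall>j\<in>{1..p}. \<exists>U. \<forall>t\<in>{2<..3}. cmod (L j t) \<le> U" using L_bounded by auto
  then obtain V where V: "\<And>j t. j \<in> {1..p} \<Longrightarrow> t \<in> {2<..3} \<Longrightarrow> cmod (L j t) \<le> V j" by metis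
  define U where "U = 1 + (\<Sum>j\<in>{1..p}. \<bar>V j\<bar>)"
  have U1: "U \<ge> 1" unfolding U_def by (simp add: sum_nonneg)
  have U: "cmod (L j t) \<le> U" if j: "0 < j" "j \<le> p" and t: "t \<in> {2<..3}" for j t
  proof -
    have "\<bar>V j\<bar> \<le> (\<Sum>j\<in>{1..p}. \<bar>V j\<bar>)" using j by (intro member_le_sum) auto
    then show ?thesis using V[of j t] j t unfolding U_def by simp
  qed
  have near2: "\<forall>\<^sub>F t in at_right (2::real). t \<in> {2<..3}"
    unfolding eventually_at_right_field by (intro exI[of _ 3]) auto
  let ?c = "\<lambda>j. cos (2 * pi / real ?n * real j)"
  have "\<exists>D. \<forall>\<^sub>F t in at_right 2. - D \<le> ?c j * ln (cmod (L j t))" if "j \<in> {1..p}" for j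
  proof -
    have j: "0 < j" "j \<le> p" using that by auto
    have lnU: "ln (cmod (L j t)) \<le> ln U" if "t \<in> {2<..3}" for t
      using U[OF j that] nz[OF that] U1 by (subst ln_le_cancel_iff) auto
    show ?thesis
    proof (cases "2 * j = ?n")
      case True
      \<comment> \<open>The quadratic character: its weight is cos pi = -1, so the upper bound on
        |L| suffices and a zero would do no harm.\<close>
      then have "real ?n = 2 * real j" by (simp flip: True)
      then have "?c j = - 1" using j by simp
      then have "\<forall>\<^sub>F t in at_right 2. - ln U \<le> ?c j * ln (cmod (L j t))"
        using near2 lnU by (intro eventually_mono[OF near2]) simp
      then show ?thesis by blast
    next
      case False
      obtain d where d: "d > 0" "\<forall>\<^sub>F t in at_right 2. d \<le> cmod (L j t)"
        using L_bounded_below[OF j False lower nz U1 U] by blast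
      from near2 d(2) have "\<forall>\<^sub>F t in at_right 2. - (\<bar>ln U\<bar> + \<bar>ln d\<bar>) \<le> ?c j * ln (cmod (L j t))"
      proof eventually_elim
        case (elim t)
        have "ln d \<le> ln (cmod (L j t))" using elim d by (subst ln_le_cancel_iff) auto
        then have "\<bar>ln (cmod (L j t))\<bar> \<le> \<bar>ln U\<bar> + \<bar>ln d\<bar>" using lnU[OF elim(1)] by linarith
        moreover have "\<bar>?c j * ln (cmod (L j t))\<bar> \<le> 1 * \<bar>ln (cmod (L j t))\<bar>"
          unfolding abs_mult by (intro mult_right_mono abs_cos_le_one) auto
        ultimately show ?case by linarith
      qed
      then show ?thesis by blast
    qed
  qed
  then obtain D where "\<And>j. j \<in> {1..p} \<Longrightarrow> \<forall>\<^sub>F t in at_right 2. - D j \<le> ?c j * ln (cmod (L j t))" by metis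
  then have D: "\<forall>\<^sub>F t in at_right 2. \<forall>j\<in>{1..p}. - D j \<le> ?c j * ln (cmod (L j t))"
    by (intro eventually_ball_finite) auto
  \<comment> \<open>The bound on ln |L 0 t| that follows from \<open>upper\<close> once the other
    terms are bounded below; the pole exceeds it.\<close>
  define Z where "Z = real ?n * K + (\<Sum>j\<in>{1..p}. D j)"
  have "\<forall>\<^sub>F t in at_right 2. exp (Z + 1) \<le> cmod (L 0 t)"
    using L0_at_top unfolding filterlim_at_top by blast
  with near2 D have "\<forall>\<^sub>F t in at_right (2::real). False"
  proof eventually_elim
    case (elim t)
    have "{..<?n} = insert 0 {1..p}" by auto
    then have "(\<Sum>j<?n. ?c j * ln (cmod (L j t))) = ln (cmod (L 0 t)) + (\<Sum>j\<in>{1..p}. ?c j * ln (cmod (L j t)))"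
      by simp
    moreover have "(\<Sum>j\<in>{1..p}. - D j) \<le> (\<Sum>j\<in>{1..p}. ?c j * ln (cmod (L j t)))"
      using elim(2) by (intro sum_mono) auto
    ultimately have "ln (cmod (L 0 t)) \<le> Z" using upper[OF elim(1)] by (simp add: Z_def sum_negf)
    moreover have "Z + 1 \<le> ln (cmod (L 0 t))" using elim(3) nz[OF elim(1)] by (subst ln_ge_iff) auto
    ultimately show False by simp
  qed
  then show False by simp
qed

end

subsection \<open>The ring of integers of an imaginary quadratic field\<close>

lemma poly_map_of_int_add:
  "poly (map_poly of_int (f + g)) x = poly (map_poly of_int f) x + poly (map_poly of_int g) (x :: complex)"
  by (induction f g rule: poly_induct2) (simp_all add: map_poly_pCons algebra_simps)

lemma poly_map_of_int_smult:
  "poly (map_poly of_int (smult c f)) x = of_int c * poly (map_poly of_int f) (x :: complex)"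
  by (induction f) (simp_all add: map_poly_pCons algebra_simps)

lemma poly_map_of_int_mult:
  "poly (map_poly of_int (f * g)) x = poly (map_poly of_int f) x * poly (map_poly of_int g) (x :: complex)"
  by (induction f) (simp_all add: map_poly_pCons poly_map_of_int_add poly_map_of_int_smult algebra_simps)

text \<open>Gauss's lemma: the primitive integral multiple of the quadratic minimal polynomial divides a
  monic integral polynomial up to a constant, so its leading coefficient is a unit.\<close>

lemma algebraic_int_trace_norm:
  fixes x :: complex
  assumes "algebraic_int x" "Im x \<noteq> 0" "2 * Re x \<in> \<rat>" "(cmod x)\<^sup>2 \<in> \<rat>"
  shows "2 * Re x \<in> \<int>" "(cmod x)\<^sup>2 \<in> \<int>"
proof -
  obtain a b where ab: "b > 0" "2 * Re x = of_int a / of_int b" using assms(3) by (elim Rats_cases') auto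
  obtain k l where kl: "l > 0" "(cmod x)\<^sup>2 = of_int k / of_int l" using assms(4) by (elim Rats_cases') auto
  \<comment> \<open>The polynomial X^2 - 2 Re(x) X + |x|^2 with denominators cleared.\<close>
  define g0 :: "int poly" where "g0 = [:k * b, - (a * l), b * l:]"
  define g where "g = primitive_part g0"
  define c where "c = Polynomial.content g0"
  let ?ev = "\<lambda>f. poly (map_poly of_int f) x"
  have bl: "b * l \<noteq> 0" using ab kl by simp
  then have g0: "g0 \<noteq> 0" "degree g0 = 2" by (auto simp: g0_def)
  then have g: "g \<noteq> 0" "degree g = 2" "Polynomial.content g = 1" by (auto simp: g_def)
  have c: "c \<noteq> 0" using g0 by (simp add: c_def)
  have sm: "smult c g = g0" by (simp add: c_def g_def)
  have "x * x - of_real (2 * Re x) * x + of_real ((cmod x)\<^sup>2) = 0"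
    unfolding complex_norm_square complex_add_cnj[symmetric] by (simp add: algebra_simps)
  then have "of_int (b * l) * (x * x - of_real (2 * Re x) * x + of_real ((cmod x)\<^sup>2)) = 0" by simp
  also have "of_int (b * l) * (x * x - of_real (2 * Re x) * x + of_real ((cmod x)\<^sup>2)) = ?ev g0"
    unfolding ab(2) kl(2) g0_def using ab(1) kl(1) by (simp add: map_poly_pCons field_simps)
  finally have "of_int c * ?ev g = 0" by (simp flip: sm add: poly_map_of_int_smult)
  then have evg: "?ev g = 0" using c by simp
  obtain f :: "int poly" where f: "?ev f = 0" "lead_coeff f = 1"
    using assms(1) unfolding algebraic_int_altdef_ipoly by blast
  define r where "r = pseudo_mod f g"
  \<comment> \<open>Over the integers division with remainder is possible only after scaling f by
    some nonzero e.\<close>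
  obtain e q where eq: "e \<noteq> 0" "smult e f = g * q + r" and deg: "r = 0 \<or> degree r < degree g"
    using pseudo_mod[OF g(1), of f] unfolding r_def by blast
  have "?ev (smult e f) = ?ev (g * q + r)" by (simp only: eq(2))
  then have evr: "?ev r = 0"
    using f(1) evg by (simp add: poly_map_of_int_smult poly_map_of_int_mult poly_map_of_int_add)
  \<comment> \<open>A polynomial of degree at most 1 with integer coefficients cannot vanish at the
    nonreal x unless it is 0.\<close>
  have "r = 0"
  proof -
    have "degree r \<le> 1" using deg g(2) by auto
    then obtain u v where r: "r = [:u, v:]"
      by (metis degree_eq_zeroE degree_pCons_eq_if le_zero_eq not_less_eq_eq One_nat_def pCons_cases pCons_0_0)
    then have z: "of_int u + of_int v * x = 0" using evr by (simp add: map_poly_pCons mult.commute)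
    have "of_int v * Im x = 0" using arg_cong[OF z, of Im] by simp
    then have "v = 0" using assms(2) by simp
    then show ?thesis using z r by simp
  qed
  then have fg: "smult e f = g * q" using eq(2) by simp
  have "Polynomial.content f dvd lead_coeff f" by (rule content_dvd_coeff)
  then have cf: "Polynomial.content f = 1" unfolding f(2) by (simp only: is_unit_content_iff)
  \<comment> \<open>Both f and g are primitive, so the content of q is |e|; comparing leading
    coefficients then makes that of g a unit.\<close>
  have "Polynomial.content q = \<bar>e\<bar>" using arg_cong[OF fg, of Polynomial.content] g(3) cf by (simp add: content_mult)
  then have "q = smult \<bar>e\<bar> (primitive_part q)" by (metis content_times_primitive_part)
  then have "lead_coeff q = \<bar>e\<bar> * lead_coeff (primitive_part q)" by (metis lead_coeff_smult)
  moreover have "e = lead_coeff g * lead_coeff q" using arg_cong[OF fg, of lead_coeff] f(2)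
    by (simp only: lead_coeff_smult lead_coeff_mult mult_1_right)
  ultimately have "\<bar>e\<bar> = \<bar>e\<bar> * (\<bar>lead_coeff g\<bar> * \<bar>lead_coeff (primitive_part q)\<bar>)"
    by (metis abs_abs abs_mult mult.left_commute)
  then have "\<bar>lead_coeff g\<bar> * \<bar>lead_coeff (primitive_part q)\<bar> = 1" using eq(1) by simp
  then have unit: "\<bar>coeff g 2\<bar> = 1" using g(2) by (simp add: zmult_eq_1_iff abs_if split: if_splits)
  have co: "coeff g0 i = c * coeff g i" for i by (simp flip: sm)
  have c0: "k * b = c * coeff g 0" and c1: "- (a * l) = c * coeff g 1" and c2: "b * l = c * coeff g 2"
    using co[of 0] co[of 1] co[of 2] by (simp_all add: g0_def numeral_2_eq_2)
  have "2 * Re x = of_int (a * l) / of_int (b * l)" unfolding ab(2) using kl(1) by simp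
  also have "a * l = - (c * coeff g 1)" using c1 by simp
  also have "of_int (- (c * coeff g 1)) / of_int (b * l) = (of_int (- (coeff g 1) * coeff g 2) :: real)"
    unfolding c2 using c unit by (auto simp: abs_if split: if_splits)
  finally show "2 * Re x \<in> \<int>" by simp
  have "(cmod x)\<^sup>2 = of_int (k * b) / of_int (b * l)" unfolding kl(2) using ab(1) by simp
  also have "of_int (k * b) / of_int (b * l) = (of_int (coeff g 0 * coeff g 2) :: real)"
    unfolding c0 c2 using c unit by (auto simp: abs_if split: if_splits)
  finally show "(cmod x)\<^sup>2 \<in> \<int>" by simp
qed

text \<open>In lowest terms b = u / v the square of v divides d u^2 and is coprime to u^2, hence
  divides d.\<close>

lemma squarefree_mult_square_int:
  fixes b :: rat
  assumes "squarefree d" "of_int d * b\<^sup>2 \<in> \<int>"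
  shows "b \<in> \<int>"
proof -
  obtain u v where uv: "v > 0" "coprime u v" "b = of_int u / of_int v"
    by (metis quotient_of_coprime quotient_of_denom_pos quotient_of_div surj_pair)
  obtain m where m: "of_int d * b\<^sup>2 = of_int m" using assms(2) by (elim Ints_cases)
  have "of_int (d * u\<^sup>2) = (of_int (m * v\<^sup>2) :: rat)"
    using m uv(1) unfolding uv(3) by (simp add: power_divide field_simps)
  then have "d * u\<^sup>2 = m * v\<^sup>2" by (simp only: of_int_eq_iff)
  then have "v\<^sup>2 dvd d * u\<^sup>2" by simp
  moreover have "coprime (v\<^sup>2) (u\<^sup>2)" using uv(2) by (simp add: coprime_commute)
  ultimately have "v\<^sup>2 dvd d" by (simp add: coprime_dvd_mult_left_iff)
  then have "is_unit v" using assms(1) by (simp add: squarefree_def)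
  then have "v = 1" using uv(1) by simp
  then show ?thesis using uv(3) by simp
qed

locale imaginary_quadratic =
  fixes d :: int
  assumes d_less: "d < - 3" and d_squarefree: "squarefree d"
begin

abbreviation s :: complex where "s \<equiv> csqrt (of_int d)"

lemma s_eq: "s = \<i> * of_real (sqrt (- of_int d))"
  using csqrt_of_real_nonpos[of "of_int d"] d_less by simp

lemma s_simps: "Re s = 0" "Im s = sqrt (- of_int d)" "s * s = of_int d" "cnj s = - s"
proof -
  show "Re s = 0" "Im s = sqrt (- of_int d)" "cnj s = - s" by (simp_all add: s_eq)
  show "s * s = of_int d" using power2_csqrt[of "of_int d"] by (simp add: power2_eq_square)
qed

abbreviation w :: complex where "w \<equiv> quad_omega d"

lemma w_eq: "d mod 4 = 1 \<Longrightarrow> w = (1 + s) / 2" "d mod 4 \<noteq> 1 \<Longrightarrow> w = s"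
  by (simp_all add: quad_omega_def)

text \<open>Since -4 is not squarefree, d is at most -5. The bound 2 leaves Im w > 1 even after
  halving.\<close>

lemma Im_s_gt: "Im s > 2"
proof -
  have "d \<noteq> - 4"
  proof
    assume "d = - 4"
    then have "(2 :: int)\<^sup>2 dvd d" by simp
    then have "is_unit (2 :: int)" using d_squarefree unfolding squarefree_def by blast
    then show False by simp
  qed
  then have "sqrt (2\<^sup>2) < sqrt (- of_int d)" using d_less by (intro real_sqrt_less_mono) simp
  then show ?thesis unfolding s_simps(2) by simp
qed

lemma Im_w_gt: "Im w > 1"
  using Im_s_gt by (cases "d mod 4 = 1") (simp_all add: w_eq del: csqrt.simps)

lemma d_mod_4: "d mod 4 = 1 \<or> d mod 4 = 2 \<or> d mod 4 = 3"
proof -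
  have "d mod 4 \<noteq> 0"
  proof
    assume "d mod 4 = 0"
    then have "(2 :: int)\<^sup>2 dvd d" by auto
    then have "is_unit (2 :: int)" using d_squarefree unfolding squarefree_def by blast
    then show False by simp
  qed
  moreover have "0 \<le> d mod 4" "d mod 4 < 4" by auto
  ultimately show ?thesis by linarith
qed

sublocale quadratic_ints w
proof
  show "Im w > 0" using Im_w_gt by simp
  show "w * w \<in> zspan w"
  proof (cases "d mod 4 = 1")
    case True
    then have "4 dvd d - 1" by presburger
    then obtain k where k: "d - 1 = 4 * k" by (rule dvdE)
    then have d: "d = 4 * k + 1" by simp
    have "(1 + x) / 2 * ((1 + x) / 2) = of_int k + of_int 1 * ((1 + x) / 2)" if "x * x = of_int d" for x :: complex
      using that unfolding d by (simp add: field_simps)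
    from this[OF s_simps(3)] show ?thesis unfolding w_eq(1)[OF True] by (metis zspanI)
  next
    case False
    then have "w * w = of_int d" using s_simps(3) w_eq(2) by simp
    then show ?thesis by simp
  qed
  show "w + cnj w \<in> \<int>"
  proof (cases "d mod 4 = 1")
    case True
    then show ?thesis unfolding w_eq(1)[OF True] using s_simps(4) by (simp add: field_simps del: csqrt.simps)
  next
    case False
    then show ?thesis unfolding w_eq(2)[OF False] using s_simps(4) by simp
  qed
qed

text \<open>Because Im w > 1, a nonzero coefficient of w would already give modulus above 1.\<close>

lemma cmod_1_imp: "y \<in> zspan w \<Longrightarrow> cmod y = 1 \<Longrightarrow> y = 1 \<or> y = - 1"
proof (elim zspanE)
  fix a b assume y: "cmod y = 1" "y = of_int a + of_int b * w"
  have "\<bar>real_of_int b\<bar> * Im w \<le> 1"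
    using abs_Im_le_cmod[of y] y Im_pos by (simp add: abs_mult)
  have "b = 0"
  proof (rule ccontr)
    assume "b \<noteq> 0"
    then have "1 * Im w \<le> \<bar>real_of_int b\<bar> * Im w" using Im_pos by (intro mult_right_mono) auto
    then show False using \<open>\<bar>real_of_int b\<bar> * Im w \<le> 1\<close> Im_w_gt by linarith
  qed
  then have ya: "y = of_int a" using y by simp
  then have "\<bar>real_of_int a\<bar> = 1" using y(1) by (simp only: norm_of_int)
  then have "a = 1 \<or> a = - 1" by linarith
  then show ?thesis unfolding ya by (elim disjE) simp_all
qed

lemma w_in_field: "of_int a + of_int b * w \<in> quadratic_field d"
proof (cases "d mod 4 = 1")
  case True
  have "of_rat (of_int a + of_int b / 2) = (of_int a + of_int b / 2 :: complex)"
    "of_rat (of_int b / 2) = (of_int b / 2 :: complex)"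
    by (simp_all add: of_rat_add of_rat_divide)
  moreover have "of_int a + of_int b * ((1 + x) / 2) = (of_int a + of_int b / 2) + of_int b / 2 * x" for x :: complex
    by (simp add: algebra_simps add_divide_distrib)
  ultimately have "of_int a + of_int b * w = of_rat (of_int a + of_int b / 2) + of_rat (of_int b / 2) * s"
    unfolding w_eq(1)[OF True] by simp
  then show ?thesis unfolding quadratic_field_def by blast
next
  case False
  then have "of_int a + of_int b * w = of_rat (of_int a) + of_rat (of_int b) * s"
    using w_eq(2) by simp
  then show ?thesis unfolding quadratic_field_def by blast
qed

lemma in_imp_algebraic_int: "y \<in> zspan w \<Longrightarrow> algebraic_int y"
proof -
  assume y: "y \<in> zspan w"
  obtain n :: nat where n: "y * cnj y = of_nat n" using norm_int[OF y] by metis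
  obtain t where t: "y + cnj y = of_int t" using real_in_imp_int[of "y + cnj y"] y by auto
  have "y * y - of_int t * y + of_nat n = 0" unfolding t[symmetric] n[symmetric] by (simp add: algebra_simps)
  then have "poly (map_poly of_int [:int n, - t, 1:]) y = 0" by (simp add: map_poly_pCons algebra_simps)
  moreover have "lead_coeff [:int n, - t, 1:] = 1" by simp
  ultimately show ?thesis unfolding algebraic_int_altdef_ipoly by blast
qed

text \<open>Integrality of the trace T and the norm N gives d B^2 = T^2 - 4 N with B = 2 b. As d is
  squarefree, B is an integer, and squares modulo 4 settle the parities.\<close>

lemma algebraic_int_imp_in:
  assumes "x \<in> quadratic_field d" "algebraic_int x" shows "x \<in> zspan w"
proof -
  obtain a b where x: "x = of_rat a + of_rat b * s" using assms(1) by (auto simp: quadratic_field_def)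
  show ?thesis
  proof (cases "b = 0")
    case True
    then have "x \<in> \<rat>" using x by simp
    then have "x \<in> \<int>" using assms(2) rational_algebraic_int_is_int by blast
    then show ?thesis by (elim Ints_cases) simp
  next
    case False
    have of_rat: "of_rat q = complex_of_real (of_rat q)" for q
      by (cases q rule: Rat_cases) (simp add: of_rat_rat)
    have re: "Re x = of_rat a" and im: "Im x = of_rat b * Im s"
      unfolding x of_rat using s_simps(1) by (simp_all del: csqrt.simps)
    have "(Im s)\<^sup>2 = - of_int d" using s_simps(2) d_less by simp
    then have nrm: "(cmod x)\<^sup>2 = of_rat (a\<^sup>2 - of_int d * b\<^sup>2)"
      unfolding cmod_power2 re im by (simp add: power_mult_distrib of_rat_diff of_rat_mult of_rat_power)
    have tr: "2 * Re x = of_rat (2 * a)" unfolding re by (simp add: of_rat_mult)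
    have "Im s \<noteq> 0" using Im_s_gt by linarith
    then have "Im x \<noteq> 0" using False unfolding im by (simp only: mult_eq_0_iff of_rat_eq_0_iff) simp
    then have "2 * Re x \<in> \<int>" "(cmod x)\<^sup>2 \<in> \<int>"
      using algebraic_int_trace_norm[OF assms(2)] unfolding tr nrm by simp_all
    then obtain T N where "of_rat (2 * a) = real_of_int T" "of_rat (a\<^sup>2 - of_int d * b\<^sup>2) = real_of_int N"
      unfolding tr nrm by (elim Ints_cases)
    then have T: "2 * a = of_int T" and N: "a\<^sup>2 - of_int d * b\<^sup>2 = of_int N"
      by (metis of_rat_eq_iff of_rat_of_int_eq)+
    have "of_int d * (2 * b)\<^sup>2 = (2 * a)\<^sup>2 - 4 * (a\<^sup>2 - of_int d * b\<^sup>2)" by (simp add: power_mult_distrib)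
    also have "\<dots> = of_int (T\<^sup>2 - 4 * N)" unfolding T N by simp
    finally have dB: "of_int d * (2 * b)\<^sup>2 = of_int (T\<^sup>2 - 4 * N)" .
    then have "2 * b \<in> \<int>" using squarefree_mult_square_int[OF d_squarefree, of "2 * b"] by simp
    then obtain B where B: "2 * b = of_int B" by (elim Ints_cases)
    have "of_int (d * B\<^sup>2) = (of_int (T\<^sup>2 - 4 * N) :: rat)" using dB unfolding B by simp
    then have eq: "d * B\<^sup>2 = T\<^sup>2 - 4 * N" by (simp only: of_int_eq_iff)
    then have m4: "(d * B\<^sup>2) mod 4 = T\<^sup>2 mod 4" by presburger
    have sq4: "n\<^sup>2 mod 4 = (if even n then 0 else 1)" for n :: int
    proof (cases "even n")
      case True
      then obtain k where "n = 2 * k" by (rule dvdE)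
      then show ?thesis using True by (simp add: power_mult_distrib)
    next
      case False
      then obtain k where "n = 2 * k + 1" by (rule oddE)
      then have "n\<^sup>2 = 1 + (k\<^sup>2 + k) * 4" by (simp add: power2_eq_square algebra_simps)
      then show ?thesis using False by (simp only: mod_mult_self1) simp
    qed
    have m4': "(d mod 4 * (B\<^sup>2 mod 4)) mod 4 = T\<^sup>2 mod 4" using m4 by (simp add: mod_mult_eq)
    have ab: "a = of_int T / 2" "b = of_int B / 2" using T B by simp_all
    show ?thesis
    proof (cases "d mod 4 = 1")
      case True
      then have "even T \<longleftrightarrow> even B" using m4' by (auto simp: sq4 split: if_splits)
      then have "even (T - B)" by simp
      then obtain k where k: "T - B = 2 * k" by (rule evenE)
      then have T': "T = B + 2 * k" by simp
      have r: "of_rat (of_int (B + 2 * k) / 2) = (of_int B / 2 + of_int k :: complex)"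
        "of_rat (of_int B / 2) = (of_int B / 2 :: complex)"
        by (simp_all add: of_rat_divide of_rat_add of_rat_mult add_divide_distrib)
      have "of_int B / 2 + of_int k + of_int B / 2 * y = of_int k + of_int B * ((1 + y) / 2)" for y :: complex
        by (simp add: algebra_simps add_divide_distrib)
      then have "x = of_int k + of_int B * w"
        unfolding x ab T' w_eq(1)[OF True] r .
      then show ?thesis by (metis zspanI)
    next
      case False
      \<comment> \<open>For d congruent to 2 or 3 an odd B would make T^2 congruent to 2 or 3 modulo
        4.\<close>
      then have "even B" "even T" using m4' d_mod_4 by (auto simp: sq4 split: if_splits)
      then obtain k l where "B = 2 * k" "T = 2 * l" by (metis evenE)
      then have "x = of_int l + of_int k * w"
        unfolding x ab w_eq(2)[OF False] by simp
      then show ?thesis by (metis zspanI)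
    qed
  qed
qed

lemma ring_of_integers_eq: "ring_of_integers (quadratic_field d) = complex_ring (zspan w)"
proof -
  have "{x \<in> quadratic_field d. algebraic_int x} = zspan w"
    using algebraic_int_imp_in in_imp_algebraic_int w_in_field by (auto elim!: zspanE)
  then show ?thesis by (simp add: ring_of_integers_def)
qed

section \<open>From class number one to Bezout\<close>

text \<open>With a single class, I is equivalent to the whole ring: a O = b I. Then a = b c with c
  in I, and cancelling b shows that c generates I.\<close>

lemma principal_of_class_number_1:
  assumes cl: "class_number (quadratic_field d) = 1"
    and I: "ideal I (complex_ring (zspan w))" "I \<noteq> {0}"
  shows "\<exists>c\<in>I. \<forall>z\<in>I. dv c z"
proof -
  define R where "R = complex_ring (zspan w)"
  interpret cring R unfolding R_def by (rule cring_O)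
  have Rs: "carrier R = zspan w" "monoid.mult R = (*)" "ring.zero R = 0"
    by (simp_all add: R_def)
  have lc: "a <#\<^bsub>R\<^esub> J = (*) a ` J" for a J by (auto simp: l_coset_def Rs)
  have nzI: "I \<in> nonzero_ideals R" using I by (simp add: nonzero_ideals_def R_def)
  have "zspan w \<noteq> {0}" using one_in_zspan[of w] by (metis singletonD zero_neq_one)
  then have nzO: "zspan w \<in> nonzero_ideals R" using oneideal by (simp add: nonzero_ideals_def Rs)
  have "card (nonzero_ideals R // ideal_class_rel R) = 1"
    using cl by (simp add: class_number_def ring_of_integers_eq ideal_classes_def R_def)
  then obtain T where T: "nonzero_ideals R // ideal_class_rel R = {T}" by (rule card_1_singletonE)
  have "ideal_class_rel R `` {I} \<in> nonzero_ideals R // ideal_class_rel R" by (rule quotientI[OF nzI])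
  moreover have "ideal_class_rel R `` {zspan w} \<in> nonzero_ideals R // ideal_class_rel R" by (rule quotientI[OF nzO])
  ultimately have "ideal_class_rel R `` {I} = ideal_class_rel R `` {zspan w}" unfolding T by simp
  \<comment> \<open>Checked directly with a = b = 1. Equality of the two images then carries I into
    the image of the whole ring, with no appeal to symmetry or transitivity.\<close>
  moreover have "(I, I) \<in> ideal_class_rel R"
    unfolding ideal_class_rel_def using nzI by (auto simp: Rs intro!: bexI[of _ 1])
  ultimately have "(zspan w, I) \<in> ideal_class_rel R" by blast
  then obtain a b where ab: "a \<in> zspan w" "a \<noteq> 0" "b \<in> zspan w" "b \<noteq> 0" "(*) a ` (zspan w) = (*) b ` I"
    unfolding ideal_class_rel_def by (auto simp: Rs lc)
  have "a * 1 \<in> (*) a ` (zspan w)" by (rule imageI) simp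
  then obtain c where c: "c \<in> I" "a = b * c" unfolding ab(5) by auto
  have "dv c z" if z: "z \<in> I" for z
  proof -
    have "b * z \<in> (*) a ` (zspan w)" unfolding ab(5) using z by blast
    then obtain y where "y \<in> zspan w" "b * z = a * y" by blast
    then have "z = c * y" using c ab(4) by simp
    then show ?thesis using dvI[OF \<open>y \<in> zspan w\<close>, of c] by simp
  qed
  then show ?thesis using c by blast
qed

text \<open>A generator of the ideal x O + y O is the required combination. The pair of zeros is
  treated apart, as only nonzero ideals have a class.\<close>

lemma bezout_of_class_number_1:
  assumes cl: "class_number (quadratic_field d) = 1" and xy: "x \<in> zspan w" "y \<in> zspan w"
  shows "\<exists>u\<in>zspan w. \<exists>v\<in>zspan w. dv (u * x + v * y) x \<and> dv (u * x + v * y) y"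
proof (cases "x = 0 \<and> y = 0")
  case True
  then show ?thesis by (intro bexI[of _ 0]) auto
next
  case False
  define R where "R = complex_ring (zspan w)"
  interpret cring R unfolding R_def by (rule cring_O)
  have Rs: "carrier R = zspan w" "monoid.mult R = (*)" "ring.zero R = 0" "add R = (+)"
    by (simp_all add: R_def)
  define I where "I = PIdl\<^bsub>R\<^esub> x <+>\<^bsub>R\<^esub> PIdl\<^bsub>R\<^esub> y"
  have I: "ideal I R" unfolding I_def using xy by (intro add_ideals cgenideal_ideal) (simp_all add: Rs)
  have mem: "z \<in> I \<longleftrightarrow> (\<exists>u\<in>zspan w. \<exists>v\<in>zspan w. z = u * x + v * y)" for z
    unfolding I_def set_add_def' cgenideal_def by (auto simp: Rs)
  have x: "x \<in> I" unfolding mem by (rule bexI[of _ 1], rule bexI[of _ 0]) simp_all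
  have y: "y \<in> I" unfolding mem by (rule bexI[of _ 0], rule bexI[of _ 1]) simp_all
  from x y have "I \<noteq> {0}" using False by auto
  then obtain c where "c \<in> I" "dv c x" "dv c y"
    using principal_of_class_number_1[OF cl I[unfolded R_def]] x y by blast
  then show ?thesis unfolding mem by metis
qed

end

theorem theorem3p6:
  fixes d :: int and p :: nat
  assumes "d < -3" and "squarefree d"
    and "class_number (quadratic_field d) = 1"
    and "Factorial_Ring.prime p"
    and "inert p (quad_order (quad_omega d))"
  shows "elasticity (quad_order (of_nat p * quad_omega d)) = ereal (1 + real p / 2)"
proof -
  interpret imaginary_quadratic d by unfold_locales (fact assms)+
  have qo: "quad_order (quad_omega d) = complex_ring (zspan (quad_omega d))" by (simp add: quad_order_def zspan_def)
  have mem: "x \<in> PIdl\<^bsub>complex_ring (zspan (quad_omega d))\<^esub> (of_nat p) \<longleftrightarrow> dv (of_nat p) x" for x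
    by (auto simp: cgenideal_def dv_def mult.commute)
  interpret P: primeideal "PIdl\<^bsub>complex_ring (zspan (quad_omega d))\<^esub> (of_nat p)" "complex_ring (zspan (quad_omega d))"
    using assms(5) unfolding inert_def qo .
  \<comment> \<open>Primality of the ideal generated by p, read through \<open>mem\<close>, is
    exactly the divisibility property \<open>p_inert\<close>.\<close>
  interpret inert_quadratic "quad_omega d" p
  proof
    fix x y assume "x \<in> zspan (quad_omega d)" "y \<in> zspan (quad_omega d)" "dv (of_nat p) (x * y)"
    then show "dv (of_nat p) x \<or> dv (of_nat p) y" using P.I_prime[of x y] unfolding mem by simp
  qed (use assms cmod_1_imp bezout_of_class_number_1 in auto)
  obtain ind where "inert_index (quad_omega d) p ind" using exists_index by blast
  then interpret inert_index "quad_omega d" p ind .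
  show ?thesis using exists_prO_index_generator elasticity_eq by blast
qed

end
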